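(* Let $z_1,\dots,z_n\in\mathbb C^\times$ be distinct, let $\lambda_1,\dots,\lambda_n$ be dominant integral weights, $V(\underline\lambda)=V(\lambda_1)\otimes\cdots\otimes V(\lambda_n)$, let $\mu$ be an integral weight, and let $\theta\in\mathfrak h\cong\mathfrak h^*$ be generic, so that the map $$\pi_\theta:\operatorname{Hom}_{\mathfrak g}(M(\theta+\mu),M(\theta)\otimes V(\underline\lambda))\to V(\underline\lambda)_\mu,\qquad\varphi\mapsto(\alpha_\theta\otimes\mathrm{id})(\varphi(v_{\theta+\mu}))$$ is an isomorphism. Consider the action of $\mathcal A(0,z_1,\dots,z_n)$ on $V(\underline\lambda)_\mu$ obtained by transporting along $\pi_\theta$ its action on $\operatorname{Hom}_{\mathfrak g}(M(\theta+\mu),M(\theta)\otimes V(\underline\lambda))$ (by post-composition). This action coincides, via $\psi_\theta$, with the action of $\mathcal A^{trig}_\theta(z_1,\dots,z_n)$ on $V(\underline\lambda)_\mu$; that is, every $a\in\mathcal A(0,z_1,\dots,z_n)$ acts on $V(\underline\lambda)_\mu$ as $\psi_\theta(a)\in\mathcal A^{trig}_\theta(z_1,\dots,z_n)\subset(U\mathfrak g^{\otimes n})^{\mathfrak h}$.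
   Context: $\mathfrak g=\mathfrak n_+\oplus\mathfrak h\oplus\mathfrak n_-$ is a complex simple Lie algebra, $\mathfrak b_-=\mathfrak h\oplus\mathfrak n_-$; $(\cdot,\cdot)$ is a non-degenerate invariant symmetric form identifying $\mathfrak h\cong\mathfrak h^*$, with dual bases $\{x_a\},\{x^a\}$ of $\mathfrak g$. $x^{(i)}$ denotes $x$ in the $i$-th tensor factor; factors of $U\mathfrak g^{\otimes(n+1)}$ are indexed $0,\dots,n$; $\Delta(x)=\sum_ix^{(i)}$. $M(\tau)$ is the Verma module of highest weight $\tau$ with highest weight vector $v_\tau$; $\alpha_\theta:M(\theta)\to\mathbb C$ is the linear map with $\alpha_\theta(v_\theta)=1$ killing all weight vectors of other weights. $V(\lambda)$ is the irreducible $\mathfrak g$-module of highest weight $\lambda$, $V(\underline\lambda)_\mu$ the $\mu$-weight space for the diagonal $\mathfrak h$. The algebra $(U\mathfrak g^{\otimes(n+1)})^{\mathfrak g}$ acts on $M(\theta)\otimes V(\underline\lambda)$ (factor $0$ on $M(\theta)$) commuting with the diagonal $\mathfrak g$. Write $x[-k]=xt^{-k}$. $\mathcal A_{\mathfrak g}\subset U(t^{-1}\mathfrak g[t^{-1}])$ is the centralizer of $\sum_ax^a[-1]x_a[-1]$ (known to be commutative). For distinct $w_0,\dots,w_n\in\mathbb C$, $\mathcal A(w_0,\dots,w_n)\subset(U\mathfrak g^{\otimes(n+1)})^{\mathfrak g}$ is the image of $\mathcal A_{\mathfrak g}$ under $x[-m]\mapsto\sum_i(w_i-c)^{-m}x^{(i)}$,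 any $c\notin\{w_i\}$ (independent of $c$). $U\mathfrak g^{\otimes(n+1)}=(U\mathfrak b_-\otimes U\mathfrak g^{\otimes n})\oplus U\mathfrak g^{\otimes(n+1)}\Delta(\mathfrak n_+)$. For $\theta$ extended to a character of $U\mathfrak b_-$ killing $\mathfrak n_-$, the algebra map $\psi_\theta:(U\mathfrak g^{\otimes(n+1)})^{\mathfrak g}\to(U\mathfrak g^{\otimes n})^{\mathfrak h}$ sends $u$ to $(\theta\otimes\mathrm{id})$ of its component in $U\mathfrak b_-\otimes U\mathfrak g^{\otimes n}$. $\mathcal A^{trig}_\theta(z_1,\dots,z_n)=\psi_\theta(\mathcal A(0,z_1,\dots,z_n))$. *)

theory Defs
  imports Complex_Main "HOL-Algebra.Module" "HOL-Algebra.QuotRing" "HOL-Algebra.Product_Groups"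
begin

section \<open>Complex vector spaces, algebras, quotients, tensor products\<close>

text \<open>The field of complex numbers, both as base ring and as algebra over itself. Complex vector
  spaces and associative algebras are \<open>(complex, _) module\<close> records; for mere vector spaces the
  fields \<open>mult\<close> and \<open>one\<close> carry no meaning.\<close>

definition complex_alg :: "(complex, complex) module" where
  "complex_alg = \<lparr>carrier = UNIV, monoid.mult = (*), one = 1, ring.zero = 0, add = (+), smult = (*)\<rparr>"

definition lspan :: "(complex, 'a, 'z) module_scheme \<Rightarrow> 'a set \<Rightarrow> 'a set" where
  "lspan V S = \<Inter>{H. submodule H complex_alg V \<and> S \<subseteq> H}"

definition left_ideal :: "'a set \<Rightarrow> ('a, 'z) ring_scheme \<Rightarrow> bool" where
  "left_ideal J A \<longleftrightarrow> additive_subgroup J A \<and> (\<forall>a\<in>carrier A. \<forall>x\<in>J. a \<otimes>\<^bsub>A\<^esub> x \<in> J)"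

definition gen_left_ideal :: "('a, 'z) ring_scheme \<Rightarrow> 'a set \<Rightarrow> 'a set" where
  "gen_left_ideal A S = \<Inter>{J. left_ideal J A \<and> S \<subseteq> J}"

text \<open>Quotient of an algebra by a two-sided ideal, or of a vector space by a subspace. This is
  \<^const>\<open>FactRing\<close> with the induced scalar multiplication.\<close>

definition quot :: "(complex, 'a, 'z) module_scheme \<Rightarrow> 'a set \<Rightarrow> (complex, 'a set) module" where
  "quot V N = \<lparr>carrier = a_rcosets\<^bsub>V\<^esub> N, monoid.mult = rcoset_mult V N, one = N +>\<^bsub>V\<^esub> \<one>\<^bsub>V\<^esub>,
     ring.zero = N, add = set_add V, smult = (\<lambda>c X. \<Union>x\<in>X. N +>\<^bsub>V\<^esub> (c \<odot>\<^bsub>V\<^esub> x))\<rparr>"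

definition dirac :: "'x \<Rightarrow> 'x \<Rightarrow> complex" where
  "dirac x = (\<lambda>y. if y = x then 1 else 0)"

definition monoid_algebra :: "('x, 'z) monoid_scheme \<Rightarrow> (complex, 'x \<Rightarrow> complex) module" where
  "monoid_algebra X = \<lparr>carrier = {f. finite {x. f x \<noteq> 0} \<and> {x. f x \<noteq> 0} \<subseteq> carrier X},
     monoid.mult = (\<lambda>f g z. \<Sum>(x, y) | f x \<noteq> 0 \<and> g y \<noteq> 0 \<and> x \<otimes>\<^bsub>X\<^esub> y = z. f x * g y),
     one = dirac \<one>\<^bsub>X\<^esub>, ring.zero = (\<lambda>_. 0), add = (\<lambda>f g x. f x + g x), smult = (\<lambda>c f x. c * f x)\<rparr>"

text \<open>Linear extension of \<open>\<phi>\<close>, given on basis elements \<open>dirac x\<close>.\<close>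

definition lin_ext :: "(complex, 'v, 'z) module_scheme \<Rightarrow> ('x \<Rightarrow> 'v) \<Rightarrow> ('x \<Rightarrow> complex) \<Rightarrow> 'v" where
  "lin_ext V \<phi> f = (\<Oplus>\<^bsub>V\<^esub>x\<in>{x. f x \<noteq> 0}. f x \<odot>\<^bsub>V\<^esub> \<phi> x)"

text \<open>Tensor product of a finite family, as the free vector space on the tuples modulo
  multilinearity. If all \<open>W i\<close> are algebras, the free vector space is the monoid algebra of the
  multiplicative monoid of tuples and the quotient is the tensor product of algebras, with
  factorwise multiplication.\<close>

definition tensor_rels :: "nat set \<Rightarrow> (nat \<Rightarrow> (complex, 'm, 'z) module_scheme) \<Rightarrow> ((nat \<Rightarrow> 'm) \<Rightarrow> complex) set" where
  "tensor_rels I W =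
     (let F = monoid_algebra (product_group I W) in
     {dirac (t(i := x \<oplus>\<^bsub>W i\<^esub> y)) \<ominus>\<^bsub>F\<^esub> (dirac (t(i := x)) \<oplus>\<^bsub>F\<^esub> dirac (t(i := y))) | t i x y.
        t \<in> (\<Pi>\<^sub>E i\<in>I. carrier (W i)) \<and> i \<in> I \<and> x \<in> carrier (W i) \<and> y \<in> carrier (W i)} \<union>
     {dirac (t(i := c \<odot>\<^bsub>W i\<^esub> x)) \<ominus>\<^bsub>F\<^esub> (c \<odot>\<^bsub>F\<^esub> dirac (t(i := x))) | t i x c.
        t \<in> (\<Pi>\<^sub>E i\<in>I. carrier (W i)) \<and> i \<in> I \<and> x \<in> carrier (W i)})"

definition tensor :: "nat set \<Rightarrow> (nat \<Rightarrow> (complex, 'm, 'z) module_scheme) \<Rightarrow> (complex, ((nat \<Rightarrow> 'm) \<Rightarrow> complex) set) module" where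
  "tensor I W = (let F = monoid_algebra (product_group I W) in quot F (lspan F (tensor_rels I W)))"

definition pure :: "nat set \<Rightarrow> (nat \<Rightarrow> (complex, 'm, 'z) module_scheme) \<Rightarrow> (nat \<Rightarrow> 'm) \<Rightarrow> ((nat \<Rightarrow> 'm) \<Rightarrow> complex) set" where
  "pure I W t = (let F = monoid_algebra (product_group I W) in lspan F (tensor_rels I W) +>\<^bsub>F\<^esub> dirac t)"

text \<open>A map on a quotient given by a formula \<open>h\<close> on representatives.\<close>

definition on_classes :: "('a \<Rightarrow> 'b) \<Rightarrow> 'a set \<Rightarrow> 'b" where
  "on_classes h X = the_elem (h ` X)"

text \<open>Left modules \<open>M\<close> over an algebra, with their underlying complex vector space.\<close>

record ('u, 'm) amod = "(complex, 'm) module" +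
  act :: "'u \<Rightarrow> 'm \<Rightarrow> 'm"

text \<open>The cyclic left module \<open>A / J\<close>.\<close>

definition cyclic_module :: "(complex, 'a, 'z) module_scheme \<Rightarrow> 'a set \<Rightarrow> ('a, 'a set) amod" where
  "cyclic_module A J =
     module.extend (quot A J) (amod.fields (\<lambda>u X. \<Union>x\<in>X. J +>\<^bsub>A\<^esub> (u \<otimes>\<^bsub>A\<^esub> x)))"

text \<open>Factorwise action of a tensor product of algebras on a tensor product of modules:
  \<open>(\<Otimes> a\<^sub>i) (\<Otimes> m\<^sub>i) = \<Otimes> a\<^sub>i m\<^sub>i\<close>.\<close>

definition tensor_act :: "nat set \<Rightarrow> (nat \<Rightarrow> ('u, 'm) amod) \<Rightarrow> ((nat \<Rightarrow> 'u) \<Rightarrow> complex) set \<Rightarrow>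
    ((nat \<Rightarrow> 'm) \<Rightarrow> complex) set \<Rightarrow> ((nat \<Rightarrow> 'm) \<Rightarrow> complex) set" where
  "tensor_act I W u X =
     on_classes (\<lambda>f. on_classes
       (lin_ext (tensor I W) (\<lambda>m. lin_ext (tensor I W) (\<lambda>a. pure I W (\<lambda>i\<in>I. act (W i) (a i) (m i))) f)) X) u"


section \<open>Lie algebras and enveloping algebras\<close>

record 'a lie = "(complex, 'a) module" +
  bracket :: "'a \<Rightarrow> 'a \<Rightarrow> 'a"

locale complex_lie_algebra = module complex_alg L for L :: "('a, 'z) lie_scheme" (structure) +
  assumes bracket_closed: "\<lbrakk>x \<in> carrier L; y \<in> carrier L\<rbrakk> \<Longrightarrow> bracket L x y \<in> carrier L"
    and bracket_add_left: "\<lbrakk>x \<in> carrier L; y \<in> carrier L; z \<in> carrier L\<rbrakk> \<Longrightarrow>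
      bracket L (x \<oplus> y) z = bracket L x z \<oplus> bracket L y z"
    and bracket_add_right: "\<lbrakk>x \<in> carrier L; y \<in> carrier L; z \<in> carrier L\<rbrakk> \<Longrightarrow>
      bracket L x (y \<oplus> z) = bracket L x y \<oplus> bracket L x z"
    and bracket_smult_left: "\<lbrakk>x \<in> carrier L; y \<in> carrier L\<rbrakk> \<Longrightarrow>
      bracket L (c \<odot>\<^bsub>L\<^esub> x) y = c \<odot>\<^bsub>L\<^esub> bracket L x y"
    and bracket_smult_right: "\<lbrakk>x \<in> carrier L; y \<in> carrier L\<rbrakk> \<Longrightarrow>
      bracket L x (c \<odot>\<^bsub>L\<^esub> y) = c \<odot>\<^bsub>L\<^esub> bracket L x y"
    and bracket_self: "x \<in> carrier L \<Longrightarrow> bracket L x x = \<zero>"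
    and jacobi: "\<lbrakk>x \<in> carrier L; y \<in> carrier L; z \<in> carrier L\<rbrakk> \<Longrightarrow>
      bracket L x (bracket L y z) \<oplus> bracket L y (bracket L z x) \<oplus> bracket L z (bracket L x y) = \<zero>"

definition lie_ideal :: "'a set \<Rightarrow> ('a, 'z) lie_scheme \<Rightarrow> bool" where
  "lie_ideal I L \<longleftrightarrow> submodule I complex_alg L \<and> (\<forall>x\<in>carrier L. \<forall>y\<in>I. bracket L x y \<in> I)"

locale simple_lie_algebra = complex_lie_algebra +
  assumes finite_dim: "\<exists>S. finite S \<and> S \<subseteq> carrier L \<and> lspan L S = carrier L"
    and nonabelian: "\<exists>x\<in>carrier L. \<exists>y\<in>carrier L. bracket L x y \<noteq> \<zero>"
    and simple: "lie_ideal I L \<Longrightarrow> I = {\<zero>} \<or> I = carrier L"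

definition tensor_alg :: "('a, 'z) lie_scheme \<Rightarrow> (complex, 'a list \<Rightarrow> complex) module" where
  "tensor_alg L = monoid_algebra \<lparr>carrier = lists (carrier L), monoid.mult = (@), one = []\<rparr>"

text \<open>Here \<open>tensor_alg L\<close> is the free associative algebra on the \<^emph>\<open>set\<close> \<open>carrier L\<close>; the linear
  relations of \<open>L\<close> are imposed together with the commutation relations.\<close>

definition env_rels :: "('a, 'z) lie_scheme \<Rightarrow> ('a list \<Rightarrow> complex) set" where
  "env_rels L =
     (let T = tensor_alg L in
     {dirac [x \<oplus>\<^bsub>L\<^esub> y] \<ominus>\<^bsub>T\<^esub> (dirac [x] \<oplus>\<^bsub>T\<^esub> dirac [y]) | x y. x \<in> carrier L \<and> y \<in> carrier L} \<union>
     {dirac [c \<odot>\<^bsub>L\<^esub> x] \<ominus>\<^bsub>T\<^esub> (c \<odot>\<^bsub>T\<^esub> dirac [x]) | c x. x \<in> carrier L} \<union>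
     {((dirac [x] \<otimes>\<^bsub>T\<^esub> dirac [y]) \<ominus>\<^bsub>T\<^esub> (dirac [y] \<otimes>\<^bsub>T\<^esub> dirac [x])) \<ominus>\<^bsub>T\<^esub> dirac [bracket L x y] | x y.
        x \<in> carrier L \<and> y \<in> carrier L})"

type_synonym 'a env = "('a list \<Rightarrow> complex) set"

definition env :: "('a, 'z) lie_scheme \<Rightarrow> (complex, 'a env) module" where
  "env L = quot (tensor_alg L) (Idl\<^bsub>tensor_alg L\<^esub> (env_rels L))"

definition env_inc :: "('a, 'z) lie_scheme \<Rightarrow> 'a \<Rightarrow> 'a env" where
  "env_inc L x = Idl\<^bsub>tensor_alg L\<^esub> (env_rels L) +>\<^bsub>tensor_alg L\<^esub> dirac [x]"

text \<open>The algebra map \<open>U L \<rightarrow> A\<close> extending a Lie map \<open>\<rho> : L \<rightarrow> A\<close>.\<close>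

definition env_lift :: "('a, 'z) lie_scheme \<Rightarrow> (complex, 'b, 'y) module_scheme \<Rightarrow> ('a \<Rightarrow> 'b) \<Rightarrow> 'a env \<Rightarrow> 'b" where
  "env_lift L A \<rho> = on_classes (lin_ext A (\<lambda>w. foldr (\<lambda>x a. \<rho> x \<otimes>\<^bsub>A\<^esub> a) w \<one>\<^bsub>A\<^esub>))"


section \<open>Triangular decomposition and weights\<close>

text \<open>Weights are encoded as elements of \<open>cartan\<close>, through the identification of the Cartan
  subalgebra with its dual given by the form: \<open>\<nu>\<close> stands for the functional \<open>form \<nu>\<close>.
  In particular roots and the base \<open>simple_roots\<close> are sets of elements of \<open>cartan\<close>.\<close>

record 'g tri_lie = "'g lie" +
  form :: "'g \<Rightarrow> 'g \<Rightarrow> complex"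
  cartan :: "'g set"
  simple_roots :: "'g set"

definition root_space :: "'g tri_lie \<Rightarrow> 'g \<Rightarrow> 'g set" where
  "root_space G \<alpha> = {x \<in> carrier G. \<forall>h\<in>cartan G. bracket G h x = form G \<alpha> h \<odot>\<^bsub>G\<^esub> x}"

definition roots :: "'g tri_lie \<Rightarrow> 'g set" where
  "roots G = {\<alpha> \<in> cartan G. \<alpha> \<noteq> \<zero>\<^bsub>G\<^esub> \<and> root_space G \<alpha> \<noteq> {\<zero>\<^bsub>G\<^esub>}}"

definition pos_roots :: "'g tri_lie \<Rightarrow> 'g set" where
  "pos_roots G = {\<alpha> \<in> roots G. \<exists>k :: 'g \<Rightarrow> nat. \<alpha> = (\<Oplus>\<^bsub>G\<^esub>\<beta>\<in>simple_roots G. of_nat (k \<beta>) \<odot>\<^bsub>G\<^esub> \<beta>)}"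

definition n_plus :: "'g tri_lie \<Rightarrow> 'g set" where
  "n_plus G = lspan G (\<Union>\<alpha>\<in>pos_roots G. root_space G \<alpha>)"

definition n_minus :: "'g tri_lie \<Rightarrow> 'g set" where
  "n_minus G = lspan G (\<Union>\<alpha>\<in>pos_roots G. root_space G (\<ominus>\<^bsub>G\<^esub> \<alpha>))"

definition b_minus :: "'g tri_lie \<Rightarrow> 'g tri_lie" where
  "b_minus G = G\<lparr>carrier := cartan G <+>\<^bsub>G\<^esub> n_minus G\<rparr>"

locale simple_tri_lie = simple_lie_algebra G for G :: "'g tri_lie" (structure) +
  assumes form_add: "\<lbrakk>x \<in> carrier G; y \<in> carrier G; z \<in> carrier G\<rbrakk> \<Longrightarrow>
      form G (x \<oplus> y) z = form G x z + form G y z"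
    and form_smult: "\<lbrakk>x \<in> carrier G; y \<in> carrier G\<rbrakk> \<Longrightarrow> form G (c \<odot>\<^bsub>G\<^esub> x) y = c * form G x y"
    and form_sym: "\<lbrakk>x \<in> carrier G; y \<in> carrier G\<rbrakk> \<Longrightarrow> form G x y = form G y x"
    and form_invariant: "\<lbrakk>x \<in> carrier G; y \<in> carrier G; z \<in> carrier G\<rbrakk> \<Longrightarrow>
      form G (bracket G x y) z = form G x (bracket G y z)"
    and form_nondegenerate: "\<lbrakk>x \<in> carrier G; \<And>y. y \<in> carrier G \<Longrightarrow> form G x y = 0\<rbrakk> \<Longrightarrow> x = \<zero>"
    and cartan_subspace: "submodule (cartan G) complex_alg G"
    and cartan_self_centralizing: "root_space G \<zero> = cartan G"
    and cartan_diagonalizable: "lspan G (\<Union>\<alpha>\<in>cartan G. root_space G \<alpha>) = carrier G"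
    and base_finite: "finite (simple_roots G)"
    and base_roots: "simple_roots G \<subseteq> roots G"
    and base_independent: "\<lbrakk>(\<Oplus>\<beta>\<in>simple_roots G. k \<beta> \<odot>\<^bsub>G\<^esub> \<beta>) = \<zero>; \<beta> \<in> simple_roots G\<rbrakk> \<Longrightarrow> k \<beta> = 0"
    and base_generates: "\<alpha> \<in> roots G \<Longrightarrow> \<alpha> \<in> pos_roots G \<or> \<ominus> \<alpha> \<in> pos_roots G"

text \<open>The pairing of \<open>\<nu>\<close> with the coroot of \<open>\<beta>\<close> is \<open>2 (\<nu>, \<beta>) / (\<beta>, \<beta>)\<close>.\<close>

definition integral_weight :: "'g tri_lie \<Rightarrow> 'g \<Rightarrow> bool" where
  "integral_weight G \<nu> \<longleftrightarrow> \<nu> \<in> cartan G \<and>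
     (\<forall>\<beta>\<in>simple_roots G. \<exists>k :: int. 2 * form G \<nu> \<beta> / form G \<beta> \<beta> = of_int k)"

definition dominant_integral_weight :: "'g tri_lie \<Rightarrow> 'g \<Rightarrow> bool" where
  "dominant_integral_weight G \<nu> \<longleftrightarrow> \<nu> \<in> cartan G \<and>
     (\<forall>\<beta>\<in>simple_roots G. \<exists>k :: nat. 2 * form G \<nu> \<beta> / form G \<beta> \<beta> = of_nat k)"

definition dual_bases :: "'g tri_lie \<Rightarrow> nat \<Rightarrow> (nat \<Rightarrow> 'g) \<Rightarrow> (nat \<Rightarrow> 'g) \<Rightarrow> bool" where
  "dual_bases G d xl xu \<longleftrightarrow> xl ` {..<d} \<subseteq> carrier G \<and> xu ` {..<d} \<subseteq> carrier G \<and>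
     lspan G (xl ` {..<d}) = carrier G \<and> lspan G (xu ` {..<d}) = carrier G \<and>
     (\<forall>a<d. \<forall>b<d. form G (xl a) (xu b) = (if a = b then 1 else 0))"

text \<open>For a vector space \<open>M\<close> with a \<open>G\<close>-action \<open>\<rho>\<close>.\<close>

definition weight_space :: "'g tri_lie \<Rightarrow> (complex, 'm, 'z) module_scheme \<Rightarrow> ('g \<Rightarrow> 'm \<Rightarrow> 'm) \<Rightarrow> 'g \<Rightarrow> 'm set" where
  "weight_space G M \<rho> \<nu> = {v \<in> carrier M. \<forall>h\<in>cartan G. \<rho> h v = form G \<nu> h \<odot>\<^bsub>M\<^esub> v}"

definition linear_map :: "(complex, 'm, 'z) module_scheme \<Rightarrow> (complex, 'k, 'y) module_scheme \<Rightarrow> ('m \<Rightarrow> 'k) \<Rightarrow> bool" where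
  "linear_map M N \<phi> \<longleftrightarrow> \<phi> \<in> carrier M \<rightarrow> carrier N \<and>
     (\<forall>x\<in>carrier M. \<forall>y\<in>carrier M. \<phi> (x \<oplus>\<^bsub>M\<^esub> y) = \<phi> x \<oplus>\<^bsub>N\<^esub> \<phi> y) \<and>
     (\<forall>c. \<forall>x\<in>carrier M. \<phi> (c \<odot>\<^bsub>M\<^esub> x) = c \<odot>\<^bsub>N\<^esub> \<phi> x)"

text \<open>Homomorphisms are taken extensional, so that they are determined by their values on
  \<open>carrier M\<close>.\<close>

definition lie_hom :: "'g tri_lie \<Rightarrow> (complex, 'm, 'z) module_scheme \<Rightarrow> ('g \<Rightarrow> 'm \<Rightarrow> 'm) \<Rightarrow>
    (complex, 'k, 'y) module_scheme \<Rightarrow> ('g \<Rightarrow> 'k \<Rightarrow> 'k) \<Rightarrow> ('m \<Rightarrow> 'k) set" where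
  "lie_hom G M \<rho> N \<sigma> = {\<phi> \<in> extensional (carrier M). linear_map M N \<phi> \<and>
     (\<forall>x\<in>carrier G. \<forall>m\<in>carrier M. \<phi> (\<rho> x m) = \<sigma> x (\<phi> m))}"


section \<open>Verma modules and irreducible highest weight modules\<close>

definition verma_ideal :: "'g tri_lie \<Rightarrow> 'g \<Rightarrow> 'g env set" where
  "verma_ideal G \<tau> = gen_left_ideal (env G) (env_inc G ` n_plus G \<union>
     {env_inc G h \<ominus>\<^bsub>env G\<^esub> (form G \<tau> h \<odot>\<^bsub>env G\<^esub> \<one>\<^bsub>env G\<^esub>) | h. h \<in> cartan G})"

definition verma :: "'g tri_lie \<Rightarrow> 'g \<Rightarrow> ('g env, 'g env set) amod" where
  "verma G \<tau> = cyclic_module (env G) (verma_ideal G \<tau>)"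

definition verma_vec :: "'g tri_lie \<Rightarrow> 'g \<Rightarrow> 'g env set" where
  "verma_vec G \<tau> = verma_ideal G \<tau> +>\<^bsub>env G\<^esub> \<one>\<^bsub>env G\<^esub>"

text \<open>\<open>V \<nu>\<close> is the quotient of the Verma module by the sum of its proper submodules, written as
  quotient of the enveloping algebra by the corresponding left ideal.\<close>

definition irrep :: "'g tri_lie \<Rightarrow> 'g \<Rightarrow> ('g env, 'g env set) amod" where
  "irrep G \<nu> = cyclic_module (env G) (gen_left_ideal (env G)
     (\<Union>{J. left_ideal J (env G) \<and> verma_ideal G \<nu> \<subseteq> J \<and> J \<noteq> carrier (env G)}))"

definition verma_functional :: "'g tri_lie \<Rightarrow> 'g \<Rightarrow> ('g env set \<Rightarrow> complex) \<Rightarrow> bool" where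
  "verma_functional G \<theta> \<alpha> \<longleftrightarrow> linear_map (verma G \<theta>) complex_alg \<alpha> \<and> \<alpha> (verma_vec G \<theta>) = 1 \<and>
     (\<forall>\<nu>\<in>cartan G. \<nu> \<noteq> \<theta> \<longrightarrow>
       (\<forall>m\<in>weight_space G (verma G \<theta>) (\<lambda>x. act (verma G \<theta>) (env_inc G x)) \<nu>. \<alpha> m = 0))"


section \<open>Tensor powers of the enveloping algebra\<close>

abbreviation env_pow :: "'g tri_lie \<Rightarrow> nat set \<Rightarrow> (complex, ((nat \<Rightarrow> 'g env) \<Rightarrow> complex) set) module" where
  "env_pow G I \<equiv> tensor I (\<lambda>_. env G)"

text \<open>The element \<open>x\<^sup>(\<^sup>i\<^sup>)\<close>.\<close>

definition factor :: "'g tri_lie \<Rightarrow> nat set \<Rightarrow> nat \<Rightarrow> 'g \<Rightarrow> ((nat \<Rightarrow> 'g env) \<Rightarrow> complex) set" where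
  "factor G I i x = pure I (\<lambda>_. env G) (\<lambda>j\<in>I. if j = i then env_inc G x else \<one>\<^bsub>env G\<^esub>)"

definition diag :: "'g tri_lie \<Rightarrow> nat set \<Rightarrow> 'g \<Rightarrow> ((nat \<Rightarrow> 'g env) \<Rightarrow> complex) set" where
  "diag G I x = (\<Oplus>\<^bsub>env_pow G I\<^esub>i\<in>I. factor G I i x)"

definition irreps :: "'g tri_lie \<Rightarrow> (nat \<Rightarrow> 'g) \<Rightarrow> nat \<Rightarrow> ('g env, 'g env set) amod" where
  "irreps G lam = (\<lambda>i. irrep G (lam i))"

text \<open>The factors of \<open>M \<theta> \<otimes> V\<close>, with \<open>M \<theta>\<close> in position 0.\<close>

definition verma_irreps :: "'g tri_lie \<Rightarrow> 'g \<Rightarrow> (nat \<Rightarrow> 'g) \<Rightarrow> nat \<Rightarrow> ('g env, 'g env set) amod" where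
  "verma_irreps G \<theta> lam = (\<lambda>i. if i = 0 then verma G \<theta> else irrep G (lam i))"

definition V_weight :: "'g tri_lie \<Rightarrow> nat \<Rightarrow> (nat \<Rightarrow> 'g) \<Rightarrow> 'g \<Rightarrow> ((nat \<Rightarrow> 'g env set) \<Rightarrow> complex) set set" where
  "V_weight G n lam \<mu> = weight_space G (tensor {1..n} (irreps G lam))
     (\<lambda>x. tensor_act {1..n} (irreps G lam) (diag G {1..n} x)) \<mu>"

definition verma_homs :: "'g tri_lie \<Rightarrow> nat \<Rightarrow> (nat \<Rightarrow> 'g) \<Rightarrow> 'g \<Rightarrow> 'g \<Rightarrow>
    ('g env set \<Rightarrow> ((nat \<Rightarrow> 'g env set) \<Rightarrow> complex) set) set" where
  "verma_homs G n lam \<mu> \<theta> =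
     lie_hom G (verma G (\<theta> \<oplus>\<^bsub>G\<^esub> \<mu>)) (\<lambda>x. act (verma G (\<theta> \<oplus>\<^bsub>G\<^esub> \<mu>)) (env_inc G x))
       (tensor {0..n} (verma_irreps G \<theta> lam))
       (\<lambda>x. tensor_act {0..n} (verma_irreps G \<theta> lam) (diag G {0..n} x))"

text \<open>\<open>\<alpha> \<otimes> id : M \<theta> \<otimes> V \<rightarrow> V\<close>\<close>

definition functional_id :: "'g tri_lie \<Rightarrow> nat \<Rightarrow> (nat \<Rightarrow> 'g) \<Rightarrow> ('g env set \<Rightarrow> complex) \<Rightarrow>
    ((nat \<Rightarrow> 'g env set) \<Rightarrow> complex) set \<Rightarrow> ((nat \<Rightarrow> 'g env set) \<Rightarrow> complex) set" where
  "functional_id G n lam \<alpha> = (let V = tensor {1..n} (irreps G lam) in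
     on_classes (lin_ext V (\<lambda>t. \<alpha> (t 0) \<odot>\<^bsub>V\<^esub> pure {1..n} (irreps G lam) (restrict t {1..n}))))"

definition pi_map :: "'g tri_lie \<Rightarrow> nat \<Rightarrow> (nat \<Rightarrow> 'g) \<Rightarrow> 'g \<Rightarrow> 'g \<Rightarrow> ('g env set \<Rightarrow> complex) \<Rightarrow>
    ('g env set \<Rightarrow> ((nat \<Rightarrow> 'g env set) \<Rightarrow> complex) set) \<Rightarrow> ((nat \<Rightarrow> 'g env set) \<Rightarrow> complex) set" where
  "pi_map G n lam \<mu> \<theta> \<alpha> \<phi> = functional_id G n lam \<alpha> (\<phi> (verma_vec G (\<theta> \<oplus>\<^bsub>G\<^esub> \<mu>)))"

definition post_comp :: "'g tri_lie \<Rightarrow> nat \<Rightarrow> (nat \<Rightarrow> 'g) \<Rightarrow> 'g \<Rightarrow> 'g \<Rightarrow> ((nat \<Rightarrow> 'g env) \<Rightarrow> complex) set \<Rightarrow>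
    ('g env set \<Rightarrow> ((nat \<Rightarrow> 'g env set) \<Rightarrow> complex) set) \<Rightarrow> 'g env set \<Rightarrow> ((nat \<Rightarrow> 'g env set) \<Rightarrow> complex) set" where
  "post_comp G n lam \<mu> \<theta> a \<phi> =
     (\<lambda>m\<in>carrier (verma G (\<theta> \<oplus>\<^bsub>G\<^esub> \<mu>)). tensor_act {0..n} (verma_irreps G \<theta> lam) a (\<phi> m))"

definition transported_act :: "'g tri_lie \<Rightarrow> nat \<Rightarrow> (nat \<Rightarrow> 'g) \<Rightarrow> 'g \<Rightarrow> 'g \<Rightarrow> ('g env set \<Rightarrow> complex) \<Rightarrow>
    ((nat \<Rightarrow> 'g env) \<Rightarrow> complex) set \<Rightarrow> ((nat \<Rightarrow> 'g env set) \<Rightarrow> complex) set \<Rightarrow> ((nat \<Rightarrow> 'g env set) \<Rightarrow> complex) set" where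
  "transported_act G n lam \<mu> \<theta> \<alpha> a v = pi_map G n lam \<mu> \<theta> \<alpha>
     (post_comp G n lam \<mu> \<theta> a (inv_into (verma_homs G n lam \<mu> \<theta>) (pi_map G n lam \<mu> \<theta> \<alpha>) v))"


section \<open>Gaudin algebras\<close>

text \<open>\<open>t\<^sup>-\<^sup>1 L[t\<^sup>-\<^sup>1]\<close>: the value \<open>f k\<close> is the coefficient of \<open>t\<close> to the power \<open>-k\<close>.\<close>

definition loop_minus :: "('a, 'z) lie_scheme \<Rightarrow> (nat \<Rightarrow> 'a) lie" where
  "loop_minus L = \<lparr>carrier = {f. range f \<subseteq> carrier L \<and> f 0 = \<zero>\<^bsub>L\<^esub> \<and> finite {k. f k \<noteq> \<zero>\<^bsub>L\<^esub>}},
     monoid.mult = undefined, one = undefined, ring.zero = (\<lambda>_. \<zero>\<^bsub>L\<^esub>),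
     add = (\<lambda>f g k. f k \<oplus>\<^bsub>L\<^esub> g k), smult = (\<lambda>c f k. c \<odot>\<^bsub>L\<^esub> f k),
     bracket = (\<lambda>f g k. \<Oplus>\<^bsub>L\<^esub>i\<in>{..k}. bracket L (f i) (g (k - i)))\<rparr>"

text \<open>\<open>x[-k]\<close>\<close>

definition loop_elem :: "('a, 'z) lie_scheme \<Rightarrow> 'a \<Rightarrow> nat \<Rightarrow> nat \<Rightarrow> 'a" where
  "loop_elem L x k = (\<lambda>m. if m = k then x else \<zero>\<^bsub>L\<^esub>)"

definition quadratic_elem :: "'g tri_lie \<Rightarrow> nat \<Rightarrow> (nat \<Rightarrow> 'g) \<Rightarrow> (nat \<Rightarrow> 'g) \<Rightarrow> (nat \<Rightarrow> 'g) env" where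
  "quadratic_elem G d xl xu = (let U = env (loop_minus G) in
     \<Oplus>\<^bsub>U\<^esub>a\<in>{..<d}. env_inc (loop_minus G) (loop_elem G (xu a) 1) \<otimes>\<^bsub>U\<^esub>
       env_inc (loop_minus G) (loop_elem G (xl a) 1))"

definition universal_gaudin :: "'g tri_lie \<Rightarrow> nat \<Rightarrow> (nat \<Rightarrow> 'g) \<Rightarrow> (nat \<Rightarrow> 'g) \<Rightarrow> (nat \<Rightarrow> 'g) env set" where
  "universal_gaudin G d xl xu = (let U = env (loop_minus G); q = quadratic_elem G d xl xu in
     {u \<in> carrier U. u \<otimes>\<^bsub>U\<^esub> q = q \<otimes>\<^bsub>U\<^esub> u})"

text \<open>The algebra map determined by \<open>x[-m] \<mapsto> \<Sum>\<^sub>i (w\<^sub>i - c)\<^sup>-\<^sup>m x\<^sup>(\<^sup>i\<^sup>)\<close>.\<close>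

definition gaudin_eval :: "'g tri_lie \<Rightarrow> nat \<Rightarrow> (nat \<Rightarrow> complex) \<Rightarrow> complex \<Rightarrow> (nat \<Rightarrow> 'g) env \<Rightarrow>
    ((nat \<Rightarrow> 'g env) \<Rightarrow> complex) set" where
  "gaudin_eval G n w c = (let A = env_pow G {0..n} in
     env_lift (loop_minus G) A (\<lambda>f. \<Oplus>\<^bsub>A\<^esub>m\<in>{m. f m \<noteq> \<zero>\<^bsub>G\<^esub>}. \<Oplus>\<^bsub>A\<^esub>i\<in>{0..n}.
       (1 / (w i - c) ^ m) \<odot>\<^bsub>A\<^esub> factor G {0..n} i (f m)))"

text \<open>The image does not depend on the auxiliary point \<open>c\<close>, which must avoid all \<open>w i\<close>.\<close>

definition gaudin :: "'g tri_lie \<Rightarrow> nat \<Rightarrow> (nat \<Rightarrow> 'g) \<Rightarrow> (nat \<Rightarrow> 'g) \<Rightarrow> nat \<Rightarrow> (nat \<Rightarrow> complex) \<Rightarrow> complex \<Rightarrow>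
    ((nat \<Rightarrow> 'g env) \<Rightarrow> complex) set set" where
  "gaudin G d xl xu n w c = gaudin_eval G n w c ` universal_gaudin G d xl xu"


section \<open>The map to the trigonometric Gaudin algebra\<close>

text \<open>The factors of the abstract tensor product \<open>U \<bb>\<^sub>- \<otimes> U \<gg>\<^sup>\<otimes>\<^sup>n\<close>, and its map \<open>b_incl\<close> to
  \<open>U \<gg>\<^sup>\<otimes>\<^sup>(\<^sup>n\<^sup>+\<^sup>1\<^sup>)\<close>.\<close>

definition b_env_factors :: "'g tri_lie \<Rightarrow> nat \<Rightarrow> (complex, 'g env) module" where
  "b_env_factors G = (\<lambda>i. if i = 0 then env (b_minus G) else env G)"

definition b_incl :: "'g tri_lie \<Rightarrow> nat \<Rightarrow> ((nat \<Rightarrow> 'g env) \<Rightarrow> complex) set \<Rightarrow> ((nat \<Rightarrow> 'g env) \<Rightarrow> complex) set" where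
  "b_incl G n = on_classes (lin_ext (env_pow G {0..n})
     (\<lambda>t. pure {0..n} (\<lambda>_. env G) (t(0 := env_lift (b_minus G) (env G) (env_inc G) (t 0)))))"

text \<open>\<open>\<theta>\<close> as a character of \<open>U \<bb>\<^sub>-\<close>, zero on \<open>\<nn>\<^sub>-\<close>.\<close>

definition b_char :: "'g tri_lie \<Rightarrow> 'g \<Rightarrow> 'g env \<Rightarrow> complex" where
  "b_char G \<theta> = env_lift (b_minus G) complex_alg
     (\<lambda>x. THE r. \<exists>h\<in>cartan G. \<exists>y\<in>n_minus G. x = h \<oplus>\<^bsub>G\<^esub> y \<and> r = form G \<theta> h)"

definition char_id :: "'g tri_lie \<Rightarrow> nat \<Rightarrow> 'g \<Rightarrow> ((nat \<Rightarrow> 'g env) \<Rightarrow> complex) set \<Rightarrow> ((nat \<Rightarrow> 'g env) \<Rightarrow> complex) set" where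
  "char_id G n \<theta> = (let A = env_pow G {1..n} in
     on_classes (lin_ext A (\<lambda>t. b_char G \<theta> (t 0) \<odot>\<^bsub>A\<^esub> pure {1..n} (\<lambda>_. env G) (restrict t {1..n}))))"

text \<open>\<open>SOME\<close> picks the component of \<open>u\<close> along the decomposition
  \<open>(U \<bb>\<^sub>- \<otimes> U \<gg>\<^sup>\<otimes>\<^sup>n) \<oplus> U \<gg>\<^sup>\<otimes>\<^sup>(\<^sup>n\<^sup>+\<^sup>1\<^sup>) \<Delta>(\<nn>\<^sub>+)\<close>; it is unique since the sum is direct.\<close>

definition b_component :: "'g tri_lie \<Rightarrow> nat \<Rightarrow> ((nat \<Rightarrow> 'g env) \<Rightarrow> complex) set \<Rightarrow> ((nat \<Rightarrow> 'g env) \<Rightarrow> complex) set" where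
  "b_component G n u = (SOME p. p \<in> carrier (tensor {0..n} (b_env_factors G)) \<and>
     (\<exists>q \<in> gen_left_ideal (env_pow G {0..n}) (diag G {0..n} ` n_plus G).
        u = b_incl G n p \<oplus>\<^bsub>env_pow G {0..n}\<^esub> q))"

text \<open>\<open>psi\<close> is written for all \<open>u\<close>; it is an algebra map on the \<open>G\<close>-invariants, with values in the
  \<open>cartan\<close>-invariants.\<close>

definition psi :: "'g tri_lie \<Rightarrow> nat \<Rightarrow> 'g \<Rightarrow> ((nat \<Rightarrow> 'g env) \<Rightarrow> complex) set \<Rightarrow> ((nat \<Rightarrow> 'g env) \<Rightarrow> complex) set" where
  "psi G n \<theta> u = char_id G n \<theta> (b_component G n u)"

text \<open>The parameters \<open>z\<^sub>1, \<dots>, z\<^sub>n\<close> are the values of \<open>z\<close> on \<open>{1..n}\<close>.\<close>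

definition trig_gaudin :: "'g tri_lie \<Rightarrow> nat \<Rightarrow> (nat \<Rightarrow> 'g) \<Rightarrow> (nat \<Rightarrow> 'g) \<Rightarrow> nat \<Rightarrow> 'g \<Rightarrow> (nat \<Rightarrow> complex) \<Rightarrow> complex \<Rightarrow>
    ((nat \<Rightarrow> 'g env) \<Rightarrow> complex) set set" where
  "trig_gaudin G d xl xu n \<theta> z c = psi G n \<theta> ` gaudin G d xl xu n (z(0 := 0)) c"

end

theory Submission
  imports Defs
begin

text \<open>
  Let \<open>\<phi>\<close> correspond to \<open>v\<close> under \<open>\<pi>\<^sub>\<theta>\<close>, and let \<open>X = \<phi> (v\<^sub>\<theta>\<^sub>+\<^sub>\<mu>)\<close>, so that
  \<open>v = (\<alpha> \<otimes> id) X\<close> and, since \<open>\<phi>\<close> is a homomorphism, \<open>X\<close> is annihilated by the diagonal action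
  of \<open>\<nn>\<^sub>+\<close>. The transported action of \<open>a\<close> sends \<open>v\<close> to \<open>(\<alpha> \<otimes> id) (a X)\<close>. Write \<open>a = b + q\<close>
  with \<open>b \<in> U \<bb>\<^sub>- \<otimes> U \<gg>\<^sup>\<otimes>\<^sup>n\<close> and \<open>q\<close> in the left ideal generated by \<open>\<Delta>(\<nn>\<^sub>+)\<close>. Then \<open>q X = 0\<close>. On the other
  hand \<open>\<alpha>\<close> is an eigenfunctional of \<open>\<bb>\<^sub>-\<close>: \<open>\<alpha> (y m) = \<theta>(y) \<alpha> m\<close> for \<open>y \<in> U \<bb>\<^sub>-\<close>, because
  \<open>\<nn>\<^sub>- M(\<theta>)\<close> has only weights different from \<open>\<theta>\<close>. Hence
  \<open>(\<alpha> \<otimes> id) (b X) = (\<theta> \<otimes> id)(b) ((\<alpha> \<otimes> id) X) = \<psi>\<^sub>\<theta>(a) v\<close>.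
  The computation applies to every such pair \<open>(b, q)\<close>, in particular to the one that the choice
  operator in \<^const>\<open>b_component\<close> selects.

  Three inputs carry this argument. The eigenfunctional property is \<open>functional_b_env\<close>; it
  rests on the fact that \<open>M(\<theta>)\<close> is spanned by weight vectors of weights \<open>\<theta> - \<gamma>\<close> with \<open>\<gamma>\<close> a
  nonnegative combination of simple roots. The existence of the decomposition is
  \<open>decomposable_all\<close>. Both come from the spanning statement \<open>env_ordered_span\<close>: words in which the
  letters from \<open>\<bb>\<^sub>-\<close> precede those from \<open>\<nn>\<^sub>+\<close> span \<open>U \<gg>\<close>. Finally, elements of the Gaudin algebra lie in
  \<open>U \<gg>\<^sup>\<otimes>\<^sup>(\<^sup>n\<^sup>+\<^sup>1\<^sup>)\<close> because the evaluation map is induced by a Lie algebra map (\<open>gaudin_carrier\<close>).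

  Quotients, tensor products, enveloping algebras and the maps between them are given by
  formulas on representatives. The first sections establish the corresponding universal properties
  (\<open>on_classes_coset\<close>, the locales \<open>tensor_lift\<close>, \<open>tensor_module\<close> and \<open>env_hom\<close>); afterwards all
  identities between linear maps are checked on pure tensors and on words.
\<close>

section \<open>Complex vector spaces\<close>

lemma complex_alg_simps [simp]:
  "carrier complex_alg = UNIV" "x \<otimes>\<^bsub>complex_alg\<^esub> y = x * y" "\<one>\<^bsub>complex_alg\<^esub> = 1"
  "\<zero>\<^bsub>complex_alg\<^esub> = 0" "x \<oplus>\<^bsub>complex_alg\<^esub> y = x + y" "x \<odot>\<^bsub>complex_alg\<^esub> y = x * y"
  by (simp_all add: complex_alg_def)

lemma complex_alg_cring: "cring complex_alg"
proof (rule cringI)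
  show "abelian_group complex_alg"
    by (rule abelian_groupI) (auto simp: algebra_simps intro: exI[of _ "- _"])
  show "comm_monoid complex_alg"
    by (rule comm_monoidI) (auto simp: algebra_simps)
qed (auto simp: algebra_simps)

locale cvec = module complex_alg V for V :: "(complex, 'v, 'z) module_scheme" (structure)
begin

lemma smult_carrier [simp, intro]: "x \<in> carrier V \<Longrightarrow> c \<odot> x \<in> carrier V"
  by simp

lemma smult_add_left: "x \<in> carrier V \<Longrightarrow> (c + d) \<odot> x = c \<odot> x \<oplus> d \<odot> x"
  using smult_l_distr[of c d x] by simp

lemma smult_add_right: "\<lbrakk>x \<in> carrier V; y \<in> carrier V\<rbrakk> \<Longrightarrow> c \<odot> (x \<oplus> y) = c \<odot> x \<oplus> c \<odot> y"
  using smult_r_distr[of c x y] by simp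

lemma smult_smult: "x \<in> carrier V \<Longrightarrow> c \<odot> (d \<odot> x) = (c * d) \<odot> x"
  using smult_assoc1[of c d x] by simp

lemma smult_1 [simp]: "x \<in> carrier V \<Longrightarrow> 1 \<odot> x = x"
  using smult_one[of x] by simp

lemma smult_0 [simp]: "x \<in> carrier V \<Longrightarrow> 0 \<odot> x = \<zero>"
  using smult_l_null[of x] by simp

lemma smult_zero [simp]: "c \<odot> \<zero> = \<zero>"
  using smult_r_null[of c] by simp

lemma uminus_eq_smult: assumes "x \<in> carrier V" shows "\<ominus> x = (-1) \<odot> x"
proof -
  have "(-1) \<odot> x \<oplus> x = \<zero>"
    using smult_add_left[of x "-1" 1] assms by simp
  then show ?thesis using assms by (metis minus_equality smult_carrier)
qed

lemma uminus_zero [simp]: "\<ominus> \<zero> = \<zero>"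
  by (simp add: uminus_eq_smult)

lemma uminus_eq_zero: assumes "x \<in> carrier V" "\<ominus> x = \<zero>" shows "x = \<zero>"
proof -
  have "x = (-1) \<odot> (\<ominus> x)" using assms(1) by (simp add: uminus_eq_smult smult_smult)
  then show ?thesis using assms(2) by simp
qed

lemma diff_zero_imp_eq:
  assumes "x \<in> carrier V" "y \<in> carrier V" "x \<ominus> y = \<zero>" shows "x = y"
proof -
  have "x = (x \<oplus> \<ominus> y) \<oplus> y" using assms(1,2) by (simp add: M.a_assoc M.l_neg)
  then show ?thesis using assms by (simp add: a_minus_def)
qed

lemma smult_finsum:
  "\<lbrakk>finite S; f \<in> S \<rightarrow> carrier V\<rbrakk> \<Longrightarrow> c \<odot> (\<Oplus>i\<in>S. f i) = (\<Oplus>i\<in>S. c \<odot> f i)"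
  using finsum_smult_ldistr[of S c f] by simp

lemma subspaceI:
  assumes "N \<subseteq> carrier V" "\<zero> \<in> N" "\<And>x y. \<lbrakk>x \<in> N; y \<in> N\<rbrakk> \<Longrightarrow> x \<oplus> y \<in> N"
    and "\<And>c x. x \<in> N \<Longrightarrow> c \<odot> x \<in> N"
  shows "submodule N complex_alg V"
proof (rule submoduleI)
  fix x assume "x \<in> N"
  then show "\<ominus> x \<in> N" using assms uminus_eq_smult by (metis subsetD)
qed (use assms in auto)

lemma submodule_zero: "submodule N complex_alg V \<Longrightarrow> \<zero> \<in> N"
  by (auto dest!: submodule.axioms(1) subgroup.one_closed)

lemma lspan_superset: "S \<subseteq> lspan V S"
  by (auto simp: lspan_def)

lemma lspan_least: "\<lbrakk>submodule N complex_alg V; S \<subseteq> N\<rbrakk> \<Longrightarrow> lspan V S \<subseteq> N"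
  by (auto simp: lspan_def)

lemma lspan_subset: "S \<subseteq> carrier V \<Longrightarrow> lspan V S \<subseteq> carrier V"
  by (rule lspan_least[OF carrier_is_submodule])

lemma lspan_submodule:
  assumes "S \<subseteq> carrier V" shows "submodule (lspan V S) complex_alg V"
proof (rule subspaceI)
  show "lspan V S \<subseteq> carrier V" by (rule lspan_subset[OF assms])
  show "\<zero> \<in> lspan V S"
    unfolding lspan_def by (auto dest!: submodule.axioms(1) subgroup.one_closed)
  show "x \<oplus> y \<in> lspan V S" if "x \<in> lspan V S" "y \<in> lspan V S" for x y
    using that unfolding lspan_def by (auto intro: submoduleE(5))
  show "c \<odot> x \<in> lspan V S" if "x \<in> lspan V S" for c x
    using that unfolding lspan_def by (auto intro: submoduleE(4))
qed

text \<open>Induction along spans. Most spanning arguments below have this form, with a linear condition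
  on \<open>x\<close> that is verified on the spanning set.\<close>

lemma lspan_induct [consumes 2, case_names zero add smult base]:
  assumes "x \<in> lspan V S" "S \<subseteq> carrier V" "P \<zero>"
    and "\<And>x y. \<lbrakk>x \<in> carrier V; y \<in> carrier V; P x; P y\<rbrakk> \<Longrightarrow> P (x \<oplus> y)"
    and "\<And>c x. \<lbrakk>x \<in> carrier V; P x\<rbrakk> \<Longrightarrow> P (c \<odot> x)"
    and "\<And>x. x \<in> S \<Longrightarrow> P x"
  shows "P x"
proof -
  have "submodule {x \<in> carrier V. P x} complex_alg V"
    by (rule subspaceI) (use assms in auto)
  then have "lspan V S \<subseteq> {x \<in> carrier V. P x}"
    by (rule lspan_least) (use assms in auto)
  then show ?thesis using assms(1) by blast
qed

lemma lspan_mono: "S \<subseteq> T \<Longrightarrow> lspan V S \<subseteq> lspan V T"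
  by (auto simp: lspan_def)

end

lemma cvecI:
  fixes V (structure)
  assumes "\<zero> \<in> carrier V" "\<And>x y. \<lbrakk>x \<in> carrier V; y \<in> carrier V\<rbrakk> \<Longrightarrow> x \<oplus> y \<in> carrier V"
    and "\<And>c x. x \<in> carrier V \<Longrightarrow> c \<odot>\<^bsub>V\<^esub> x \<in> carrier V"
    and "\<And>x y z. \<lbrakk>x \<in> carrier V; y \<in> carrier V; z \<in> carrier V\<rbrakk> \<Longrightarrow> x \<oplus> y \<oplus> z = x \<oplus> (y \<oplus> z)"
    and "\<And>x y. \<lbrakk>x \<in> carrier V; y \<in> carrier V\<rbrakk> \<Longrightarrow> x \<oplus> y = y \<oplus> x"
    and "\<And>x. x \<in> carrier V \<Longrightarrow> \<zero> \<oplus> x = x"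
    and "\<And>c d x. x \<in> carrier V \<Longrightarrow> (c + d) \<odot>\<^bsub>V\<^esub> x = c \<odot>\<^bsub>V\<^esub> x \<oplus> d \<odot>\<^bsub>V\<^esub> x"
    and "\<And>c x y. \<lbrakk>x \<in> carrier V; y \<in> carrier V\<rbrakk> \<Longrightarrow> c \<odot>\<^bsub>V\<^esub> (x \<oplus> y) = c \<odot>\<^bsub>V\<^esub> x \<oplus> c \<odot>\<^bsub>V\<^esub> y"
    and "\<And>c d x. x \<in> carrier V \<Longrightarrow> (c * d) \<odot>\<^bsub>V\<^esub> x = c \<odot>\<^bsub>V\<^esub> (d \<odot>\<^bsub>V\<^esub> x)"
    and "\<And>x. x \<in> carrier V \<Longrightarrow> 1 \<odot>\<^bsub>V\<^esub> x = x" and "\<And>x. x \<in> carrier V \<Longrightarrow> 0 \<odot>\<^bsub>V\<^esub> x = \<zero>"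
  shows "cvec V"
proof (intro cvec.intro moduleI)
  show "abelian_group V"
  proof (rule abelian_groupI)
    fix x assume "x \<in> carrier V"
    then show "\<exists>y\<in>carrier V. y \<oplus> x = \<zero>"
      using assms(3)[of x "-1"] assms(7)[of x "-1" 1] assms(10,11)[of x] by force
  qed (use assms in blast)+
qed (use assms complex_alg_cring in auto)

lemma cvec_complex: "cvec complex_alg"
  by (rule cvecI) (auto simp: algebra_simps)

subsection \<open>Linear maps\<close>

lemma linear_mapI:
  assumes "\<And>x. x \<in> carrier M \<Longrightarrow> f x \<in> carrier N"
    and "\<And>x y. \<lbrakk>x \<in> carrier M; y \<in> carrier M\<rbrakk> \<Longrightarrow> f (x \<oplus>\<^bsub>M\<^esub> y) = f x \<oplus>\<^bsub>N\<^esub> f y"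
    and "\<And>c x. x \<in> carrier M \<Longrightarrow> f (c \<odot>\<^bsub>M\<^esub> x) = c \<odot>\<^bsub>N\<^esub> f x"
  shows "linear_map M N f"
  using assms by (auto simp: linear_map_def)

lemma linear_map_closed: "\<lbrakk>linear_map M N f; x \<in> carrier M\<rbrakk> \<Longrightarrow> f x \<in> carrier N"
  by (auto simp: linear_map_def)

lemma linear_map_add:
  "\<lbrakk>linear_map M N f; x \<in> carrier M; y \<in> carrier M\<rbrakk> \<Longrightarrow> f (x \<oplus>\<^bsub>M\<^esub> y) = f x \<oplus>\<^bsub>N\<^esub> f y"
  by (auto simp: linear_map_def)

lemma linear_map_smult:
  "\<lbrakk>linear_map M N f; x \<in> carrier M\<rbrakk> \<Longrightarrow> f (c \<odot>\<^bsub>M\<^esub> x) = c \<odot>\<^bsub>N\<^esub> f x"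
  by (auto simp: linear_map_def)

lemma linear_map_zero:
  assumes "cvec M" "cvec N" "linear_map M N f" shows "f \<zero>\<^bsub>M\<^esub> = \<zero>\<^bsub>N\<^esub>"
proof -
  interpret M: cvec M by fact
  interpret N: cvec N by fact
  have "f (0 \<odot>\<^bsub>M\<^esub> \<zero>\<^bsub>M\<^esub>) = 0 \<odot>\<^bsub>N\<^esub> f \<zero>\<^bsub>M\<^esub>"
    using assms(3) M.zero_closed by (rule linear_map_smult)
  then show ?thesis using linear_map_closed[OF assms(3) M.zero_closed] by simp
qed

lemma linear_map_uminus:
  assumes "cvec M" "cvec N" "linear_map M N f" "x \<in> carrier M"
  shows "f (\<ominus>\<^bsub>M\<^esub> x) = \<ominus>\<^bsub>N\<^esub> f x"
  using assms by (simp add: cvec.uminus_eq_smult linear_map_smult linear_map_closed)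

lemma linear_map_diff:
  assumes "cvec M" "cvec N" "linear_map M N f" "x \<in> carrier M" "y \<in> carrier M"
  shows "f (x \<ominus>\<^bsub>M\<^esub> y) = f x \<ominus>\<^bsub>N\<^esub> f y"
proof -
  interpret M: cvec M by fact
  show ?thesis
    using assms by (simp add: a_minus_def linear_map_add[OF assms(3)] linear_map_uminus)
qed

lemma linear_map_finsum:
  assumes "cvec M" "cvec N" "linear_map M N f" "finite S" "g \<in> S \<rightarrow> carrier M"
  shows "f (\<Oplus>\<^bsub>M\<^esub>i\<in>S. g i) = (\<Oplus>\<^bsub>N\<^esub>i\<in>S. f (g i))"
proof -
  interpret M: cvec M by fact
  interpret N: cvec N by fact
  show ?thesis using assms(4,5)
  proof induction
    case empty
    show ?case using linear_map_zero assms by simp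
  next
    case (insert i S)
    then have "g i \<in> carrier M" "g \<in> S \<rightarrow> carrier M" by auto
    then show ?case using insert
      by (simp add: linear_map_add[OF assms(3)] Pi_iff linear_map_closed[OF assms(3)])
  qed
qed

lemma linear_map_comp:
  "\<lbrakk>linear_map M N f; linear_map N K g\<rbrakk> \<Longrightarrow> linear_map M K (\<lambda>x. g (f x))"
  by (rule linear_mapI) (simp_all add: linear_map_add linear_map_smult linear_map_closed)

lemma linear_map_cong:
  assumes "linear_map M N f" "cvec M" "\<And>x. x \<in> carrier M \<Longrightarrow> f x = g x"
  shows "linear_map M N g"
proof -
  interpret cvec M by fact
  show ?thesis using assms(1,3) by (auto simp: linear_map_def Pi_iff)
qed

lemma linear_map_add_fun:
  assumes "cvec N" "linear_map M N f" "linear_map M N g"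
  shows "linear_map M N (\<lambda>x. f x \<oplus>\<^bsub>N\<^esub> g x)"
proof -
  interpret N: cvec N by fact
  show ?thesis
    using assms(2,3)
    by (auto intro!: linear_mapI simp: linear_map_add linear_map_smult linear_map_closed
        N.smult_add_right N.a_ac)
qed

lemma linear_map_smult_fun:
  assumes "cvec N" "linear_map M N f"
  shows "linear_map M N (\<lambda>x. c \<odot>\<^bsub>N\<^esub> f x)"
proof -
  interpret N: cvec N by fact
  show ?thesis
    using assms(2)
    by (auto intro!: linear_mapI simp: linear_map_add linear_map_smult linear_map_closed
        N.smult_add_right N.smult_smult mult.commute)
qed

lemma linear_map_smult_scalar:
  assumes "cvec N" "linear_map M complex_alg f" "v \<in> carrier N"
  shows "linear_map M N (\<lambda>x. f x \<odot>\<^bsub>N\<^esub> v)"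
proof -
  interpret N: cvec N by fact
  show ?thesis
    using assms(2,3)
    by (auto intro!: linear_mapI simp: linear_map_add[OF assms(2)] linear_map_smult[OF assms(2)]
        N.smult_add_left N.smult_smult)
qed

lemma linear_map_zero_fun: "cvec N \<Longrightarrow> linear_map M N (\<lambda>x. \<zero>\<^bsub>N\<^esub>)"
proof -
  assume "cvec N"
  then interpret N: cvec N .
  show ?thesis by (rule linear_mapI) auto
qed

lemma linear_map_subspace_vimage:
  assumes "cvec M" "cvec N" "linear_map M N f" "submodule K complex_alg N"
  shows "submodule {x \<in> carrier M. f x \<in> K} complex_alg M"
proof -
  interpret M: cvec M by fact
  interpret N: cvec N by fact
  interpret K: submodule K complex_alg N by fact
  show ?thesis
    by (rule M.subspaceI)
      (use K.one_closed in \<open>auto simp: linear_map_zero[OF assms(1-3)] linear_map_add[OF assms(3)]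
        linear_map_smult[OF assms(3)] intro: N.submoduleE(4,5)[OF assms(4)]\<close>)
qed

section \<open>Quotients\<close>

locale csubspace = cvec V + abelian_subgroup N V for V (structure) and N +
  assumes smult_sub: "x \<in> N \<Longrightarrow> c \<odot>\<^bsub>V\<^esub> x \<in> N"

lemma csubspaceI:
  assumes "cvec V" "submodule N complex_alg V" shows "csubspace V N"
proof -
  interpret cvec V by fact
  interpret submodule N complex_alg V by fact
  have "additive_subgroup N V"
    by (rule additive_subgroupI) (rule subgroup_axioms)
  then show ?thesis
    by (intro csubspace.intro csubspace_axioms.intro abelian_subgroupI3 cvec_axioms
        abelian_group_axioms) auto
qed

context csubspace
begin

lemma coset_eq_iff:
  assumes "x \<in> carrier V" "y \<in> carrier V"
  shows "N +> x = N +> y \<longleftrightarrow> x \<ominus> y \<in> N"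
proof -
  have "N +> x = N +> y \<longleftrightarrow> x \<in> N +> y"
    using a_rcos_self[OF assms(1)] a_repr_independence'[OF _ assms(2)] by blast
  also have "\<dots> \<longleftrightarrow> x \<ominus> y \<in> N"
    using a_rcos_module[OF assms(2,1)] by (simp add: minus_eq)
  finally show ?thesis .
qed

lemma coset_diff: "\<lbrakk>x \<in> carrier V; y \<in> N +> x\<rbrakk> \<Longrightarrow> y \<in> carrier V \<and> y \<ominus> x \<in> N"
  using a_elemrcos_carrier a_rcos_module[of x y] by (simp add: minus_eq)

lemma sub_carrier: "x \<in> N \<Longrightarrow> x \<in> carrier V"
  by simp

lemma quot_carrier: "carrier (quot V N) = (\<lambda>x. N +> x) ` carrier V"
  by (auto simp: quot_def A_RCOSETS_def')

lemma coset_closed: "x \<in> carrier V \<Longrightarrow> N +> x \<in> carrier (quot V N)"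
  by (simp add: quot_carrier)

lemma quot_carrierE:
  assumes "X \<in> carrier (quot V N)" obtains x where "x \<in> carrier V" "X = N +> x"
  using assms by (auto simp: quot_carrier)

lemma quot_add: "\<lbrakk>x \<in> carrier V; y \<in> carrier V\<rbrakk> \<Longrightarrow> (N +> x) \<oplus>\<^bsub>quot V N\<^esub> (N +> y) = N +> (x \<oplus> y)"
  by (simp add: quot_def a_rcos_sum)

lemma coset_eq_zero: "x \<in> N \<Longrightarrow> N +> x = \<zero>\<^bsub>quot V N\<^esub>"
  by (simp add: quot_def a_rcos_const)

lemma zero_coset: "N +> \<zero> = \<zero>\<^bsub>quot V N\<^esub>"
  by (rule coset_eq_zero) (rule zero_closed)

text \<open>The formulas for scalar multiplication on \<^const>\<open>quot\<close> and for the action on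
  \<^const>\<open>cyclic_module\<close> are unions over a coset; they collapse to one member as soon as the
  integrand depends on the coset only.\<close>

lemma Union_coset:
  assumes "x \<in> carrier V" "\<And>y. \<lbrakk>y \<in> carrier V; y \<ominus> x \<in> N\<rbrakk> \<Longrightarrow> f y = f x"
  shows "(\<Union>y\<in>N +> x. f y) = f x"
proof -
  have "f y = f x" if "y \<in> N +> x" for y
    using coset_diff[OF assms(1) that] assms(2) by blast
  then show ?thesis using a_rcos_self[OF assms(1)] by blast
qed

lemma on_classes_coset_raw:
  assumes "x \<in> carrier V" "\<And>y. \<lbrakk>y \<in> carrier V; y \<ominus> x \<in> N\<rbrakk> \<Longrightarrow> f y = f x"
  shows "on_classes f (N +> x) = f x"
proof -
  have "f y = f x" if "y \<in> N +> x" for y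
    using coset_diff[OF assms(1) that] assms(2) by blast
  then have "f ` (N +> x) = {f x}" using a_rcos_self[OF assms(1)] by blast
  then show ?thesis by (simp add: on_classes_def)
qed

lemma quot_smult:
  assumes "x \<in> carrier V" shows "c \<odot>\<^bsub>quot V N\<^esub> (N +> x) = N +> (c \<odot> x)"
proof -
  have "N +> (c \<odot> y) = N +> (c \<odot> x)" if "y \<in> carrier V" "y \<ominus> x \<in> N" for y
  proof -
    have "c \<odot> y \<ominus> c \<odot> x = c \<odot> (y \<ominus> x)"
      using that assms by (simp add: minus_eq smult_add_right uminus_eq_smult smult_smult mult.commute)
    then show ?thesis using that assms smult_sub[of "y \<ominus> x" c] by (simp add: coset_eq_iff)
  qed
  then show ?thesis using Union_coset[OF assms, of "\<lambda>y. N +> (c \<odot> y)"] by (simp add: quot_def)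
qed

lemma quot_cvec: "cvec (quot V N)"
proof (rule cvecI)
  show "\<zero>\<^bsub>quot V N\<^esub> \<in> carrier (quot V N)"
    using coset_closed[OF M.zero_closed] by (simp only: zero_coset)
  show "\<zero>\<^bsub>quot V N\<^esub> \<oplus>\<^bsub>quot V N\<^esub> X = X" if X: "X \<in> carrier (quot V N)" for X
    using X by (elim quot_carrierE) (simp add: quot_add flip: zero_coset del: a_coset_add_zero)
  show "0 \<odot>\<^bsub>quot V N\<^esub> X = \<zero>\<^bsub>quot V N\<^esub>" if X: "X \<in> carrier (quot V N)" for X
    using X by (elim quot_carrierE) (simp add: quot_smult zero_coset del: a_coset_add_zero)
qed (auto elim!: quot_carrierE simp: quot_add quot_smult coset_closed a_ac smult_add_left
    smult_add_right smult_smult)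

lemma coset_linear: "linear_map V (quot V N) (\<lambda>x. N +> x)"
  by (rule linear_mapI) (auto simp: quot_add quot_smult coset_closed)

lemma on_classes_coset:
  assumes "cvec W" "linear_map V W f" "\<And>y. y \<in> N \<Longrightarrow> f y = \<zero>\<^bsub>W\<^esub>" "x \<in> carrier V"
  shows "on_classes f (N +> x) = f x"
proof (rule on_classes_coset_raw[OF assms(4)])
  interpret W: cvec W by fact
  fix y assume y: "y \<in> carrier V" "y \<ominus> x \<in> N"
  have "f y \<ominus>\<^bsub>W\<^esub> f x = f (y \<ominus> x)"
    by (rule linear_map_diff[OF cvec_axioms assms(1,2) y(1) assms(4), symmetric])
  also have "\<dots> = \<zero>\<^bsub>W\<^esub>" by (rule assms(3)[OF y(2)])
  finally show "f y = f x"
    by (rule W.diff_zero_imp_eq[rotated 2]) (use linear_map_closed[OF assms(2)] y(1) assms(4) in simp_all)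
qed

lemma on_classes_linear:
  assumes "cvec W" "linear_map V W f" "\<And>y. y \<in> N \<Longrightarrow> f y = \<zero>\<^bsub>W\<^esub>"
  shows "linear_map (quot V N) W (on_classes f)"
  by (rule linear_mapI; elim quot_carrierE)
    (simp_all add: quot_add quot_smult on_classes_coset[OF assms] linear_map_closed[OF assms(2)]
      linear_map_add[OF assms(2)] linear_map_smult[OF assms(2)])

end

section \<open>Algebras\<close>

locale calg = cvec A + ring A for A :: "(complex, 'v, 'z) module_scheme" (structure) +
  assumes smult_mult_left: "\<lbrakk>x \<in> carrier A; y \<in> carrier A\<rbrakk> \<Longrightarrow> (c \<odot> x) \<otimes> y = c \<odot> (x \<otimes> y)"
    and smult_mult_right: "\<lbrakk>x \<in> carrier A; y \<in> carrier A\<rbrakk> \<Longrightarrow> x \<otimes> (c \<odot> y) = c \<odot> (x \<otimes> y)"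
begin

lemma smult_one_mult: "x \<in> carrier A \<Longrightarrow> c \<odot> x = (c \<odot> \<one>) \<otimes> x"
  by (simp add: smult_mult_left)

lemma mult_left_linear: "a \<in> carrier A \<Longrightarrow> linear_map A A (\<lambda>x. a \<otimes> x)"
  by (rule linear_mapI) (auto simp: r_distr smult_mult_right)

lemma mult_right_linear: "a \<in> carrier A \<Longrightarrow> linear_map A A (\<lambda>x. x \<otimes> a)"
  by (rule linear_mapI) (auto simp: l_distr smult_mult_left)

lemma left_ideal_submodule:
  assumes "left_ideal J A" shows "submodule J complex_alg A"
proof -
  interpret J: additive_subgroup J A using assms by (simp add: left_ideal_def)
  show ?thesis
  proof (rule subspaceI)
    show "c \<odot> x \<in> J" if "x \<in> J" for c x
      using that assms smult_one_mult[of x c] J.a_subset unfolding left_ideal_def by auto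
  qed (use J.a_subset in auto)
qed

lemma gen_left_ideal_left_ideal:
  assumes "S \<subseteq> carrier A" shows "left_ideal (gen_left_ideal A S) A"
proof -
  have car: "left_ideal (carrier A) A"
    using additive_subgroupI[OF add.subgroup_self] by (simp add: left_ideal_def)
  have sub: "x \<in> carrier A" if "x \<in> gen_left_ideal A S" for x
    using that car assms by (auto simp: gen_left_ideal_def)
  have "submodule (gen_left_ideal A S) complex_alg A"
  proof (rule subspaceI)
    show "\<zero> \<in> gen_left_ideal A S"
      by (auto simp: gen_left_ideal_def left_ideal_def additive_subgroup.zero_closed)
    show "x \<oplus> y \<in> gen_left_ideal A S" if "x \<in> gen_left_ideal A S" "y \<in> gen_left_ideal A S" for x y
      using that by (auto simp: gen_left_ideal_def left_ideal_def additive_subgroup.a_closed)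
    show "c \<odot> x \<in> gen_left_ideal A S" if x: "x \<in> gen_left_ideal A S" for c x
      using x smult_one_mult[OF sub[OF x], of c] by (auto simp: gen_left_ideal_def left_ideal_def)
  qed (use sub in blast)
  then have "additive_subgroup (gen_left_ideal A S) A"
    by (intro additive_subgroupI submodule.axioms(1))
  then show ?thesis by (auto simp: left_ideal_def gen_left_ideal_def)
qed

lemma gen_left_ideal_superset: "S \<subseteq> gen_left_ideal A S"
  by (auto simp: gen_left_ideal_def)

lemma gen_left_ideal_least: "\<lbrakk>left_ideal J A; S \<subseteq> J\<rbrakk> \<Longrightarrow> gen_left_ideal A S \<subseteq> J"
  by (auto simp: gen_left_ideal_def)

lemma ideal_csubspace:
  assumes "ideal J A" shows "csubspace A J"
proof -
  interpret J: ideal J A by fact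
  have "left_ideal J A" using J.I_l_closed J.additive_subgroup_axioms by (simp add: left_ideal_def)
  then show ?thesis using left_ideal_submodule csubspaceI cvec_axioms by blast
qed

lemma quot_mult:
  "\<lbrakk>ideal J A; x \<in> carrier A; y \<in> carrier A\<rbrakk> \<Longrightarrow> (J +> x) \<otimes>\<^bsub>quot A J\<^esub> (J +> y) = J +> (x \<otimes> y)"
  by (simp add: quot_def ideal.rcoset_mult_add)

lemma quot_one: "\<one>\<^bsub>quot A J\<^esub> = J +> \<one>"
  by (simp add: quot_def)

lemma quot_calg:
  assumes J: "ideal J A" shows "calg (quot A J)"
proof -
  interpret S: csubspace A J by (rule ideal_csubspace[OF J])
  interpret Q: cvec "quot A J" by (rule S.quot_cvec)
  note simps = quot_mult[OF J] quot_one S.coset_closed S.quot_add S.quot_smult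
  have "monoid (quot A J)"
    by (rule monoidI; (elim S.quot_carrierE)?) (simp_all add: simps m_assoc)
  then have "ring (quot A J)"
    by (intro ringI Q.abelian_group_axioms; (elim S.quot_carrierE)?)
      (simp_all add: simps l_distr r_distr)
  then show ?thesis
    by (intro calg.intro calg_axioms.intro Q.cvec_axioms; (elim S.quot_carrierE)?)
      (simp_all add: simps smult_mult_left smult_mult_right)
qed

end

lemma calg_complex: "calg complex_alg"
  using complex_alg_cring cvec_complex
  by (auto simp: calg_def calg_axioms_def cring_def)

section \<open>Free vector spaces and monoid algebras\<close>

lemma monoid_algebra_simps [simp]:
  "\<zero>\<^bsub>monoid_algebra X\<^esub> = (\<lambda>_. 0)" "f \<oplus>\<^bsub>monoid_algebra X\<^esub> g = (\<lambda>x. f x + g x)"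
  "c \<odot>\<^bsub>monoid_algebra X\<^esub> f = (\<lambda>x. c * f x)" "\<one>\<^bsub>monoid_algebra X\<^esub> = dirac \<one>\<^bsub>X\<^esub>"
  by (simp_all add: monoid_algebra_def)

lemma monoid_algebra_carrier:
  "f \<in> carrier (monoid_algebra X) \<longleftrightarrow> finite {x. f x \<noteq> 0} \<and> {x. f x \<noteq> 0} \<subseteq> carrier X"
  by (simp add: monoid_algebra_def)

lemma cvec_monoid_algebra: "cvec (monoid_algebra X)"
proof (rule cvecI)
  fix f g assume "f \<in> carrier (monoid_algebra X)" "g \<in> carrier (monoid_algebra X)"
  moreover have "{x. f x + g x \<noteq> 0} \<subseteq> {x. f x \<noteq> 0} \<union> {x. g x \<noteq> 0}" by auto
  ultimately show "f \<oplus>\<^bsub>monoid_algebra X\<^esub> g \<in> carrier (monoid_algebra X)"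
    by (auto simp: monoid_algebra_carrier intro: finite_subset)
next
  fix f c assume "f \<in> carrier (monoid_algebra X)"
  then show "c \<odot>\<^bsub>monoid_algebra X\<^esub> f \<in> carrier (monoid_algebra X)"
    by (auto simp: monoid_algebra_carrier elim: rev_finite_subset)
qed (auto simp: monoid_algebra_carrier algebra_simps)

lemma dirac_self [simp]: "dirac x x = 1" by (simp add: dirac_def)

lemma dirac_nz: "dirac x y \<noteq> 0 \<longleftrightarrow> y = x" by (simp add: dirac_def)

lemma dirac_carrier: "x \<in> carrier X \<Longrightarrow> dirac x \<in> carrier (monoid_algebra X)"
  by (simp add: monoid_algebra_carrier dirac_nz)

text \<open>The functions \<open>dirac x\<close> are a basis: peel off the values of \<open>f\<close> one point at a time.\<close>

lemma monoid_algebra_induct [consumes 1, case_names zero add smult dirac]: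
  assumes "f \<in> carrier (monoid_algebra X)" and "P (\<lambda>_. 0)"
    and add: "\<And>f g. \<lbrakk>f \<in> carrier (monoid_algebra X); g \<in> carrier (monoid_algebra X); P f; P g\<rbrakk> \<Longrightarrow>
      P (f \<oplus>\<^bsub>monoid_algebra X\<^esub> g)"
    and smult: "\<And>c f. \<lbrakk>f \<in> carrier (monoid_algebra X); P f\<rbrakk> \<Longrightarrow> P (c \<odot>\<^bsub>monoid_algebra X\<^esub> f)"
    and dirac: "\<And>x. x \<in> carrier X \<Longrightarrow> P (dirac x)"
  shows "P f"
proof -
  interpret F: cvec "monoid_algebra X" by (rule cvec_monoid_algebra)
  have "\<forall>f. f \<in> carrier (monoid_algebra X) \<longrightarrow> {x. f x \<noteq> 0} = S \<longrightarrow> P f" if "finite S" for S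
    using that
  proof induction
    case empty
    have "f = (\<lambda>_. 0)" if "{x. f x \<noteq> 0} = {}" for f :: "'a \<Rightarrow> complex"
      using that by auto
    then show ?case using assms(2) by blast
  next
    case (insert a S)
    show ?case
    proof (intro allI impI)
      fix f assume f: "f \<in> carrier (monoid_algebra X)" "{x. f x \<noteq> 0} = insert a S"
      define g where "g = (\<lambda>x. if x = a then 0 else f x)"
      have g: "{x. g x \<noteq> 0} = S" using f(2) insert.hyps by (auto simp: g_def)
      then have gc: "g \<in> carrier (monoid_algebra X)"
        using f insert.hyps by (auto simp: monoid_algebra_carrier)
      have a: "a \<in> carrier X" using f by (auto simp: monoid_algebra_carrier)
      have "f = (f a \<odot>\<^bsub>monoid_algebra X\<^esub> dirac a) \<oplus>\<^bsub>monoid_algebra X\<^esub> g"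
        by (auto simp: g_def dirac_def)
      moreover have "P g" using insert.IH g gc by blast
      ultimately show "P f"
        using add smult dirac a gc F.smult_carrier[OF dirac_carrier[OF a]] dirac_carrier[OF a] by metis
    qed
  qed
  then show ?thesis using assms(1) by (auto simp: monoid_algebra_carrier)
qed

text \<open>Sums over the support are awkward under addition, where the support changes; any larger finite
  index set gives the same value.\<close>

lemma lin_ext_superset:
  assumes "cvec V" "\<phi> \<in> carrier X \<rightarrow> carrier V" "f \<in> carrier (monoid_algebra X)"
    and "finite S" "{x. f x \<noteq> 0} \<subseteq> S" "S \<subseteq> carrier X"
  shows "lin_ext V \<phi> f = (\<Oplus>\<^bsub>V\<^esub>x\<in>S. f x \<odot>\<^bsub>V\<^esub> \<phi> x)"
proof -
  interpret cvec V by fact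
  show ?thesis unfolding lin_ext_def
    using assms(2-) by (intro add.finprod_mono_neutral_cong_left) (auto simp: Pi_iff)
qed

lemma lin_ext_dirac:
  fixes X :: "('x, 'z) monoid_scheme"
  assumes "cvec V" "\<phi> \<in> carrier X \<rightarrow> carrier V" "x \<in> carrier X"
  shows "lin_ext V \<phi> (dirac x) = \<phi> x"
proof -
  interpret cvec V by fact
  have "\<phi> x \<in> carrier V" using assms by auto
  then show ?thesis
    using lin_ext_superset[OF assms(1,2) dirac_carrier[OF assms(3)], of "{x}"] assms(3)
    by (simp add: dirac_nz)
qed

lemma lin_ext_linear:
  assumes "cvec V" "\<phi> \<in> carrier X \<rightarrow> carrier V"
  shows "linear_map (monoid_algebra X) V (lin_ext V \<phi>)"
proof -
  interpret V: cvec V by fact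
  interpret F: cvec "monoid_algebra X" by (rule cvec_monoid_algebra)
  note sup = lin_ext_superset[OF assms]
  show ?thesis
  proof (rule linear_mapI)
    fix f assume f: "f \<in> carrier (monoid_algebra X)"
    then have S: "finite {x. f x \<noteq> 0}" "{x. f x \<noteq> 0} \<subseteq> carrier X" by (auto simp: monoid_algebra_carrier)
    show "lin_ext V \<phi> f \<in> carrier V"
      unfolding lin_ext_def using S assms(2) by (intro V.finsum_closed) auto
    fix c
    have "lin_ext V \<phi> (c \<odot>\<^bsub>monoid_algebra X\<^esub> f) =
        (\<Oplus>\<^bsub>V\<^esub>x\<in>{x. f x \<noteq> 0}. (c \<odot>\<^bsub>monoid_algebra X\<^esub> f) x \<odot>\<^bsub>V\<^esub> \<phi> x)"
      using S by (intro sup F.smult_carrier f) auto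
    also have "\<dots> = (\<Oplus>\<^bsub>V\<^esub>x\<in>{x. f x \<noteq> 0}. c \<odot>\<^bsub>V\<^esub> (f x \<odot>\<^bsub>V\<^esub> \<phi> x))"
      using S assms(2) by (intro V.finsum_cong') (auto simp: V.smult_smult Pi_iff subset_iff)
    also have "\<dots> = c \<odot>\<^bsub>V\<^esub> lin_ext V \<phi> f"
      unfolding lin_ext_def using S assms(2) by (subst V.smult_finsum) auto
    finally show "lin_ext V \<phi> (c \<odot>\<^bsub>monoid_algebra X\<^esub> f) = c \<odot>\<^bsub>V\<^esub> lin_ext V \<phi> f" .
    fix g assume g: "g \<in> carrier (monoid_algebra X)"
    let ?S = "{x. f x \<noteq> 0} \<union> {x. g x \<noteq> 0}"
    have T: "finite ?S" "?S \<subseteq> carrier X" using f g by (auto simp: monoid_algebra_carrier)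
    have "lin_ext V \<phi> (f \<oplus>\<^bsub>monoid_algebra X\<^esub> g) = (\<Oplus>\<^bsub>V\<^esub>x\<in>?S. (f \<oplus>\<^bsub>monoid_algebra X\<^esub> g) x \<odot>\<^bsub>V\<^esub> \<phi> x)"
      using T by (intro sup F.add.m_closed f g) auto
    also have "\<dots> = (\<Oplus>\<^bsub>V\<^esub>x\<in>?S. f x \<odot>\<^bsub>V\<^esub> \<phi> x \<oplus>\<^bsub>V\<^esub> g x \<odot>\<^bsub>V\<^esub> \<phi> x)"
      using T assms(2) by (intro V.finsum_cong') (auto simp: V.smult_add_left Pi_iff subset_iff)
    also have "\<dots> = (\<Oplus>\<^bsub>V\<^esub>x\<in>?S. f x \<odot>\<^bsub>V\<^esub> \<phi> x) \<oplus>\<^bsub>V\<^esub> (\<Oplus>\<^bsub>V\<^esub>x\<in>?S. g x \<odot>\<^bsub>V\<^esub> \<phi> x)"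
      using T assms(2) by (intro V.finsum_addf) (auto simp: Pi_iff subset_iff)
    also have "\<dots> = lin_ext V \<phi> f \<oplus>\<^bsub>V\<^esub> lin_ext V \<phi> g"
      using sup[OF f T(1)] sup[OF g T(1)] T(2) by simp
    finally show "lin_ext V \<phi> (f \<oplus>\<^bsub>monoid_algebra X\<^esub> g) = lin_ext V \<phi> f \<oplus>\<^bsub>V\<^esub> lin_ext V \<phi> g" .
  qed
qed

lemma free_linear_eq:
  assumes "linear_map (monoid_algebra X) V p" "linear_map (monoid_algebra X) V q" "cvec V"
    and "\<And>x. x \<in> carrier X \<Longrightarrow> p (dirac x) = q (dirac x)" "f \<in> carrier (monoid_algebra X)"
  shows "p f = q f"
  using assms(5)
proof (induction rule: monoid_algebra_induct)
  case zero
  show ?case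
    using linear_map_zero[OF cvec_monoid_algebra assms(3,1)] linear_map_zero[OF cvec_monoid_algebra assms(3,2)]
    by simp
next
  case (add f g)
  then show ?case by (simp only: linear_map_add[OF assms(1)] linear_map_add[OF assms(2)])
next
  case (smult c f)
  then show ?case by (simp only: linear_map_smult[OF assms(1)] linear_map_smult[OF assms(2)])
qed (use assms(4) in simp)

subsection \<open>Multiplication\<close>

lemma monoid_algebra_mult:
  assumes "finite S" "finite T" "{x. f x \<noteq> 0} \<subseteq> S" "{x. g x \<noteq> 0} \<subseteq> T"
  shows "(f \<otimes>\<^bsub>monoid_algebra X\<^esub> g) z = (\<Sum>x\<in>S. \<Sum>y\<in>T. if x \<otimes>\<^bsub>X\<^esub> y = z then f x * g y else 0)"
proof -
  have "(f \<otimes>\<^bsub>monoid_algebra X\<^esub> g) z =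
      (\<Sum>(x, y) | f x \<noteq> 0 \<and> g y \<noteq> 0 \<and> x \<otimes>\<^bsub>X\<^esub> y = z. f x * g y)"
    by (simp add: monoid_algebra_def)
  also have "\<dots> = (\<Sum>(x, y)\<in>S \<times> T. if x \<otimes>\<^bsub>X\<^esub> y = z then f x * g y else 0)"
  proof (rule sum.mono_neutral_cong_left)
    show "finite (S \<times> T)" using assms(1,2) by simp
    show "{(x, y). f x \<noteq> 0 \<and> g y \<noteq> 0 \<and> x \<otimes>\<^bsub>X\<^esub> y = z} \<subseteq> S \<times> T" using assms(3,4) by blast
  qed (auto split: if_splits)
  finally show ?thesis by (simp add: sum.cartesian_product)
qed

context monoid begin

lemma monoid_algebra_mult_closed:
  assumes "f \<in> carrier (monoid_algebra G)" "g \<in> carrier (monoid_algebra G)"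
  shows "f \<otimes>\<^bsub>monoid_algebra G\<^esub> g \<in> carrier (monoid_algebra G)"
proof -
  let ?S = "{x. f x \<noteq> 0}" and ?T = "{x. g x \<noteq> 0}"
  have fin: "finite ?S" "finite ?T" "?S \<subseteq> carrier G" "?T \<subseteq> carrier G"
    using assms by (auto simp: monoid_algebra_carrier)
  have sub: "{z. (f \<otimes>\<^bsub>monoid_algebra G\<^esub> g) z \<noteq> 0} \<subseteq> (\<lambda>(x, y). x \<otimes> y) ` (?S \<times> ?T)"
  proof (rule subsetI, rule ccontr)
    fix z
    assume z: "z \<in> {z. (f \<otimes>\<^bsub>monoid_algebra G\<^esub> g) z \<noteq> 0}" "z \<notin> (\<lambda>(x, y). x \<otimes> y) ` (?S \<times> ?T)"
    have "x \<otimes> y \<noteq> z" if "x \<in> ?S" "y \<in> ?T" for x y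
      using z(2) that by force
    then have "(\<Sum>x\<in>?S. \<Sum>y\<in>?T. if x \<otimes> y = z then f x * g y else 0) = 0"
      by (intro sum.neutral ballI) simp
    then show False
      using z(1) unfolding mem_Collect_eq monoid_algebra_mult[OF fin(1,2) order_refl order_refl] by contradiction
  qed
  have "(\<lambda>(x, y). x \<otimes> y) ` (?S \<times> ?T) \<subseteq> carrier G" using fin(3,4) by auto
  moreover have "finite ((\<lambda>(x, y). x \<otimes> y) ` (?S \<times> ?T))" using fin by simp
  ultimately show ?thesis
    unfolding monoid_algebra_carrier using finite_subset[OF sub] sub by blast
qed

lemma monoid_algebra_mult_left_linear:
  assumes "f \<in> carrier (monoid_algebra G)"
  shows "linear_map (monoid_algebra G) (monoid_algebra G) (\<lambda>g. f \<otimes>\<^bsub>monoid_algebra G\<^esub> g)"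
proof (rule linear_mapI)
  interpret F: cvec "monoid_algebra G" by (rule cvec_monoid_algebra)
  fix g assume g: "g \<in> carrier (monoid_algebra G)"
  then show "f \<otimes>\<^bsub>monoid_algebra G\<^esub> g \<in> carrier (monoid_algebra G)"
    by (rule monoid_algebra_mult_closed[OF assms])
  fix c
  let ?S = "{x. f x \<noteq> 0}" and ?T = "{x. g x \<noteq> 0}"
  have fin: "finite ?S" "finite ?T" using assms g by (auto simp: monoid_algebra_carrier)
  have "(f \<otimes>\<^bsub>monoid_algebra G\<^esub> (\<lambda>x. c * g x)) z = c * (f \<otimes>\<^bsub>monoid_algebra G\<^esub> g) z" for z
    using fin by (simp add: monoid_algebra_mult[of ?S ?T] subset_iff sum_distrib_left if_distrib
        mult.left_commute cong: if_cong)
  then show "f \<otimes>\<^bsub>monoid_algebra G\<^esub> (c \<odot>\<^bsub>monoid_algebra G\<^esub> g) = c \<odot>\<^bsub>monoid_algebra G\<^esub> (f \<otimes>\<^bsub>monoid_algebra G\<^esub> g)"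
    by auto
  fix h assume h: "h \<in> carrier (monoid_algebra G)"
  let ?T = "{x. g x \<noteq> 0} \<union> {x. h x \<noteq> 0}"
  have fin: "finite ?S" "finite ?T" using assms g h by (auto simp: monoid_algebra_carrier)
  have eq: "(if P then a * (b + c) else 0) = (if P then a * b else 0) + (if P then a * c else (0::complex))"
    for P a b c by (simp add: algebra_simps)
  have "(f \<otimes>\<^bsub>monoid_algebra G\<^esub> (\<lambda>x. g x + h x)) z =
      (f \<otimes>\<^bsub>monoid_algebra G\<^esub> g) z + (f \<otimes>\<^bsub>monoid_algebra G\<^esub> h) z" for z
    using fin by (subst (1 2 3) monoid_algebra_mult[of ?S ?T]) (auto simp: eq sum.distrib)
  then show "f \<otimes>\<^bsub>monoid_algebra G\<^esub> (g \<oplus>\<^bsub>monoid_algebra G\<^esub> h) =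
      (f \<otimes>\<^bsub>monoid_algebra G\<^esub> g) \<oplus>\<^bsub>monoid_algebra G\<^esub> (f \<otimes>\<^bsub>monoid_algebra G\<^esub> h)"
    by auto
qed

lemma monoid_algebra_mult_right_linear:
  assumes "f \<in> carrier (monoid_algebra G)"
  shows "linear_map (monoid_algebra G) (monoid_algebra G) (\<lambda>g. g \<otimes>\<^bsub>monoid_algebra G\<^esub> f)"
proof (rule linear_mapI)
  interpret F: cvec "monoid_algebra G" by (rule cvec_monoid_algebra)
  fix g assume g: "g \<in> carrier (monoid_algebra G)"
  then show "g \<otimes>\<^bsub>monoid_algebra G\<^esub> f \<in> carrier (monoid_algebra G)"
    by (intro monoid_algebra_mult_closed assms)
  fix c
  let ?S = "{x. f x \<noteq> 0}" and ?T = "{x. g x \<noteq> 0}"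
  have fin: "finite ?S" "finite ?T" using assms g by (auto simp: monoid_algebra_carrier)
  have "((\<lambda>x. c * g x) \<otimes>\<^bsub>monoid_algebra G\<^esub> f) z = c * (g \<otimes>\<^bsub>monoid_algebra G\<^esub> f) z" for z
    using fin by (simp add: monoid_algebra_mult[of ?T ?S] subset_iff sum_distrib_left if_distrib
        mult.assoc cong: if_cong)
  then show "(c \<odot>\<^bsub>monoid_algebra G\<^esub> g) \<otimes>\<^bsub>monoid_algebra G\<^esub> f = c \<odot>\<^bsub>monoid_algebra G\<^esub> (g \<otimes>\<^bsub>monoid_algebra G\<^esub> f)"
    by auto
  fix h assume h: "h \<in> carrier (monoid_algebra G)"
  let ?T = "{x. g x \<noteq> 0} \<union> {x. h x \<noteq> 0}"
  have fin: "finite ?S" "finite ?T" using assms g h by (auto simp: monoid_algebra_carrier)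
  have eq: "(if P then (b + c) * a else 0) = (if P then b * a else 0) + (if P then c * a else (0::complex))"
    for P a b c by (simp add: algebra_simps)
  have "((\<lambda>x. g x + h x) \<otimes>\<^bsub>monoid_algebra G\<^esub> f) z =
      (g \<otimes>\<^bsub>monoid_algebra G\<^esub> f) z + (h \<otimes>\<^bsub>monoid_algebra G\<^esub> f) z" for z
    using fin by (subst (1 2 3) monoid_algebra_mult[of ?T ?S]) (auto simp: eq sum.distrib)
  then show "(g \<oplus>\<^bsub>monoid_algebra G\<^esub> h) \<otimes>\<^bsub>monoid_algebra G\<^esub> f =
      (g \<otimes>\<^bsub>monoid_algebra G\<^esub> f) \<oplus>\<^bsub>monoid_algebra G\<^esub> (h \<otimes>\<^bsub>monoid_algebra G\<^esub> f)"
    by auto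
qed

lemma dirac_mult: "dirac x \<otimes>\<^bsub>monoid_algebra G\<^esub> dirac y = dirac (x \<otimes> y)"
proof
  fix z
  show "(dirac x \<otimes>\<^bsub>monoid_algebra G\<^esub> dirac y) z = dirac (x \<otimes> y) z"
    using monoid_algebra_mult[of "{x}" "{y}" "dirac x" "dirac y" G z] by (auto simp: dirac_def)
qed

lemma calg_monoid_algebra: "calg (monoid_algebra G)"
proof -
  let ?F = "monoid_algebra G"
  interpret F: cvec ?F by (rule cvec_monoid_algebra)
  note L = monoid_algebra_mult_left_linear and R = monoid_algebra_mult_right_linear
  note simps = monoid_algebra_mult_closed linear_map_add[OF L] linear_map_add[OF R]
    linear_map_smult[OF L] linear_map_smult[OF R] linear_map_zero[OF F.cvec_axioms F.cvec_axioms L]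
    linear_map_zero[OF F.cvec_axioms F.cvec_axioms R]
  have assoc1: "dirac x \<otimes>\<^bsub>?F\<^esub> dirac y \<otimes>\<^bsub>?F\<^esub> h = dirac x \<otimes>\<^bsub>?F\<^esub> (dirac y \<otimes>\<^bsub>?F\<^esub> h)"
    if "x \<in> carrier G" "y \<in> carrier G" "h \<in> carrier ?F" for x y h
    by (rule free_linear_eq[where V = ?F and f = h])
      (use that in \<open>auto simp: dirac_mult m_assoc simp del: monoid_algebra_simps
        intro!: L linear_map_comp[OF L L] dirac_carrier monoid_algebra_mult_closed cvec_monoid_algebra\<close>)
  have assoc2: "dirac x \<otimes>\<^bsub>?F\<^esub> g \<otimes>\<^bsub>?F\<^esub> h = dirac x \<otimes>\<^bsub>?F\<^esub> (g \<otimes>\<^bsub>?F\<^esub> h)"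
    if "x \<in> carrier G" "g \<in> carrier ?F" "h \<in> carrier ?F" for x g h
    by (rule free_linear_eq[where V = ?F and f = g])
      (use that in \<open>auto simp: assoc1 simp del: monoid_algebra_simps
        intro!: linear_map_comp[OF L R] linear_map_comp[OF R L] dirac_carrier cvec_monoid_algebra\<close>)
  have assoc: "f \<otimes>\<^bsub>?F\<^esub> g \<otimes>\<^bsub>?F\<^esub> h = f \<otimes>\<^bsub>?F\<^esub> (g \<otimes>\<^bsub>?F\<^esub> h)"
    if "f \<in> carrier ?F" "g \<in> carrier ?F" "h \<in> carrier ?F" for f g h
    by (rule free_linear_eq[where V = ?F and f = f])
      (use that in \<open>auto simp: assoc2 simp del: monoid_algebra_simps
        intro!: linear_map_comp[OF R R] R monoid_algebra_mult_closed cvec_monoid_algebra\<close>)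
  have id: "linear_map ?F ?F (\<lambda>f. f)" by (rule linear_mapI) auto
  have l_one: "dirac \<one> \<otimes>\<^bsub>?F\<^esub> f = f" if "f \<in> carrier ?F" for f
    by (rule free_linear_eq[where V = ?F and f = f])
      (use that in \<open>auto simp: dirac_mult intro!: L id dirac_carrier cvec_monoid_algebra\<close>)
  have r_one: "f \<otimes>\<^bsub>?F\<^esub> dirac \<one> = f" if "f \<in> carrier ?F" for f
    by (rule free_linear_eq[where V = ?F and f = f])
      (use that in \<open>auto simp: dirac_mult intro!: R id dirac_carrier cvec_monoid_algebra\<close>)
  have "monoid ?F"
    by (rule monoidI) (auto simp: assoc l_one r_one intro: dirac_carrier monoid_algebra_mult_closed)
  then have "ring ?F"
    by (intro ringI F.abelian_group_axioms) (simp_all add: simps del: monoid_algebra_simps)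
  then show ?thesis
    by (intro calg.intro calg_axioms.intro F.cvec_axioms) (simp_all add: simps del: monoid_algebra_simps)
qed

end

section \<open>Tensor products\<close>

lemma PiE_upd: "\<lbrakk>t \<in> (\<Pi>\<^sub>E i\<in>I. A i); i \<in> I; x \<in> A i\<rbrakk> \<Longrightarrow> t(i := x) \<in> (\<Pi>\<^sub>E i\<in>I. A i)"
  by (auto simp: PiE_iff extensional_def)

text \<open>The condition \<open>\<phi> t \<in> carrier V\<close> is stated separately for the sake of empty \<open>I\<close>: there is then
  one tuple and no linearity condition.\<close>

definition multilinear ::
  "nat set \<Rightarrow> (nat \<Rightarrow> (complex, 'm, 'z) module_scheme) \<Rightarrow> (complex, 'v, 'y) module_scheme \<Rightarrow> ((nat \<Rightarrow> 'm) \<Rightarrow> 'v) \<Rightarrow> bool"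
  where "multilinear I W V \<phi> \<longleftrightarrow> (\<forall>t\<in>(\<Pi>\<^sub>E i\<in>I. carrier (W i)).
     \<phi> t \<in> carrier V \<and> (\<forall>i\<in>I. linear_map (W i) V (\<lambda>x. \<phi> (t(i := x)))))"

lemma multilinearI:
  assumes "\<And>t. t \<in> (\<Pi>\<^sub>E i\<in>I. carrier (W i)) \<Longrightarrow> \<phi> t \<in> carrier V"
    and "\<And>t i. \<lbrakk>t \<in> (\<Pi>\<^sub>E i\<in>I. carrier (W i)); i \<in> I\<rbrakk> \<Longrightarrow> linear_map (W i) V (\<lambda>x. \<phi> (t(i := x)))"
  shows "multilinear I W V \<phi>"
  using assms by (simp add: multilinear_def)

lemma multilinear_closed:
  "\<lbrakk>multilinear I W V \<phi>; t \<in> (\<Pi>\<^sub>E i\<in>I. carrier (W i))\<rbrakk> \<Longrightarrow> \<phi> t \<in> carrier V"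
  by (simp add: multilinear_def)

lemma multilinear_linear:
  "\<lbrakk>multilinear I W V \<phi>; t \<in> (\<Pi>\<^sub>E i\<in>I. carrier (W i)); i \<in> I\<rbrakk> \<Longrightarrow> linear_map (W i) V (\<lambda>x. \<phi> (t(i := x)))"
  by (simp add: multilinear_def)

locale tensor_family =
  fixes I :: "nat set" and W :: "nat \<Rightarrow> (complex, 'm, 'z) module_scheme"
  assumes cvec_factor: "i \<in> I \<Longrightarrow> cvec (W i)"
begin

abbreviation tuples :: "(nat \<Rightarrow> 'm) set" where "tuples \<equiv> (\<Pi>\<^sub>E i\<in>I. carrier (W i))"
abbreviation Free :: "(complex, (nat \<Rightarrow> 'm) \<Rightarrow> complex) module"
  where "Free \<equiv> monoid_algebra (product_group I W)"
abbreviation Rels :: "((nat \<Rightarrow> 'm) \<Rightarrow> complex) set" where "Rels \<equiv> lspan Free (tensor_rels I W)"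

lemma tuple_upd: "\<lbrakk>t \<in> tuples; i \<in> I; x \<in> carrier (W i)\<rbrakk> \<Longrightarrow> t(i := x) \<in> tuples"
  by (rule PiE_upd)

lemma dirac_tuple: "t \<in> tuples \<Longrightarrow> dirac t \<in> carrier Free"
  by (rule dirac_carrier) simp

sublocale Free: cvec Free by (rule cvec_monoid_algebra)

lemma factor_closed:
  assumes "i \<in> I"
  shows "\<lbrakk>x \<in> carrier (W i); y \<in> carrier (W i)\<rbrakk> \<Longrightarrow> x \<oplus>\<^bsub>W i\<^esub> y \<in> carrier (W i)"
    and "x \<in> carrier (W i) \<Longrightarrow> c \<odot>\<^bsub>W i\<^esub> x \<in> carrier (W i)"
proof -
  interpret cvec "W i" using assms by (rule cvec_factor)
  show "\<lbrakk>x \<in> carrier (W i); y \<in> carrier (W i)\<rbrakk> \<Longrightarrow> x \<oplus>\<^bsub>W i\<^esub> y \<in> carrier (W i)"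
    and "x \<in> carrier (W i) \<Longrightarrow> c \<odot>\<^bsub>W i\<^esub> x \<in> carrier (W i)" by simp_all
qed

lemma tensor_rels_cases [consumes 1, case_names add smult]:
  assumes "r \<in> tensor_rels I W"
  obtains t i x y where "t \<in> tuples" "i \<in> I" "x \<in> carrier (W i)" "y \<in> carrier (W i)"
      "r = dirac (t(i := x \<oplus>\<^bsub>W i\<^esub> y)) \<ominus>\<^bsub>Free\<^esub> (dirac (t(i := x)) \<oplus>\<^bsub>Free\<^esub> dirac (t(i := y)))"
  | t i x c where "t \<in> tuples" "i \<in> I" "x \<in> carrier (W i)"
      "r = dirac (t(i := c \<odot>\<^bsub>W i\<^esub> x)) \<ominus>\<^bsub>Free\<^esub> (c \<odot>\<^bsub>Free\<^esub> dirac (t(i := x)))"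
  using assms unfolding tensor_rels_def Let_def by (elim UnE CollectE exE conjE) metis+

lemma tensor_rels_addI:
  "\<lbrakk>t \<in> tuples; i \<in> I; x \<in> carrier (W i); y \<in> carrier (W i)\<rbrakk> \<Longrightarrow>
    dirac (t(i := x \<oplus>\<^bsub>W i\<^esub> y)) \<ominus>\<^bsub>Free\<^esub> (dirac (t(i := x)) \<oplus>\<^bsub>Free\<^esub> dirac (t(i := y))) \<in> tensor_rels I W"
  unfolding tensor_rels_def Let_def by blast

lemma tensor_rels_smultI:
  "\<lbrakk>t \<in> tuples; i \<in> I; x \<in> carrier (W i)\<rbrakk> \<Longrightarrow>
    dirac (t(i := c \<odot>\<^bsub>W i\<^esub> x)) \<ominus>\<^bsub>Free\<^esub> (c \<odot>\<^bsub>Free\<^esub> dirac (t(i := x))) \<in> tensor_rels I W"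
  unfolding tensor_rels_def Let_def by blast

lemma tensor_rels_carrier: "tensor_rels I W \<subseteq> carrier Free"
proof
  fix r assume "r \<in> tensor_rels I W"
  then show "r \<in> carrier Free"
    by (cases rule: tensor_rels_cases)
      (simp_all add: dirac_tuple tuple_upd factor_closed Free.M.minus_closed Free.M.a_closed
        Free.smult_carrier del: monoid_algebra_simps)
qed

sublocale Rels: csubspace Free Rels
  by (rule csubspaceI[OF Free.cvec_axioms Free.lspan_submodule[OF tensor_rels_carrier]])

lemma tensor_eq_quot: "tensor I W = quot Free Rels"
  by (simp add: tensor_def Let_def)

lemma pure_eq_coset: "pure I W t = Rels +>\<^bsub>Free\<^esub> dirac t"
  by (simp add: pure_def Let_def)

lemma cvec_tensor: "cvec (tensor I W)"
  unfolding tensor_eq_quot by (rule Rels.quot_cvec)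

lemma pure_closed: "t \<in> tuples \<Longrightarrow> pure I W t \<in> carrier (tensor I W)"
  unfolding tensor_eq_quot pure_eq_coset by (intro Rels.coset_closed dirac_tuple)

lemma pure_add:
  assumes "t \<in> tuples" "i \<in> I" "x \<in> carrier (W i)" "y \<in> carrier (W i)"
  shows "pure I W (t(i := x \<oplus>\<^bsub>W i\<^esub> y)) = pure I W (t(i := x)) \<oplus>\<^bsub>tensor I W\<^esub> pure I W (t(i := y))"
proof -
  have c: "dirac (t(i := x)) \<in> carrier Free" "dirac (t(i := y)) \<in> carrier Free"
    "dirac (t(i := x \<oplus>\<^bsub>W i\<^esub> y)) \<in> carrier Free"
    using assms by (simp_all add: dirac_tuple tuple_upd factor_closed)
  show ?thesis
    unfolding tensor_eq_quot pure_eq_coset Rels.quot_add[OF c(1,2)]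
    using tensor_rels_addI[OF assms] Free.lspan_superset
    by (subst Rels.coset_eq_iff[OF c(3) Free.M.a_closed[OF c(1,2)]]) blast
qed

lemma pure_smult:
  assumes "t \<in> tuples" "i \<in> I" "x \<in> carrier (W i)"
  shows "pure I W (t(i := c \<odot>\<^bsub>W i\<^esub> x)) = c \<odot>\<^bsub>tensor I W\<^esub> pure I W (t(i := x))"
proof -
  have c: "dirac (t(i := x)) \<in> carrier Free" "dirac (t(i := c \<odot>\<^bsub>W i\<^esub> x)) \<in> carrier Free"
    using assms by (simp_all add: dirac_tuple tuple_upd factor_closed)
  show ?thesis
    unfolding tensor_eq_quot pure_eq_coset Rels.quot_smult[OF c(1)]
    using tensor_rels_smultI[OF assms] Free.lspan_superset
    by (subst Rels.coset_eq_iff[OF c(2) Free.smult_carrier[OF c(1)]]) blast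
qed

lemma pure_multilinear: "multilinear I W (tensor I W) (pure I W)"
  by (intro multilinearI linear_mapI) (simp_all add: pure_closed tuple_upd pure_add pure_smult)

lemma tensor_induct [consumes 1, case_names zero add smult pure]:
  assumes "X \<in> carrier (tensor I W)" and "P \<zero>\<^bsub>tensor I W\<^esub>"
    and add: "\<And>X Y. \<lbrakk>X \<in> carrier (tensor I W); Y \<in> carrier (tensor I W); P X; P Y\<rbrakk> \<Longrightarrow> P (X \<oplus>\<^bsub>tensor I W\<^esub> Y)"
    and smult: "\<And>c X. \<lbrakk>X \<in> carrier (tensor I W); P X\<rbrakk> \<Longrightarrow> P (c \<odot>\<^bsub>tensor I W\<^esub> X)"
    and pure: "\<And>t. t \<in> tuples \<Longrightarrow> P (pure I W t)"
  shows "P X"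
proof -
  obtain f where f: "f \<in> carrier Free" "X = Rels +>\<^bsub>Free\<^esub> f"
    using assms(1) unfolding tensor_eq_quot by (rule Rels.quot_carrierE)
  have "P (Rels +>\<^bsub>Free\<^esub> f)" using f(1)
  proof (induction rule: monoid_algebra_induct)
    case zero
    have "Rels +>\<^bsub>Free\<^esub> (\<lambda>_. 0) = \<zero>\<^bsub>tensor I W\<^esub>"
      using Rels.zero_coset unfolding tensor_eq_quot monoid_algebra_simps .
    then show ?case using assms(2) by (simp only:)
  next
    case (add f g)
    then show ?case
      using assms(3)[unfolded tensor_eq_quot, OF Rels.coset_closed Rels.coset_closed]
      by (metis Rels.quot_add)
  next
    case (smult c f)
    then show ?case
      using assms(4)[unfolded tensor_eq_quot, OF Rels.coset_closed] by (metis Rels.quot_smult)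
  next
    case (dirac t)
    then show ?case using pure by (simp add: pure_eq_coset)
  qed
  then show ?thesis using f by simp
qed

text \<open>A linear map on a tensor product is determined by its values on pure tensors. Identities
  between composites of the maps below are reduced to pure tensors in this way.\<close>

lemma tensor_linear_eq:
  assumes "linear_map (tensor I W) V p" "linear_map (tensor I W) V q" "cvec V"
    and "\<And>t. t \<in> tuples \<Longrightarrow> p (pure I W t) = q (pure I W t)" "X \<in> carrier (tensor I W)"
  shows "p X = q X"
  using assms(5)
proof (induction rule: tensor_induct)
  case zero
  show ?case
    using linear_map_zero[OF cvec_tensor assms(3,1)] linear_map_zero[OF cvec_tensor assms(3,2)] by simp
qed (use assms(4) in \<open>simp_all add: linear_map_add[OF assms(1)] linear_map_add[OF assms(2)]
      linear_map_smult[OF assms(1)] linear_map_smult[OF assms(2)]\<close>)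

end

locale tensor_lift = tensor_family I W for I and W :: "nat \<Rightarrow> (complex, 'm, 'z) module_scheme" +
  fixes V :: "(complex, 'v, 'y) module_scheme" and \<phi> :: "(nat \<Rightarrow> 'm) \<Rightarrow> 'v"
  assumes cvec_target: "cvec V" and ml: "multilinear I W V \<phi>"
begin

sublocale target: cvec V by (rule cvec_target)

lemma lift_Pi: "\<phi> \<in> carrier (product_group I W) \<rightarrow> carrier V"
  using multilinear_closed[OF ml] by auto

lemma free_lift_linear: "linear_map Free V (lin_ext V \<phi>)"
  by (rule lin_ext_linear[OF cvec_target lift_Pi])

lemma free_lift_dirac: "t \<in> tuples \<Longrightarrow> lin_ext V \<phi> (dirac t) = \<phi> t"
  by (rule lin_ext_dirac[OF cvec_target lift_Pi]) simp

lemma free_lift_rels: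
  assumes "r \<in> Rels" shows "lin_ext V \<phi> r = \<zero>\<^bsub>V\<^esub>"
proof -
  note simps = linear_map_diff[OF Free.cvec_axioms cvec_target free_lift_linear]
    linear_map_add[OF free_lift_linear] linear_map_smult[OF free_lift_linear]
    free_lift_dirac tuple_upd dirac_tuple factor_closed
    linear_map_add[OF multilinear_linear[OF ml]] linear_map_smult[OF multilinear_linear[OF ml]]
    multilinear_closed[OF ml]
  show ?thesis using assms tensor_rels_carrier
  proof (induction rule: Free.lspan_induct)
    case (base r)
    then show ?case
      by (cases rule: tensor_rels_cases)
        (simp_all add: simps target.M.r_neg a_minus_def[of V] Free.M.a_closed Free.smult_carrier
          del: monoid_algebra_simps)
  qed (simp_all add: linear_map_zero[OF Free.cvec_axioms cvec_target free_lift_linear] simps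
      del: monoid_algebra_simps)
qed

lemma lift_linear: "linear_map (tensor I W) V (on_classes (lin_ext V \<phi>))"
  unfolding tensor_eq_quot
  by (rule Rels.on_classes_linear[OF cvec_target free_lift_linear free_lift_rels])

lemma lift_pure: "t \<in> tuples \<Longrightarrow> on_classes (lin_ext V \<phi>) (pure I W t) = \<phi> t"
  unfolding pure_eq_coset
  using Rels.on_classes_coset[OF cvec_target free_lift_linear free_lift_rels dirac_tuple] free_lift_dirac
  by simp

end

context tensor_family begin

lemma multilinear_cong:
  assumes "multilinear I W V \<phi>" "\<And>t. t \<in> tuples \<Longrightarrow> \<phi> t = \<psi> t"
  shows "multilinear I W V \<psi>"
proof (rule multilinearI)
  fix t assume t: "t \<in> tuples"
  show "\<psi> t \<in> carrier V" using multilinear_closed[OF assms(1) t] assms(2)[OF t] by simp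
  fix i assume i: "i \<in> I"
  show "linear_map (W i) V (\<lambda>x. \<psi> (t(i := x)))"
    by (rule linear_map_cong[OF multilinear_linear[OF assms(1) t i] cvec_factor[OF i]])
      (simp add: assms(2) tuple_upd t i)
qed

end

subsection \<open>Tensor products of algebras\<close>

text \<open>If the factors are algebras, then the span of the multilinearity relations is a two-sided ideal of
  the monoid algebra of tuples, since multiplication by a tuple maps relations to relations. So the quotient
  is an algebra, with factorwise multiplication of pure tensors.\<close>

locale tensor_algebra_family =
  fixes I :: "nat set" and W :: "nat \<Rightarrow> (complex, 'm, 'z) module_scheme"
  assumes calg_factor: "i \<in> I \<Longrightarrow> calg (W i)"
begin

sublocale tensor_family I W
  by (rule tensor_family.intro) (use calg_factor in \<open>simp add: calg_def\<close>)

definition tmult :: "(nat \<Rightarrow> 'm) \<Rightarrow> (nat \<Rightarrow> 'm) \<Rightarrow> nat \<Rightarrow> 'm"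
  where "tmult s t = (\<lambda>i\<in>I. s i \<otimes>\<^bsub>W i\<^esub> t i)"

lemma factor_mult_closed:
  assumes "i \<in> I" "x \<in> carrier (W i)" "y \<in> carrier (W i)"
  shows "x \<otimes>\<^bsub>W i\<^esub> y \<in> carrier (W i)"
proof -
  interpret calg "W i" using assms(1) by (rule calg_factor)
  show ?thesis using assms by simp
qed

lemma factor_one_closed: "i \<in> I \<Longrightarrow> \<one>\<^bsub>W i\<^esub> \<in> carrier (W i)"
proof -
  assume "i \<in> I"
  then interpret calg "W i" by (rule calg_factor)
  show ?thesis by simp
qed

lemma tmult_closed: "\<lbrakk>s \<in> tuples; t \<in> tuples\<rbrakk> \<Longrightarrow> tmult s t \<in> tuples"
  by (auto simp: PiE_iff factor_mult_closed tmult_def)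

lemma monoid_tuples: "monoid (product_group I W)"
proof (rule monoidI)
  have a: "x \<otimes>\<^bsub>W i\<^esub> y \<otimes>\<^bsub>W i\<^esub> z = x \<otimes>\<^bsub>W i\<^esub> (y \<otimes>\<^bsub>W i\<^esub> z)"
    and b: "\<one>\<^bsub>W i\<^esub> \<otimes>\<^bsub>W i\<^esub> x = x" and c: "x \<otimes>\<^bsub>W i\<^esub> \<one>\<^bsub>W i\<^esub> = x"
    if "i \<in> I" "x \<in> carrier (W i)" "y \<in> carrier (W i)" "z \<in> carrier (W i)" for i x y z
  proof -
    interpret calg "W i" using that(1) by (rule calg_factor)
    show "x \<otimes>\<^bsub>W i\<^esub> y \<otimes>\<^bsub>W i\<^esub> z = x \<otimes>\<^bsub>W i\<^esub> (y \<otimes>\<^bsub>W i\<^esub> z)" "\<one>\<^bsub>W i\<^esub> \<otimes>\<^bsub>W i\<^esub> x = x" "x \<otimes>\<^bsub>W i\<^esub> \<one>\<^bsub>W i\<^esub> = x"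
      using that by (simp_all add: m_assoc)
  qed
  fix x y z
  assume xyz: "x \<in> carrier (product_group I W)" "y \<in> carrier (product_group I W)" "z \<in> carrier (product_group I W)"
  show "x \<otimes>\<^bsub>product_group I W\<^esub> y \<in> carrier (product_group I W)"
    using xyz tmult_closed by (simp add: tmult_def)
  show "x \<otimes>\<^bsub>product_group I W\<^esub> y \<otimes>\<^bsub>product_group I W\<^esub> z = x \<otimes>\<^bsub>product_group I W\<^esub> (y \<otimes>\<^bsub>product_group I W\<^esub> z)"
    using xyz by (auto simp: PiE_iff a intro!: restrict_ext)
  show "\<one>\<^bsub>product_group I W\<^esub> \<otimes>\<^bsub>product_group I W\<^esub> x = x"
    using xyz(1) by (intro ext) (auto simp: PiE_iff extensional_def b)
  show "x \<otimes>\<^bsub>product_group I W\<^esub> \<one>\<^bsub>product_group I W\<^esub> = x"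
    using xyz(1) by (intro ext) (auto simp: PiE_iff extensional_def c)
next
  show "\<one>\<^bsub>product_group I W\<^esub> \<in> carrier (product_group I W)" by (simp add: factor_one_closed)
qed

sublocale tuples: monoid "product_group I W" by (rule monoid_tuples)
sublocale FreeA: calg Free by (rule tuples.calg_monoid_algebra)

lemma dirac_tmult: "dirac s \<otimes>\<^bsub>Free\<^esub> dirac t = dirac (tmult s t)"
  by (simp add: tuples.dirac_mult tmult_def)

lemma tmult_upd_right:
  assumes "i \<in> I" shows "tmult s (t(i := x)) = (tmult s t)(i := s i \<otimes>\<^bsub>W i\<^esub> x)"
  using assms by (auto simp: tmult_def)

lemma tmult_upd_left:
  assumes "i \<in> I" shows "tmult (t(i := x)) s = (tmult t s)(i := x \<otimes>\<^bsub>W i\<^esub> s i)"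
  using assms by (auto simp: tmult_def)

lemma rels_mult_dirac:
  assumes r: "r \<in> tensor_rels I W" and s: "s \<in> tuples"
  shows "dirac s \<otimes>\<^bsub>Free\<^esub> r \<in> tensor_rels I W" "r \<otimes>\<^bsub>Free\<^esub> dirac s \<in> tensor_rels I W"
proof -
  note L = FreeA.mult_left_linear[OF dirac_tuple[OF s]] and R = FreeA.mult_right_linear[OF dirac_tuple[OF s]]
  note simps = linear_map_diff[OF Free.cvec_axioms Free.cvec_axioms L]
    linear_map_diff[OF Free.cvec_axioms Free.cvec_axioms R]
    linear_map_add[OF L] linear_map_add[OF R] linear_map_smult[OF L] linear_map_smult[OF R]
    dirac_tmult tmult_upd_right tmult_upd_left dirac_tuple tuple_upd factor_closed
    Free.M.a_closed Free.smult_carrier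
  have si: "s i \<in> carrier (W i)" if "i \<in> I" for i using s that by auto
  show "dirac s \<otimes>\<^bsub>Free\<^esub> r \<in> tensor_rels I W" using r
  proof (cases rule: tensor_rels_cases)
    case (add t i x y)
    interpret calg "W i" using add(2) by (rule calg_factor)
    show ?thesis
      using add s si tensor_rels_addI[OF tmult_closed[OF s add(1)] add(2)
          factor_mult_closed[OF add(2) si[OF add(2)] add(3)] factor_mult_closed[OF add(2) si[OF add(2)] add(4)]]
      by (simp add: simps r_distr del: monoid_algebra_simps)
  next
    case (smult t i x c)
    interpret calg "W i" using smult(2) by (rule calg_factor)
    show ?thesis
      using smult s si tensor_rels_smultI[OF tmult_closed[OF s smult(1)] smult(2)
          factor_mult_closed[OF smult(2) si[OF smult(2)] smult(3)]]
      by (simp add: simps smult_mult_right del: monoid_algebra_simps)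
  qed
  show "r \<otimes>\<^bsub>Free\<^esub> dirac s \<in> tensor_rels I W" using r
  proof (cases rule: tensor_rels_cases)
    case (add t i x y)
    interpret calg "W i" using add(2) by (rule calg_factor)
    show ?thesis
      using add s si tensor_rels_addI[OF tmult_closed[OF add(1) s] add(2)
          factor_mult_closed[OF add(2) add(3) si[OF add(2)]] factor_mult_closed[OF add(2) add(4) si[OF add(2)]]]
      by (simp add: simps l_distr del: monoid_algebra_simps)
  next
    case (smult t i x c)
    interpret calg "W i" using smult(2) by (rule calg_factor)
    show ?thesis
      using smult s si tensor_rels_smultI[OF tmult_closed[OF smult(1) s] smult(2)
          factor_mult_closed[OF smult(2) smult(3) si[OF smult(2)]]]
      by (simp add: simps smult_mult_left del: monoid_algebra_simps)
  qed
qed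

lemma Rels_ideal: "ideal Rels Free"
proof (rule idealI)
  show "ring Free" by (rule FreeA.ring_axioms)
  show "subgroup Rels (add_monoid Free)" by (rule Rels.a_subgroup)
  fix r f assume r: "r \<in> Rels" and f: "f \<in> carrier Free"
  have sub: "submodule Rels complex_alg Free" by (rule Free.lspan_submodule[OF tensor_rels_carrier])
  have L: "Rels \<subseteq> {a \<in> carrier Free. dirac s \<otimes>\<^bsub>Free\<^esub> a \<in> Rels}" if "s \<in> tuples" for s
  proof (rule Free.lspan_least)
    show "submodule {a \<in> carrier Free. dirac s \<otimes>\<^bsub>Free\<^esub> a \<in> Rels} complex_alg Free"
      by (rule linear_map_subspace_vimage[OF Free.cvec_axioms Free.cvec_axioms
            FreeA.mult_left_linear[OF dirac_tuple[OF that]] sub])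
  qed (use tensor_rels_carrier rels_mult_dirac(1)[OF _ that] Free.lspan_superset in blast)
  have R: "Rels \<subseteq> {a \<in> carrier Free. a \<otimes>\<^bsub>Free\<^esub> dirac s \<in> Rels}" if "s \<in> tuples" for s
  proof (rule Free.lspan_least)
    show "submodule {a \<in> carrier Free. a \<otimes>\<^bsub>Free\<^esub> dirac s \<in> Rels} complex_alg Free"
      by (rule linear_map_subspace_vimage[OF Free.cvec_axioms Free.cvec_axioms
            FreeA.mult_right_linear[OF dirac_tuple[OF that]] sub])
  qed (use tensor_rels_carrier rels_mult_dirac(2)[OF _ that] Free.lspan_superset in blast)
  have rc: "r \<in> carrier Free" using r by (rule Rels.sub_carrier)
  note l = FreeA.mult_left_linear[OF rc] and rr = FreeA.mult_right_linear[OF rc]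
  show "r \<otimes>\<^bsub>Free\<^esub> f \<in> Rels" using f
  proof (induction rule: monoid_algebra_induct)
    case zero
    show ?case
      using linear_map_zero[OF Free.cvec_axioms Free.cvec_axioms l] Rels.zero_closed by simp
  next
    case (add f g)
    then show ?case by (simp only: linear_map_add[OF l] Rels.a_closed)
  next
    case (smult c f)
    then show ?case by (simp only: linear_map_smult[OF l] Rels.smult_sub)
  next
    case (dirac s)
    then have "s \<in> tuples" by simp
    then show ?case using R[of s] r by blast
  qed
  show "f \<otimes>\<^bsub>Free\<^esub> r \<in> Rels" using f
  proof (induction rule: monoid_algebra_induct)
    case zero
    show ?case
      using linear_map_zero[OF Free.cvec_axioms Free.cvec_axioms rr] Rels.zero_closed by simp
  next
    case (add f g)
    then show ?case by (simp only: linear_map_add[OF rr] Rels.a_closed)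
  next
    case (smult c f)
    then show ?case by (simp only: linear_map_smult[OF rr] Rels.smult_sub)
  next
    case (dirac s)
    then have "s \<in> tuples" by simp
    then show ?case using L[of s] r by blast
  qed
qed

lemma calg_tensor: "calg (tensor I W)"
  unfolding tensor_eq_quot by (rule FreeA.quot_calg[OF Rels_ideal])

lemma pure_mult:
  assumes "s \<in> tuples" "t \<in> tuples"
  shows "pure I W s \<otimes>\<^bsub>tensor I W\<^esub> pure I W t = pure I W (tmult s t)"
  unfolding tensor_eq_quot pure_eq_coset
  by (simp only: FreeA.quot_mult[OF Rels_ideal dirac_tuple[OF assms(1)] dirac_tuple[OF assms(2)]] dirac_tmult)

end

subsection \<open>Actions on tensor products\<close>

text \<open>The action of a tensor product of algebras is defined by lifting to representatives in
  both arguments. The inner lift, in the module argument, is \<open>half_act f\<close> for a fixed representative \<open>f\<close>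
  of the algebra element; it depends linearly on \<open>f\<close> and kills the relations, so the outer lift exists
  as well.\<close>

locale tensor_action = U: tensor_family I U + W: tensor_family I W
  for I and U :: "nat \<Rightarrow> (complex, 'u, 'y) module_scheme" and W :: "nat \<Rightarrow> ('u, 'm) amod" +
  assumes act_linear_left: "\<lbrakk>i \<in> I; m \<in> carrier (W i)\<rbrakk> \<Longrightarrow> linear_map (U i) (W i) (\<lambda>u. act (W i) u m)"
    and act_linear_right: "\<lbrakk>i \<in> I; u \<in> carrier (U i)\<rbrakk> \<Longrightarrow> linear_map (W i) (W i) (act (W i) u)"
begin

definition tact :: "(nat \<Rightarrow> 'u) \<Rightarrow> (nat \<Rightarrow> 'm) \<Rightarrow> nat \<Rightarrow> 'm"
  where "tact a m = (\<lambda>i\<in>I. act (W i) (a i) (m i))"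

lemma tact_closed: "\<lbrakk>a \<in> U.tuples; m \<in> W.tuples\<rbrakk> \<Longrightarrow> tact a m \<in> W.tuples"
  by (auto simp: tact_def PiE_iff intro: linear_map_closed[OF act_linear_right])

lemma tact_upd_left: "i \<in> I \<Longrightarrow> tact (a(i := u)) m = (tact a m)(i := act (W i) u (m i))"
  by (auto simp: tact_def)

lemma tact_upd_right: "i \<in> I \<Longrightarrow> tact a (m(i := x)) = (tact a m)(i := act (W i) (a i) x)"
  by (auto simp: tact_def)

lemma multilinear_left:
  assumes m: "m \<in> W.tuples" shows "multilinear I U (tensor I W) (\<lambda>a. pure I W (tact a m))"
proof (rule multilinearI)
  fix a assume a: "a \<in> U.tuples"
  then show "pure I W (tact a m) \<in> carrier (tensor I W)"
    by (intro W.pure_closed tact_closed m)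
  fix i assume i: "i \<in> I"
  then have "m i \<in> carrier (W i)" using m by auto
  then show "linear_map (U i) (tensor I W) (\<lambda>x. pure I W (tact (a(i := x)) m))"
    unfolding tact_upd_left[OF i]
    by (rule linear_map_comp[OF act_linear_left[OF i]])
      (rule multilinear_linear[OF W.pure_multilinear tact_closed[OF a m] i])
qed

lemma multilinear_right:
  assumes a: "a \<in> U.tuples" shows "multilinear I W (tensor I W) (\<lambda>m. pure I W (tact a m))"
proof (rule multilinearI)
  fix m assume m: "m \<in> W.tuples"
  then show "pure I W (tact a m) \<in> carrier (tensor I W)"
    by (intro W.pure_closed tact_closed a)
  fix i assume i: "i \<in> I"
  then have "a i \<in> carrier (U i)" using a by auto
  then show "linear_map (W i) (tensor I W) (\<lambda>x. pure I W (tact a (m(i := x))))"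
    unfolding tact_upd_right[OF i]
    by (rule linear_map_comp[OF act_linear_right[OF i]])
      (rule multilinear_linear[OF W.pure_multilinear tact_closed[OF a m] i])
qed

definition free_act :: "((nat \<Rightarrow> 'u) \<Rightarrow> complex) \<Rightarrow> (nat \<Rightarrow> 'm) \<Rightarrow> ((nat \<Rightarrow> 'm) \<Rightarrow> complex) set"
  where "free_act f m = lin_ext (tensor I W) (\<lambda>a. pure I W (tact a m)) f"

lemma tensor_lift_left: "m \<in> W.tuples \<Longrightarrow> tensor_lift I U (tensor I W) (\<lambda>a. pure I W (tact a m))"
  by (intro tensor_lift.intro tensor_lift_axioms.intro U.tensor_family_axioms W.cvec_tensor multilinear_left)

lemma free_act_linear: "m \<in> W.tuples \<Longrightarrow> linear_map U.Free (tensor I W) (\<lambda>f. free_act f m)"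
  unfolding free_act_def by (rule tensor_lift.free_lift_linear[OF tensor_lift_left])

lemma free_act_rels: "\<lbrakk>m \<in> W.tuples; f \<in> U.Rels\<rbrakk> \<Longrightarrow> free_act f m = \<zero>\<^bsub>tensor I W\<^esub>"
  unfolding free_act_def by (rule tensor_lift.free_lift_rels[OF tensor_lift_left])

lemma free_act_dirac: "\<lbrakk>m \<in> W.tuples; a \<in> U.tuples\<rbrakk> \<Longrightarrow> free_act (dirac a) m = pure I W (tact a m)"
  unfolding free_act_def by (rule tensor_lift.free_lift_dirac[OF tensor_lift_left])

lemma free_act_multilinear:
  assumes "f \<in> carrier U.Free" shows "multilinear I W (tensor I W) (free_act f)"
  using assms
proof (induction rule: monoid_algebra_induct)
  case zero
  have "free_act (\<lambda>_. 0) m = \<zero>\<^bsub>tensor I W\<^esub>" if "m \<in> W.tuples" for m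
    using linear_map_zero[OF U.Free.cvec_axioms W.cvec_tensor free_act_linear[OF that]] by simp
  moreover have "multilinear I W (tensor I W) (\<lambda>m. \<zero>\<^bsub>tensor I W\<^esub>)"
  proof -
    interpret T: cvec "tensor I W" by (rule W.cvec_tensor)
    show ?thesis by (intro multilinearI linear_map_zero_fun W.cvec_tensor T.M.zero_closed)
  qed
  ultimately show ?case using W.multilinear_cong by force
next
  case (add f g)
  have "multilinear I W (tensor I W) (\<lambda>m. free_act f m \<oplus>\<^bsub>tensor I W\<^esub> free_act g m)"
  proof (rule multilinearI)
    interpret T: cvec "tensor I W" by (rule W.cvec_tensor)
    fix m assume m: "m \<in> W.tuples"
    then show "free_act f m \<oplus>\<^bsub>tensor I W\<^esub> free_act g m \<in> carrier (tensor I W)"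
      using add.IH by (simp add: multilinear_closed)
    fix i assume i: "i \<in> I"
    show "linear_map (W i) (tensor I W) (\<lambda>x. free_act f (m(i := x)) \<oplus>\<^bsub>tensor I W\<^esub> free_act g (m(i := x)))"
      by (intro linear_map_add_fun W.cvec_tensor multilinear_linear[OF _ m i] add.IH)
  qed
  then show ?case
    by (rule W.multilinear_cong) (rule linear_map_add[OF free_act_linear add.hyps, symmetric])
next
  case (smult c f)
  have "multilinear I W (tensor I W) (\<lambda>m. c \<odot>\<^bsub>tensor I W\<^esub> free_act f m)"
  proof (rule multilinearI)
    interpret T: cvec "tensor I W" by (rule W.cvec_tensor)
    fix m assume m: "m \<in> W.tuples"
    then show "c \<odot>\<^bsub>tensor I W\<^esub> free_act f m \<in> carrier (tensor I W)"
      using smult.IH by (simp add: multilinear_closed)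
    fix i assume i: "i \<in> I"
    show "linear_map (W i) (tensor I W) (\<lambda>x. c \<odot>\<^bsub>tensor I W\<^esub> free_act f (m(i := x)))"
      by (intro linear_map_smult_fun W.cvec_tensor multilinear_linear[OF _ m i] smult.IH)
  qed
  then show ?case
    by (rule W.multilinear_cong) (rule linear_map_smult[OF free_act_linear smult.hyps, symmetric])
next
  case (dirac a)
  then have a: "a \<in> U.tuples" by simp
  show ?case
    by (rule W.multilinear_cong[OF multilinear_right[OF a]]) (rule free_act_dirac[OF _ a, symmetric])
qed

definition half_act :: "((nat \<Rightarrow> 'u) \<Rightarrow> complex) \<Rightarrow> ((nat \<Rightarrow> 'm) \<Rightarrow> complex) set \<Rightarrow> ((nat \<Rightarrow> 'm) \<Rightarrow> complex) set"
  where "half_act f = on_classes (lin_ext (tensor I W) (free_act f))"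

lemma tensor_lift_right: "f \<in> carrier U.Free \<Longrightarrow> tensor_lift I W (tensor I W) (free_act f)"
  by (intro tensor_lift.intro tensor_lift_axioms.intro W.tensor_family_axioms W.cvec_tensor free_act_multilinear)

lemma half_act_linear_right: "f \<in> carrier U.Free \<Longrightarrow> linear_map (tensor I W) (tensor I W) (half_act f)"
  unfolding half_act_def by (rule tensor_lift.lift_linear[OF tensor_lift_right])

lemma half_act_pure: "\<lbrakk>f \<in> carrier U.Free; m \<in> W.tuples\<rbrakk> \<Longrightarrow> half_act f (pure I W m) = free_act f m"
  unfolding half_act_def by (rule tensor_lift.lift_pure[OF tensor_lift_right])

lemma half_act_linear_left:
  assumes "X \<in> carrier (tensor I W)" shows "linear_map U.Free (tensor I W) (\<lambda>f. half_act f X)"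
  using assms
proof (induction rule: W.tensor_induct)
  case zero
  have "half_act f \<zero>\<^bsub>tensor I W\<^esub> = \<zero>\<^bsub>tensor I W\<^esub>" if "f \<in> carrier U.Free" for f
    by (rule linear_map_zero[OF W.cvec_tensor W.cvec_tensor half_act_linear_right[OF that]])
  then show ?case
    by (intro linear_map_cong[OF linear_map_zero_fun[OF W.cvec_tensor] U.Free.cvec_axioms]) simp
next
  case (add X Y)
  show ?case
    by (rule linear_map_cong[OF linear_map_add_fun[OF W.cvec_tensor add.IH] U.Free.cvec_axioms])
      (rule linear_map_add[OF half_act_linear_right add.hyps, symmetric])
next
  case (smult c X)
  show ?case
    by (rule linear_map_cong[OF linear_map_smult_fun[OF W.cvec_tensor smult.IH] U.Free.cvec_axioms])
      (rule linear_map_smult[OF half_act_linear_right smult.hyps, symmetric])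
next
  case (pure m)
  show ?case
    by (rule linear_map_cong[OF free_act_linear[OF pure] U.Free.cvec_axioms])
      (rule half_act_pure[OF _ pure, symmetric])
qed

lemma half_act_rels:
  assumes "X \<in> carrier (tensor I W)" "f \<in> U.Rels" shows "half_act f X = \<zero>\<^bsub>tensor I W\<^esub>"
proof -
  have f: "f \<in> carrier U.Free" by (rule U.Rels.sub_carrier[OF assms(2)])
  show ?thesis
    by (rule W.tensor_linear_eq[OF half_act_linear_right[OF f] linear_map_zero_fun[OF W.cvec_tensor]
          W.cvec_tensor _ assms(1)])
      (simp add: half_act_pure[OF f] free_act_rels assms(2))
qed

lemma tensor_act_eq: "tensor_act I W u X = on_classes (\<lambda>f. half_act f X) u"
  by (simp add: tensor_act_def half_act_def free_act_def[abs_def] tact_def)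

lemma tensor_act_linear_left:
  "X \<in> carrier (tensor I W) \<Longrightarrow> linear_map (tensor I U) (tensor I W) (\<lambda>u. tensor_act I W u X)"
  unfolding U.tensor_eq_quot tensor_act_eq
  by (intro U.Rels.on_classes_linear half_act_linear_left W.cvec_tensor half_act_rels)

lemma tensor_act_pure_left:
  "\<lbrakk>X \<in> carrier (tensor I W); a \<in> U.tuples\<rbrakk> \<Longrightarrow> tensor_act I W (pure I U a) X = half_act (dirac a) X"
  unfolding tensor_act_eq U.pure_eq_coset
  by (rule U.Rels.on_classes_coset[OF W.cvec_tensor half_act_linear_left half_act_rels U.dirac_tuple])

lemma tensor_act_pure:
  "\<lbrakk>a \<in> U.tuples; m \<in> W.tuples\<rbrakk> \<Longrightarrow> tensor_act I W (pure I U a) (pure I W m) = pure I W (tact a m)"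
  by (simp add: tensor_act_pure_left W.pure_closed half_act_pure U.dirac_tuple free_act_dirac)

lemma tensor_act_linear_right:
  assumes "u \<in> carrier (tensor I U)" shows "linear_map (tensor I W) (tensor I W) (tensor_act I W u)"
  using assms
proof (induction rule: U.tensor_induct)
  case zero
  have "tensor_act I W \<zero>\<^bsub>tensor I U\<^esub> X = \<zero>\<^bsub>tensor I W\<^esub>" if "X \<in> carrier (tensor I W)" for X
    by (rule linear_map_zero[OF U.cvec_tensor W.cvec_tensor tensor_act_linear_left[OF that]])
  then show ?case
    by (intro linear_map_cong[OF linear_map_zero_fun[OF W.cvec_tensor] W.cvec_tensor]) simp
next
  case (add u v)
  show ?case
    by (rule linear_map_cong[OF linear_map_add_fun[OF W.cvec_tensor add.IH] W.cvec_tensor])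
      (rule linear_map_add[OF tensor_act_linear_left add.hyps, symmetric])
next
  case (smult c u)
  show ?case
    by (rule linear_map_cong[OF linear_map_smult_fun[OF W.cvec_tensor smult.IH] W.cvec_tensor])
      (rule linear_map_smult[OF tensor_act_linear_left smult.hyps, symmetric])
next
  case (pure a)
  show ?case
    by (rule linear_map_cong[OF half_act_linear_right[OF U.dirac_tuple[OF pure]] W.cvec_tensor])
      (rule tensor_act_pure_left[OF _ pure, symmetric])
qed

lemma tensor_act_closed:
  "\<lbrakk>u \<in> carrier (tensor I U); X \<in> carrier (tensor I W)\<rbrakk> \<Longrightarrow> tensor_act I W u X \<in> carrier (tensor I W)"
  by (rule linear_map_closed[OF tensor_act_linear_right])

end

locale tensor_module = tensor_action I U W + U: tensor_algebra_family I U
  for I and U :: "nat \<Rightarrow> (complex, 'u, 'y) module_scheme" and W :: "nat \<Rightarrow> ('u, 'm) amod" +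
  assumes act_mult: "\<lbrakk>i \<in> I; u \<in> carrier (U i); v \<in> carrier (U i); m \<in> carrier (W i)\<rbrakk> \<Longrightarrow>
    act (W i) (u \<otimes>\<^bsub>U i\<^esub> v) m = act (W i) u (act (W i) v m)"
begin

lemma tact_tmult:
  "\<lbrakk>a \<in> U.tuples; b \<in> U.tuples; m \<in> W.tuples\<rbrakk> \<Longrightarrow> tact (U.tmult a b) m = tact a (tact b m)"
  by (auto simp: tact_def U.tmult_def PiE_iff act_mult intro!: restrict_ext)

sublocale TU: calg "tensor I U" by (rule U.calg_tensor)

lemma tensor_act_mult:
  assumes "u \<in> carrier (tensor I U)" "v \<in> carrier (tensor I U)" "X \<in> carrier (tensor I W)"
  shows "tensor_act I W (u \<otimes>\<^bsub>tensor I U\<^esub> v) X = tensor_act I W u (tensor_act I W v X)"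
proof -
  have 1: "tensor_act I W (pure I U a \<otimes>\<^bsub>tensor I U\<^esub> pure I U b) Y =
      tensor_act I W (pure I U a) (tensor_act I W (pure I U b) Y)"
    if ab: "a \<in> U.tuples" "b \<in> U.tuples" and Y: "Y \<in> carrier (tensor I W)" for a b Y
    by (rule W.tensor_linear_eq[OF tensor_act_linear_right linear_map_comp[OF tensor_act_linear_right
            tensor_act_linear_right] W.cvec_tensor _ Y])
      (simp_all add: ab U.pure_closed U.pure_mult tensor_act_pure tact_closed U.tmult_closed tact_tmult)
  have 2: "tensor_act I W (pure I U a \<otimes>\<^bsub>tensor I U\<^esub> v) X =
      tensor_act I W (pure I U a) (tensor_act I W v X)" if a: "a \<in> U.tuples" for a
    by (rule U.tensor_linear_eq[OF linear_map_comp[OF TU.mult_left_linear tensor_act_linear_left]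
          linear_map_comp[OF tensor_act_linear_left tensor_act_linear_right] W.cvec_tensor _ assms(2)])
      (simp_all add: a U.pure_closed 1 assms)
  show ?thesis
    by (rule U.tensor_linear_eq[OF linear_map_comp[OF TU.mult_right_linear tensor_act_linear_left]
          tensor_act_linear_left W.cvec_tensor _ assms(1)])
      (simp_all add: 2 assms tensor_act_closed)
qed

text \<open>The annihilator of a vector is a left ideal. For a vector annihilated by \<open>\<Delta>(\<nn>\<^sub>+)\<close> this disposes of the
  second summand of the decomposition of \<open>U \<gg>\<^sup>\<otimes>\<^sup>(\<^sup>n\<^sup>+\<^sup>1\<^sup>)\<close>.\<close>

lemma gen_left_ideal_annihilates:
  assumes X: "X \<in> carrier (tensor I W)" and S: "S \<subseteq> carrier (tensor I U)"
    and ann: "\<And>s. s \<in> S \<Longrightarrow> tensor_act I W s X = \<zero>\<^bsub>tensor I W\<^esub>"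
    and q: "q \<in> gen_left_ideal (tensor I U) S"
  shows "tensor_act I W q X = \<zero>\<^bsub>tensor I W\<^esub>"
proof -
  interpret T: cvec "tensor I W" by (rule W.cvec_tensor)
  let ?J = "{u \<in> carrier (tensor I U). tensor_act I W u X = \<zero>\<^bsub>tensor I W\<^esub>}"
  have "submodule ?J complex_alg (tensor I U)"
    using linear_map_subspace_vimage[OF U.cvec_tensor W.cvec_tensor tensor_act_linear_left[OF X],
        of "{\<zero>\<^bsub>tensor I W\<^esub>}"] T.subspaceI[of "{\<zero>\<^bsub>tensor I W\<^esub>}"] by simp
  then have "additive_subgroup ?J (tensor I U)"
    by (intro additive_subgroupI submodule.axioms(1))
  moreover have "a \<otimes>\<^bsub>tensor I U\<^esub> u \<in> ?J" if "a \<in> carrier (tensor I U)" "u \<in> ?J" for a u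
    using that X linear_map_zero[OF W.cvec_tensor W.cvec_tensor tensor_act_linear_right[of a]]
    by (simp add: tensor_act_mult)
  ultimately have "left_ideal ?J (tensor I U)" by (simp add: left_ideal_def)
  then have "gen_left_ideal (tensor I U) S \<subseteq> ?J"
    by (rule TU.gen_left_ideal_least) (use S ann in blast)
  then show ?thesis using q by blast
qed

end

section \<open>Enveloping algebras\<close>

text \<open>Closure of the carrier makes the defining relations elements of the tensor algebra; they generate
  a genuine ideal then. It has to be checked for \<open>\<bb>\<^sub>-\<close> and for \<open>t\<^sup>-\<^sup>1 \<gg>[t\<^sup>-\<^sup>1]\<close>.\<close>

locale lie_ops =
  fixes L :: "('a, 'z) lie_scheme"
  assumes add_closed: "\<lbrakk>x \<in> carrier L; y \<in> carrier L\<rbrakk> \<Longrightarrow> x \<oplus>\<^bsub>L\<^esub> y \<in> carrier L"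
    and scale_closed: "x \<in> carrier L \<Longrightarrow> c \<odot>\<^bsub>L\<^esub> x \<in> carrier L"
    and bracket_closed: "\<lbrakk>x \<in> carrier L; y \<in> carrier L\<rbrakk> \<Longrightarrow> bracket L x y \<in> carrier L"
begin

abbreviation Words :: "'a list monoid"
  where "Words \<equiv> \<lparr>carrier = lists (carrier L), monoid.mult = (@), one = []\<rparr>"
abbreviation Tens :: "(complex, 'a list \<Rightarrow> complex) module" where "Tens \<equiv> monoid_algebra Words"
abbreviation Rel_ideal :: "('a list \<Rightarrow> complex) set"
  where "Rel_ideal \<equiv> Idl\<^bsub>Tens\<^esub> (env_rels L)"

definition word :: "'a list \<Rightarrow> 'a env" where "word w = Rel_ideal +>\<^bsub>Tens\<^esub> dirac w"

sublocale Words: monoid Words by (rule monoidI) auto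
sublocale Tens: calg Tens by (rule Words.calg_monoid_algebra)

lemma dirac_word: "w \<in> lists (carrier L) \<Longrightarrow> dirac w \<in> carrier Tens"
  by (rule dirac_carrier) simp

lemma dirac_append: "dirac v \<otimes>\<^bsub>Tens\<^esub> dirac w = dirac (v @ w)"
  by (simp add: Words.dirac_mult)

lemma tensor_alg_eq: "tensor_alg L = Tens" by (simp add: tensor_alg_def)

lemma env_rels_cases [consumes 1, case_names add smult bracket]:
  assumes "r \<in> env_rels L"
  obtains x y where "x \<in> carrier L" "y \<in> carrier L"
      "r = dirac [x \<oplus>\<^bsub>L\<^esub> y] \<ominus>\<^bsub>Tens\<^esub> (dirac [x] \<oplus>\<^bsub>Tens\<^esub> dirac [y])"
  | x c where "x \<in> carrier L" "r = dirac [c \<odot>\<^bsub>L\<^esub> x] \<ominus>\<^bsub>Tens\<^esub> (c \<odot>\<^bsub>Tens\<^esub> dirac [x])"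
  | x y where "x \<in> carrier L" "y \<in> carrier L"
      "r = ((dirac [x] \<otimes>\<^bsub>Tens\<^esub> dirac [y]) \<ominus>\<^bsub>Tens\<^esub> (dirac [y] \<otimes>\<^bsub>Tens\<^esub> dirac [x])) \<ominus>\<^bsub>Tens\<^esub> dirac [bracket L x y]"
  using assms unfolding env_rels_def Let_def tensor_alg_eq by (elim UnE CollectE exE conjE) metis+

lemma env_rels_carrier: "env_rels L \<subseteq> carrier Tens"
proof
  fix r assume "r \<in> env_rels L"
  then show "r \<in> carrier Tens"
    by (cases rule: env_rels_cases)
      (simp_all add: dirac_word add_closed scale_closed bracket_closed Tens.M.minus_closed
        Tens.M.a_closed Tens.smult_carrier dirac_append del: monoid_algebra_simps)
qed

lemma Rel_ideal: "ideal Rel_ideal Tens"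
  by (rule Tens.genideal_ideal[OF env_rels_carrier])

lemma env_rels_Rel_ideal: "r \<in> env_rels L \<Longrightarrow> r \<in> Rel_ideal"
  using Tens.genideal_self[OF env_rels_carrier] by blast

sublocale Rel: csubspace Tens Rel_ideal
  by (rule Tens.ideal_csubspace[OF Rel_ideal])

lemma env_eq_quot: "env L = quot Tens Rel_ideal"
  by (simp add: env_def tensor_alg_eq)

lemma env_inc_eq: "env_inc L x = word [x]"
  by (simp add: env_inc_def tensor_alg_eq word_def)

sublocale env: calg "env L"
  unfolding env_eq_quot by (rule Tens.quot_calg[OF Rel_ideal])

lemma word_closed: "w \<in> lists (carrier L) \<Longrightarrow> word w \<in> carrier (env L)"
  unfolding env_eq_quot word_def by (intro Rel.coset_closed dirac_word)

lemma word_append: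
  "\<lbrakk>v \<in> lists (carrier L); w \<in> lists (carrier L)\<rbrakk> \<Longrightarrow> word (v @ w) = word v \<otimes>\<^bsub>env L\<^esub> word w"
  unfolding env_eq_quot word_def by (simp only: Tens.quot_mult[OF Rel_ideal dirac_word dirac_word] dirac_append)

lemma word_Nil: "word [] = \<one>\<^bsub>env L\<^esub>"
  unfolding env_eq_quot word_def Tens.quot_one by simp

lemma env_inc_closed: "x \<in> carrier L \<Longrightarrow> env_inc L x \<in> carrier (env L)"
  unfolding env_inc_eq by (rule word_closed) simp

lemma word_Cons:
  "\<lbrakk>x \<in> carrier L; w \<in> lists (carrier L)\<rbrakk> \<Longrightarrow> word (x # w) = env_inc L x \<otimes>\<^bsub>env L\<^esub> word w"
  using word_append[of "[x]" w] by (simp add: env_inc_eq)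

lemma env_inc_add:
  assumes "x \<in> carrier L" "y \<in> carrier L"
  shows "env_inc L (x \<oplus>\<^bsub>L\<^esub> y) = env_inc L x \<oplus>\<^bsub>env L\<^esub> env_inc L y"
proof -
  have c: "dirac [x] \<in> carrier Tens" "dirac [y] \<in> carrier Tens" "dirac [x \<oplus>\<^bsub>L\<^esub> y] \<in> carrier Tens"
    using assms by (simp_all add: dirac_word add_closed)
  have "dirac [x \<oplus>\<^bsub>L\<^esub> y] \<ominus>\<^bsub>Tens\<^esub> (dirac [x] \<oplus>\<^bsub>Tens\<^esub> dirac [y]) \<in> Rel_ideal"
    by (rule env_rels_Rel_ideal) (use assms in \<open>unfold env_rels_def Let_def tensor_alg_eq, blast\<close>)
  then show ?thesis
    unfolding env_eq_quot env_inc_eq word_def Rel.quot_add[OF c(1,2)]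
    by (subst Rel.coset_eq_iff[OF c(3) Tens.M.a_closed[OF c(1,2)]])
qed

lemma env_inc_smult:
  assumes "x \<in> carrier L"
  shows "env_inc L (c \<odot>\<^bsub>L\<^esub> x) = c \<odot>\<^bsub>env L\<^esub> env_inc L x"
proof -
  have c: "dirac [x] \<in> carrier Tens" "dirac [c \<odot>\<^bsub>L\<^esub> x] \<in> carrier Tens"
    using assms by (simp_all add: dirac_word scale_closed)
  have "dirac [c \<odot>\<^bsub>L\<^esub> x] \<ominus>\<^bsub>Tens\<^esub> (c \<odot>\<^bsub>Tens\<^esub> dirac [x]) \<in> Rel_ideal"
    by (rule env_rels_Rel_ideal) (use assms in \<open>unfold env_rels_def Let_def tensor_alg_eq, blast\<close>)
  then show ?thesis
    unfolding env_eq_quot env_inc_eq word_def Rel.quot_smult[OF c(1)]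
    by (subst Rel.coset_eq_iff[OF c(2) Tens.smult_carrier[OF c(1)]])
qed

lemma env_inc_linear: "linear_map L (env L) (env_inc L)"
  by (rule linear_mapI) (simp_all add: env_inc_closed env_inc_add env_inc_smult)

lemma env_inc_bracket:
  assumes "x \<in> carrier L" "y \<in> carrier L"
  shows "env_inc L (bracket L x y) =
    env_inc L x \<otimes>\<^bsub>env L\<^esub> env_inc L y \<ominus>\<^bsub>env L\<^esub> env_inc L y \<otimes>\<^bsub>env L\<^esub> env_inc L x"
proof -
  have c: "dirac [x] \<in> carrier Tens" "dirac [y] \<in> carrier Tens" "dirac [bracket L x y] \<in> carrier Tens"
    using assms by (simp_all add: dirac_word bracket_closed)
  let ?xy = "dirac [x] \<otimes>\<^bsub>Tens\<^esub> dirac [y]" and ?yx = "dirac [y] \<otimes>\<^bsub>Tens\<^esub> dirac [x]"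
  note cm = Tens.m_closed[OF c(1,2)] Tens.m_closed[OF c(2,1)]
  have "(?xy \<ominus>\<^bsub>Tens\<^esub> ?yx) \<ominus>\<^bsub>Tens\<^esub> dirac [bracket L x y] \<in> Rel_ideal"
    by (rule env_rels_Rel_ideal) (use assms in \<open>unfold env_rels_def Let_def tensor_alg_eq, blast\<close>)
  then have "Rel_ideal +>\<^bsub>Tens\<^esub> (?xy \<ominus>\<^bsub>Tens\<^esub> ?yx) = Rel_ideal +>\<^bsub>Tens\<^esub> dirac [bracket L x y]"
    by (subst Rel.coset_eq_iff[OF Tens.M.minus_closed[OF cm] c(3)])
  then show ?thesis
    unfolding env_eq_quot env_inc_eq word_def
    using linear_map_diff[OF Tens.cvec_axioms Rel.quot_cvec Rel.coset_linear cm]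
      Tens.quot_mult[OF Rel_ideal c(1,2)] Tens.quot_mult[OF Rel_ideal c(2,1)] by simp
qed

lemma env_induct [consumes 1, case_names zero add smult word]:
  assumes "u \<in> carrier (env L)" and "P \<zero>\<^bsub>env L\<^esub>"
    and "\<And>u v. \<lbrakk>u \<in> carrier (env L); v \<in> carrier (env L); P u; P v\<rbrakk> \<Longrightarrow> P (u \<oplus>\<^bsub>env L\<^esub> v)"
    and "\<And>c u. \<lbrakk>u \<in> carrier (env L); P u\<rbrakk> \<Longrightarrow> P (c \<odot>\<^bsub>env L\<^esub> u)"
    and "\<And>w. w \<in> lists (carrier L) \<Longrightarrow> P (word w)"
  shows "P u"
proof -
  obtain f where f: "f \<in> carrier Tens" "u = Rel_ideal +>\<^bsub>Tens\<^esub> f"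
    using assms(1) unfolding env_eq_quot by (rule Rel.quot_carrierE)
  have "P (Rel_ideal +>\<^bsub>Tens\<^esub> f)" using f(1)
  proof (induction rule: monoid_algebra_induct)
    case zero
    have "Rel_ideal +>\<^bsub>Tens\<^esub> (\<lambda>_. 0) = \<zero>\<^bsub>env L\<^esub>"
      using Rel.zero_coset unfolding env_eq_quot monoid_algebra_simps .
    then show ?case using assms(2) by (simp only:)
  next
    case (add f g)
    then show ?case
      using assms(3)[unfolded env_eq_quot, OF Rel.coset_closed Rel.coset_closed]
      by (metis Rel.quot_add)
  next
    case (smult c f)
    then show ?case
      using assms(4)[unfolded env_eq_quot, OF Rel.coset_closed] by (metis Rel.quot_smult)
  next
    case (dirac w)
    then show ?case using assms(5)[of w] by (simp add: word_def)
  qed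
  then show ?thesis using f by simp
qed

end

text \<open>Universal property of the enveloping algebra: a Lie map \<open>\<rho>\<close> into an algebra is extended to words,
  and the kernel of this extension is an ideal containing the defining relations.\<close>

locale env_hom = lie_ops L + target: calg A
  for L :: "('a, 'z) lie_scheme" and A :: "(complex, 'b, 'y) module_scheme" +
  fixes \<rho> :: "'a \<Rightarrow> 'b"
  assumes map_linear: "linear_map L A \<rho>"
    and map_bracket: "\<lbrakk>x \<in> carrier L; y \<in> carrier L\<rbrakk> \<Longrightarrow>
      \<rho> (bracket L x y) = \<rho> x \<otimes>\<^bsub>A\<^esub> \<rho> y \<ominus>\<^bsub>A\<^esub> \<rho> y \<otimes>\<^bsub>A\<^esub> \<rho> x"
begin

definition eval_word :: "'a list \<Rightarrow> 'b"
  where "eval_word w = foldr (\<lambda>x a. \<rho> x \<otimes>\<^bsub>A\<^esub> a) w \<one>\<^bsub>A\<^esub>"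

lemma map_closed: "x \<in> carrier L \<Longrightarrow> \<rho> x \<in> carrier A"
  by (rule linear_map_closed[OF map_linear])

lemma eval_word_closed: "w \<in> lists (carrier L) \<Longrightarrow> eval_word w \<in> carrier A"
  by (induction w) (auto simp: eval_word_def map_closed)

lemma eval_word_append:
  "\<lbrakk>v \<in> lists (carrier L); w \<in> lists (carrier L)\<rbrakk> \<Longrightarrow> eval_word (v @ w) = eval_word v \<otimes>\<^bsub>A\<^esub> eval_word w"
proof (induction v)
  case Nil
  then show ?case using eval_word_closed by (simp add: eval_word_def)
next
  case (Cons x v)
  then have "eval_word (v @ w) = eval_word v \<otimes>\<^bsub>A\<^esub> eval_word w" by simp
  then have "eval_word ((x # v) @ w) = \<rho> x \<otimes>\<^bsub>A\<^esub> (eval_word v \<otimes>\<^bsub>A\<^esub> eval_word w)"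
    by (simp add: eval_word_def)
  also have "\<dots> = (\<rho> x \<otimes>\<^bsub>A\<^esub> eval_word v) \<otimes>\<^bsub>A\<^esub> eval_word w"
    using Cons.prems by (simp add: target.m_assoc eval_word_closed map_closed)
  finally show ?case by (simp add: eval_word_def)
qed

lemma eval_word_singleton: "x \<in> carrier L \<Longrightarrow> eval_word [x] = \<rho> x"
  by (simp add: eval_word_def map_closed)

lemma eval_Pi: "eval_word \<in> carrier Words \<rightarrow> carrier A"
  by (simp add: eval_word_closed Pi_iff)

abbreviation tens_lift :: "('a list \<Rightarrow> complex) \<Rightarrow> 'b" where "tens_lift \<equiv> lin_ext A eval_word"

lemma tens_lift_linear: "linear_map Tens A tens_lift"
  by (rule lin_ext_linear[OF target.cvec_axioms eval_Pi])

lemma tens_lift_dirac: "w \<in> lists (carrier L) \<Longrightarrow> tens_lift (dirac w) = eval_word w"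
  by (rule lin_ext_dirac[OF target.cvec_axioms eval_Pi]) simp

lemma tens_lift_mult:
  assumes "f \<in> carrier Tens" "g \<in> carrier Tens"
  shows "tens_lift (f \<otimes>\<^bsub>Tens\<^esub> g) = tens_lift f \<otimes>\<^bsub>A\<^esub> tens_lift g"
proof -
  note lin = linear_map_closed[OF tens_lift_linear]
  have 1: "tens_lift (dirac v \<otimes>\<^bsub>Tens\<^esub> g) = tens_lift (dirac v) \<otimes>\<^bsub>A\<^esub> tens_lift g"
    if v: "v \<in> lists (carrier L)" for v
  proof (rule free_linear_eq[OF _ _ target.cvec_axioms _ assms(2)])
    show "linear_map Tens A (\<lambda>g. tens_lift (dirac v \<otimes>\<^bsub>Tens\<^esub> g))"
      by (rule linear_map_comp[OF Tens.mult_left_linear[OF dirac_word[OF v]] tens_lift_linear])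
    show "linear_map Tens A (\<lambda>g. tens_lift (dirac v) \<otimes>\<^bsub>A\<^esub> tens_lift g)"
      by (rule linear_map_comp[OF tens_lift_linear target.mult_left_linear[OF lin[OF dirac_word[OF v]]]])
    show "tens_lift (dirac v \<otimes>\<^bsub>Tens\<^esub> dirac w) = tens_lift (dirac v) \<otimes>\<^bsub>A\<^esub> tens_lift (dirac w)"
      if "w \<in> carrier Words" for w
      using that v by (simp add: dirac_append tens_lift_dirac eval_word_append)
  qed
  show ?thesis
  proof (rule free_linear_eq[OF _ _ target.cvec_axioms _ assms(1)])
    show "linear_map Tens A (\<lambda>f. tens_lift (f \<otimes>\<^bsub>Tens\<^esub> g))"
      by (rule linear_map_comp[OF Tens.mult_right_linear[OF assms(2)] tens_lift_linear])
    show "linear_map Tens A (\<lambda>f. tens_lift f \<otimes>\<^bsub>A\<^esub> tens_lift g)"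
      by (rule linear_map_comp[OF tens_lift_linear target.mult_right_linear[OF lin[OF assms(2)]]])
  qed (use 1 in simp)
qed

lemma tens_lift_Rel: assumes "f \<in> Rel_ideal" shows "tens_lift f = \<zero>\<^bsub>A\<^esub>"
proof -
  let ?K = "{f \<in> carrier Tens. tens_lift f = \<zero>\<^bsub>A\<^esub>}"
  note lin = linear_map_closed[OF tens_lift_linear]
  have "submodule ?K complex_alg Tens"
    using linear_map_subspace_vimage[OF Tens.cvec_axioms target.cvec_axioms tens_lift_linear,
        of "{\<zero>\<^bsub>A\<^esub>}"] target.subspaceI[of "{\<zero>\<^bsub>A\<^esub>}"] by simp
  then have "ideal ?K Tens"
    by (intro idealI Tens.ring_axioms submodule.axioms(1)) (auto simp: tens_lift_mult lin)
  moreover have "env_rels L \<subseteq> ?K"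
  proof
    fix r assume r: "r \<in> env_rels L"
    then have rc: "r \<in> carrier Tens" using env_rels_carrier by blast
    note simps = linear_map_diff[OF Tens.cvec_axioms target.cvec_axioms tens_lift_linear]
      linear_map_add[OF tens_lift_linear] linear_map_smult[OF tens_lift_linear]
      dirac_word add_closed scale_closed bracket_closed tens_lift_dirac eval_word_singleton tens_lift_mult
      linear_map_add[OF map_linear] linear_map_smult[OF map_linear] map_bracket map_closed
    from r have "tens_lift r = \<zero>\<^bsub>A\<^esub>"
      by (cases rule: env_rels_cases)
        (simp_all add: simps Tens.M.minus_closed target.M.r_neg a_minus_def[of A] Tens.M.a_closed Tens.smult_carrier
          del: monoid_algebra_simps)
    then show "r \<in> ?K" using rc by simp
  qed
  ultimately have "Rel_ideal \<subseteq> ?K" by (rule Tens.genideal_minimal)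
  then show ?thesis using assms by blast
qed

lemma env_lift_eq: "env_lift L A \<rho> = on_classes tens_lift"
  unfolding env_lift_def eval_word_def ..

lemma env_lift_linear: "linear_map (env L) A (env_lift L A \<rho>)"
  unfolding env_lift_eq env_eq_quot
  by (rule Rel.on_classes_linear[OF target.cvec_axioms tens_lift_linear tens_lift_Rel])

lemma env_lift_word: "w \<in> lists (carrier L) \<Longrightarrow> env_lift L A \<rho> (word w) = eval_word w"
  unfolding env_lift_eq word_def
  using Rel.on_classes_coset[OF target.cvec_axioms tens_lift_linear tens_lift_Rel dirac_word] tens_lift_dirac
  by simp

end

text \<open>Left multiplication by a letter \<open>x\<close> preserves the span of the ordered words: if the word begins
  with \<open>h \<in> H\<close>, then \<open>x h w = [x, h] w + h (x w)\<close>, and induction on the number of letters from \<open>H\<close>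
  applies to both \<open>[x, h] w\<close> and \<open>x w\<close>; if the word has letters from \<open>C\<close> only, \<open>x\<close> can be taken in \<open>H\<close> or in
  \<open>C\<close> by linearity, and the product is an ordered word.\<close>

lemma (in lie_ops) env_ordered_span:
  assumes L: "cvec L" and HC: "H \<subseteq> carrier L" "C \<subseteq> carrier L" and gen: "carrier L \<subseteq> lspan L (H \<union> C)"
  shows "carrier (env L) \<subseteq> lspan (env L) {word (hs @ cs) | hs cs. hs \<in> lists H \<and> cs \<in> lists C}"
    (is "_ \<subseteq> lspan _ ?S")
proof
  interpret L: cvec L by (rule L)
  let ?K = "lspan (env L) ?S"
  have lists: "hs \<in> lists (carrier L)" if "hs \<in> lists H \<or> hs \<in> lists C" for hs
    using that HC by (auto simp: lists_eq_set)
  have S: "?S \<subseteq> carrier (env L)"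
  proof
    fix u assume "u \<in> ?S"
    then obtain hs cs where u: "u = word (hs @ cs)" "hs \<in> lists H" "cs \<in> lists C" by blast
    then have "hs @ cs \<in> lists (carrier L)" using lists[of hs] lists[of cs] by simp
    then show "u \<in> carrier (env L)" using word_closed u(1) by simp
  qed
  note K = env.lspan_submodule[OF S] and KS = env.lspan_superset[of ?S]
  have Kc: "?K \<subseteq> carrier (env L)" by (rule env.lspan_subset[OF S])
  note mult_linear = linear_map_subspace_vimage[OF env.cvec_axioms env.cvec_axioms env.mult_left_linear[OF env_inc_closed] K]
  have H_mult: "env_inc L h \<otimes>\<^bsub>env L\<^esub> u \<in> ?K" if h: "h \<in> H" and u: "u \<in> ?K" for h u
  proof -
    have hc: "h \<in> carrier L" using h HC by blast
    have "?K \<subseteq> {u \<in> carrier (env L). env_inc L h \<otimes>\<^bsub>env L\<^esub> u \<in> ?K}"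
    proof (rule env.lspan_least[OF mult_linear[OF hc]], rule subsetI)
      fix u assume "u \<in> ?S"
      then obtain hs cs where u: "u = word (hs @ cs)" "hs \<in> lists H" "cs \<in> lists C" by blast
      have "env_inc L h \<otimes>\<^bsub>env L\<^esub> u = word ((h # hs) @ cs)"
        using u lists hc by (simp add: word_Cons)
      also have "\<dots> \<in> ?S" using u h by (intro CollectI exI[of _ "h # hs"] exI[of _ cs]) simp
      finally show "u \<in> {u \<in> carrier (env L). env_inc L h \<otimes>\<^bsub>env L\<^esub> u \<in> ?K}"
        using KS S \<open>u \<in> ?S\<close> by blast
    qed
    then show ?thesis using u by blast
  qed
  have base: "env_inc L x \<otimes>\<^bsub>env L\<^esub> word (hs @ cs) \<in> ?K"
    if "hs \<in> lists H" "cs \<in> lists C" "x \<in> carrier L" for hs cs x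
    using that(1,3)
  proof (induction hs arbitrary: x)
    case Nil
    have cs: "cs \<in> lists (carrier L)" using lists that(2) by blast
    have "submodule {x \<in> carrier L. env_inc L x \<otimes>\<^bsub>env L\<^esub> word cs \<in> ?K} complex_alg L"
      by (rule linear_map_subspace_vimage[OF L env.cvec_axioms _ K])
        (rule linear_map_comp[OF env_inc_linear env.mult_right_linear[OF word_closed[OF cs]]])
    moreover have "H \<union> C \<subseteq> {x \<in> carrier L. env_inc L x \<otimes>\<^bsub>env L\<^esub> word cs \<in> ?K}"
    proof
      fix x assume x: "x \<in> H \<union> C"
      then have xc: "x \<in> carrier L" using HC by blast
      have "env_inc L x \<otimes>\<^bsub>env L\<^esub> word cs = word (x # cs)" using xc cs by (simp add: word_Cons)
      also have "\<dots> \<in> ?S"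
      proof (cases "x \<in> H")
        case True
        then show ?thesis using that(2) by (intro CollectI exI[of _ "[x]"] exI[of _ cs]) simp
      next
        case False
        then show ?thesis using x that(2) by (intro CollectI exI[of _ "[]"] exI[of _ "x # cs"]) simp
      qed
      finally show "x \<in> {x \<in> carrier L. env_inc L x \<otimes>\<^bsub>env L\<^esub> word cs \<in> ?K}" using xc KS by blast
    qed
    ultimately have "lspan L (H \<union> C) \<subseteq> {x \<in> carrier L. env_inc L x \<otimes>\<^bsub>env L\<^esub> word cs \<in> ?K}"
      by (rule L.lspan_least)
    then show ?case using gen Nil.prems by auto
  next
    case (Cons h hs)
    have h: "h \<in> H" "h \<in> carrier L" and hs: "hs \<in> lists H" using Cons.hyps HC by auto
    let ?w = "word (hs @ cs)"
    have ws: "hs @ cs \<in> lists (carrier L)" using lists hs that(2) by simp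
    then have w: "?w \<in> carrier (env L)" by (rule word_closed)
    note c = env_inc_closed[OF h(2)] env_inc_closed[OF Cons.prems]
    have "env_inc L x \<otimes>\<^bsub>env L\<^esub> word ((h # hs) @ cs) = env_inc L x \<otimes>\<^bsub>env L\<^esub> env_inc L h \<otimes>\<^bsub>env L\<^esub> ?w"
      using h c w ws by (simp add: word_Cons env.m_assoc)
    also have "env_inc L x \<otimes>\<^bsub>env L\<^esub> env_inc L h =
        env_inc L (bracket L x h) \<oplus>\<^bsub>env L\<^esub> env_inc L h \<otimes>\<^bsub>env L\<^esub> env_inc L x"
      using c by (simp add: env_inc_bracket[OF Cons.prems h(2)] a_minus_def env.a_assoc env.l_neg)
    also have "\<dots> \<otimes>\<^bsub>env L\<^esub> ?w =
        env_inc L (bracket L x h) \<otimes>\<^bsub>env L\<^esub> ?w \<oplus>\<^bsub>env L\<^esub> env_inc L h \<otimes>\<^bsub>env L\<^esub> (env_inc L x \<otimes>\<^bsub>env L\<^esub> ?w)"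
      using c w bracket_closed[OF Cons.prems h(2)] by (simp add: env.l_distr env.m_assoc env_inc_closed)
    also have "\<dots> \<in> ?K"
      by (intro env.submoduleE(5)[OF K] H_mult h Cons.IH hs bracket_closed Cons.prems)
    finally show ?case .
  qed
  have all_mult: "env_inc L x \<otimes>\<^bsub>env L\<^esub> u \<in> ?K" if x: "x \<in> carrier L" and u: "u \<in> ?K" for x u
  proof -
    have "?K \<subseteq> {u \<in> carrier (env L). env_inc L x \<otimes>\<^bsub>env L\<^esub> u \<in> ?K}"
      by (rule env.lspan_least[OF mult_linear[OF x]]) (use base[OF _ _ x] S in blast)
    then show ?thesis using u by blast
  qed
  have words: "word w \<in> ?K" if "w \<in> lists (carrier L)" for w
    using that
  proof (induction w)
    case Nil
    have "word ([] @ []) \<in> ?S" by blast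
    then show ?case using KS by auto
  next
    case (Cons x w)
    then show ?case by (simp add: word_Cons all_mult)
  qed
  fix u assume "u \<in> carrier (env L)"
  then show "u \<in> ?K"
  proof (induction rule: env_induct)
    case zero
    show ?case by (rule env.submodule_zero[OF K])
  next
    case (add u v)
    then show ?case by (blast intro: env.submoduleE(5)[OF K])
  next
    case (smult c u)
    then show ?case using env.submoduleE(4)[OF K, of c u] by simp
  qed (rule words)
qed

section \<open>Cyclic modules\<close>

lemma cyclic_module_simps [simp]:
  "carrier (cyclic_module A J) = carrier (quot A J)"
  "\<zero>\<^bsub>cyclic_module A J\<^esub> = \<zero>\<^bsub>quot A J\<^esub>"
  "add (cyclic_module A J) = add (quot A J)"
  "smult (cyclic_module A J) = smult (quot A J)"
  "act (cyclic_module A J) = (\<lambda>u X. \<Union>x\<in>X. J +>\<^bsub>A\<^esub> (u \<otimes>\<^bsub>A\<^esub> x))"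
  by (simp_all add: cyclic_module_def module.defs amod.defs)

context calg begin

lemma left_ideal_csubspace: "left_ideal J A \<Longrightarrow> csubspace A J"
  by (rule csubspaceI[OF cvec_axioms left_ideal_submodule])

lemma cyclic_act:
  assumes J: "left_ideal J A" and u: "u \<in> carrier A" and x: "x \<in> carrier A"
  shows "act (cyclic_module A J) u (J +> x) = J +> (u \<otimes> x)"
proof -
  interpret S: csubspace A J by (rule left_ideal_csubspace[OF J])
  have "J +> (u \<otimes> y) = J +> (u \<otimes> x)" if y: "y \<in> carrier A" "y \<ominus> x \<in> J" for y
  proof -
    have "u \<otimes> y \<ominus> u \<otimes> x = u \<otimes> (y \<ominus> x)"
      using linear_map_diff[OF cvec_axioms cvec_axioms mult_left_linear[OF u] y(1) x] by simp
    also have "\<dots> \<in> J" using J u y by (simp add: left_ideal_def)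
    finally show ?thesis using u x y by (simp add: S.coset_eq_iff)
  qed
  then show ?thesis using S.Union_coset[OF x, of "\<lambda>y. J +> (u \<otimes> y)"] by simp
qed

lemma cyclic_cvec:
  assumes J: "left_ideal J A" shows "cvec (cyclic_module A J)"
proof -
  interpret S: csubspace A J by (rule left_ideal_csubspace[OF J])
  interpret Q: cvec "quot A J" by (rule S.quot_cvec)
  show ?thesis
    by (rule cvecI) (simp_all add: Q.smult_add_left Q.smult_add_right Q.smult_smult Q.M.a_ac)
qed

lemma cyclic_act_linear_left:
  assumes J: "left_ideal J A" and m: "m \<in> carrier (cyclic_module A J)"
  shows "linear_map A (cyclic_module A J) (\<lambda>u. act (cyclic_module A J) u m)"
proof -
  interpret S: csubspace A J by (rule left_ideal_csubspace[OF J])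
  obtain x where x: "x \<in> carrier A" "m = J +> x" using m by (auto elim: S.quot_carrierE)
  show ?thesis unfolding x(2)
    by (rule linear_mapI)
      (simp_all only: cyclic_act[OF J] x(1) M.add.m_closed smult_carrier m_closed l_distr smult_mult_left
        S.quot_add S.quot_smult S.coset_closed cyclic_module_simps(1-4))
qed

lemma cyclic_act_linear_right:
  assumes J: "left_ideal J A" and u: "u \<in> carrier A"
  shows "linear_map (cyclic_module A J) (cyclic_module A J) (act (cyclic_module A J) u)"
proof -
  interpret S: csubspace A J by (rule left_ideal_csubspace[OF J])
  show ?thesis
    by (rule linear_mapI; simp only: cyclic_module_simps(1-4); elim S.quot_carrierE)
      (simp_all only: cyclic_act[OF J] u M.add.m_closed smult_carrier m_closed r_distr smult_mult_right
        S.quot_add S.quot_smult S.coset_closed)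
qed

lemma cyclic_act_mult:
  assumes J: "left_ideal J A" and "u \<in> carrier A" "v \<in> carrier A" "m \<in> carrier (cyclic_module A J)"
  shows "act (cyclic_module A J) (u \<otimes> v) m = act (cyclic_module A J) u (act (cyclic_module A J) v m)"
proof -
  interpret S: csubspace A J by (rule left_ideal_csubspace[OF J])
  obtain x where x: "x \<in> carrier A" "m = J +> x" using assms(4) by (auto elim: S.quot_carrierE)
  show ?thesis using assms(2,3) x by (simp only: cyclic_act[OF J] m_closed m_assoc)
qed

end

section \<open>Roots and the form\<close>

sublocale complex_lie_algebra \<subseteq> cvec L ..

sublocale complex_lie_algebra \<subseteq> U: lie_ops L
  by (rule lie_ops.intro) (simp_all add: bracket_closed)

context complex_lie_algebra begin

lemma bracket_linear_left: "y \<in> carrier L \<Longrightarrow> linear_map L L (\<lambda>x. bracket L x y)"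
  by (rule linear_mapI) (simp_all add: bracket_closed bracket_add_left bracket_smult_left)

lemma bracket_linear_right: "x \<in> carrier L \<Longrightarrow> linear_map L L (bracket L x)"
  by (rule linear_mapI) (simp_all add: bracket_closed bracket_add_right bracket_smult_right)

lemma bracket_anti:
  assumes "x \<in> carrier L" "y \<in> carrier L" shows "bracket L x y = \<ominus> bracket L y x"
proof -
  have "\<zero> = bracket L (x \<oplus> y) (x \<oplus> y)" using assms by (simp add: bracket_self)
  also have "\<dots> = (bracket L x x \<oplus> bracket L y x) \<oplus> (bracket L x y \<oplus> bracket L y y)"
    using assms by (simp add: bracket_add_left bracket_add_right bracket_closed)
  also have "\<dots> = bracket L x y \<oplus> bracket L y x"
    using assms by (simp add: bracket_self bracket_closed M.a_comm)
  finally show ?thesis using assms by (metis bracket_closed minus_equality)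
qed

lemma bracket_leibniz:
  assumes "h \<in> carrier L" "x \<in> carrier L" "y \<in> carrier L"
  shows "bracket L h (bracket L x y) = bracket L (bracket L h x) y \<oplus> bracket L x (bracket L h y)"
proof -
  note c = bracket_closed assms
  let ?a = "bracket L h (bracket L x y)" and ?b = "bracket L x (bracket L h y)"
    and ?c = "bracket L (bracket L h x) y"
  have "bracket L x (bracket L y h) = \<ominus> ?b"
    using linear_map_uminus[OF cvec_axioms cvec_axioms bracket_linear_right, of x "bracket L h y"]
      bracket_anti[of y h] c by simp
  moreover have "bracket L y (bracket L h x) = \<ominus> ?c"
    using bracket_anti[of y "bracket L h x"] c by simp
  ultimately have "?a \<oplus> \<ominus> ?b \<oplus> \<ominus> ?c = \<zero>" using jacobi[of h x y] assms by simp
  then have "?a \<ominus> (?c \<oplus> ?b) = \<zero>"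
    using c by (simp add: a_minus_def M.minus_add M.a_ac)
  then show ?thesis using diff_zero_imp_eq c by simp
qed

end

context simple_tri_lie begin

lemma cartan_carrier: "h \<in> cartan G \<Longrightarrow> h \<in> carrier G"
  using submoduleE(1)[OF cartan_subspace] by blast

lemma form_linear_left: "y \<in> carrier G \<Longrightarrow> linear_map G complex_alg (\<lambda>x. form G x y)"
  by (rule linear_mapI) (simp_all add: form_add form_smult)

lemma form_linear_right: "y \<in> carrier G \<Longrightarrow> linear_map G complex_alg (form G y)"
  by (rule linear_map_cong[OF form_linear_left cvec_axioms]) (simp_all add: form_sym)

lemma form_zero_left [simp]: "y \<in> carrier G \<Longrightarrow> form G \<zero> y = 0"
  using linear_map_zero[OF cvec_axioms cvec_complex form_linear_left] by simp

lemma form_zero_right [simp]: "y \<in> carrier G \<Longrightarrow> form G y \<zero> = 0"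
  using linear_map_zero[OF cvec_axioms cvec_complex form_linear_right] by simp

lemma root_space_carrier: "x \<in> root_space G \<alpha> \<Longrightarrow> x \<in> carrier G"
  by (simp add: root_space_def)

lemma root_spaceD: "\<lbrakk>x \<in> root_space G \<alpha>; h \<in> cartan G\<rbrakk> \<Longrightarrow> bracket G h x = form G \<alpha> h \<odot> x"
  by (simp add: root_space_def)

lemma cartan_abelian:
  assumes "h \<in> cartan G" "h' \<in> cartan G" shows "bracket G h h' = \<zero>"
  using root_spaceD[of h' \<zero> h] assms cartan_self_centralizing by (simp add: cartan_carrier)

text \<open>Compare \<open>(h, [h', y]) = \<gamma>(h') (h, y)\<close> with \<open>([h, h'], y) = 0\<close>.\<close>

lemma form_cartan_root_space_aux:
  assumes "h \<in> cartan G" "h' \<in> cartan G" "form G \<gamma> h' \<noteq> 0" "y \<in> root_space G \<gamma>"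
  shows "form G h y = 0"
proof -
  have y: "y \<in> carrier G" using assms(4) by (rule root_space_carrier)
  have "form G \<gamma> h' * form G h y = form G h (bracket G h' y)"
    using assms y linear_map_smult[OF form_linear_right] by (simp add: root_spaceD cartan_carrier)
  also have "\<dots> = form G (bracket G h h') y"
    using assms y by (simp add: form_invariant cartan_carrier)
  also have "\<dots> = 0" using assms y by (simp add: cartan_abelian)
  finally show ?thesis using assms by simp
qed

text \<open>An element of the Cartan subalgebra orthogonal to it is orthogonal to every root
  space: to those on which the Cartan subalgebra acts nontrivially by the previous lemma, and to the remaining ones
  because they consist of elements that centralize the Cartan subalgebra, hence belong to it.\<close>

lemma form_nondegenerate_cartan:
  assumes \<gamma>: "\<gamma> \<in> cartan G" and 0: "\<And>h. h \<in> cartan G \<Longrightarrow> form G \<gamma> h = 0"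
  shows "\<gamma> = \<zero>"
proof (rule form_nondegenerate)
  show \<gamma>c: "\<gamma> \<in> carrier G" using \<gamma> by (rule cartan_carrier)
  fix y assume "y \<in> carrier G"
  then have "y \<in> lspan G (\<Union>\<alpha>\<in>cartan G. root_space G \<alpha>)" by (simp add: cartan_diagonalizable)
  moreover have "(\<Union>\<alpha>\<in>cartan G. root_space G \<alpha>) \<subseteq> carrier G" by (auto simp: root_space_carrier)
  ultimately show "form G \<gamma> y = 0"
  proof (induction rule: lspan_induct)
    case (base y)
    then obtain \<alpha> where \<alpha>: "\<alpha> \<in> cartan G" "y \<in> root_space G \<alpha>" by blast
    show ?case
    proof (cases "\<exists>h'\<in>cartan G. form G \<alpha> h' \<noteq> 0")
      case True
      then show ?thesis using form_cartan_root_space_aux[OF \<gamma>] \<alpha> by blast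
    next
      case False
      then have "y \<in> root_space G \<zero>"
        using \<alpha> by (simp add: root_space_def cartan_carrier)
      then show ?thesis using 0 cartan_self_centralizing by simp
    qed
  qed (use \<gamma>c linear_map_add[OF form_linear_right] linear_map_smult[OF form_linear_right] in
      \<open>auto simp: root_space_carrier\<close>)
qed

lemma form_cartan_root_space:
  assumes "h \<in> cartan G" "\<gamma> \<in> cartan G" "\<gamma> \<noteq> \<zero>" "y \<in> root_space G \<gamma>"
  shows "form G h y = 0"
  using assms form_nondegenerate_cartan form_cartan_root_space_aux by blast

end

context simple_tri_lie begin

lemma cartan_zero: "\<zero> \<in> cartan G"
  by (rule submodule_zero[OF cartan_subspace])

lemma root_space_bracket:
  assumes x: "x \<in> root_space G \<alpha>" and y: "y \<in> root_space G \<beta>"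
    and \<alpha>: "\<alpha> \<in> cartan G" and \<beta>: "\<beta> \<in> cartan G"
  shows "bracket G x y \<in> root_space G (\<alpha> \<oplus> \<beta>)"
  unfolding root_space_def
proof (intro CollectI conjI ballI)
  note c = root_space_carrier[OF x] root_space_carrier[OF y]
  show "bracket G x y \<in> carrier G" by (rule bracket_closed[OF c])
  fix h assume h: "h \<in> cartan G"
  show "bracket G h (bracket G x y) = form G (\<alpha> \<oplus> \<beta>) h \<odot> bracket G x y"
    using c h \<alpha> \<beta> root_spaceD[OF x h] root_spaceD[OF y h]
    by (simp add: bracket_leibniz cartan_carrier bracket_smult_left bracket_smult_right form_add
        smult_add_left bracket_closed)
qed

text \<open>The monoid generated by the simple roots; every weight of \<open>M(\<theta>)\<close> is \<open>\<theta> - \<gamma>\<close> with \<open>\<gamma>\<close> in it.\<close>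

definition nonneg_combs :: "'g set" where
  "nonneg_combs = {(\<Oplus>\<beta>\<in>simple_roots G. of_nat (k \<beta>) \<odot> \<beta>) | k :: 'g \<Rightarrow> nat. True}"

lemma simple_roots_cartan: "simple_roots G \<subseteq> cartan G"
  using base_roots by (auto simp: roots_def)

lemma simple_roots_Pi: "(\<lambda>\<beta>. c \<beta> \<odot> \<beta>) \<in> simple_roots G \<rightarrow> carrier G"
  using simple_roots_cartan by (auto simp: cartan_carrier)

lemma comb_add:
  "(\<Oplus>\<beta>\<in>simple_roots G. c \<beta> \<odot> \<beta>) \<oplus> (\<Oplus>\<beta>\<in>simple_roots G. d \<beta> \<odot> \<beta>) =
    (\<Oplus>\<beta>\<in>simple_roots G. (c \<beta> + d \<beta>) \<odot> \<beta>)"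
proof -
  have "(\<Oplus>\<beta>\<in>simple_roots G. (c \<beta> + d \<beta>) \<odot> \<beta>) = (\<Oplus>\<beta>\<in>simple_roots G. c \<beta> \<odot> \<beta> \<oplus> d \<beta> \<odot> \<beta>)"
    using simple_roots_cartan
    by (intro M.finsum_cong') (auto simp: smult_add_left cartan_carrier subset_iff)
  also have "\<dots> = (\<Oplus>\<beta>\<in>simple_roots G. c \<beta> \<odot> \<beta>) \<oplus> (\<Oplus>\<beta>\<in>simple_roots G. d \<beta> \<odot> \<beta>)"
    by (rule M.finsum_addf[OF simple_roots_Pi simple_roots_Pi])
  finally show ?thesis by simp
qed

lemma comb_zero: "(\<Oplus>\<beta>\<in>simple_roots G. 0 \<odot> \<beta>) = \<zero>"
proof -
  have "(\<Oplus>\<beta>\<in>simple_roots G. 0 \<odot> \<beta>) = (\<Oplus>\<beta>\<in>simple_roots G. \<zero>)"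
    using simple_roots_cartan by (intro M.finsum_cong') (auto simp: cartan_carrier subset_iff)
  then show ?thesis by simp
qed

lemma nonneg_combs_zero: "\<zero> \<in> nonneg_combs"
  unfolding nonneg_combs_def using comb_zero by (intro CollectI exI[of _ "\<lambda>_. 0"]) simp

lemma nonneg_combs_add:
  assumes "\<gamma> \<in> nonneg_combs" "\<delta> \<in> nonneg_combs" shows "\<gamma> \<oplus> \<delta> \<in> nonneg_combs"
proof -
  obtain k l :: "'g \<Rightarrow> nat" where "\<gamma> = (\<Oplus>\<beta>\<in>simple_roots G. of_nat (k \<beta>) \<odot> \<beta>)"
    "\<delta> = (\<Oplus>\<beta>\<in>simple_roots G. of_nat (l \<beta>) \<odot> \<beta>)"
    using assms unfolding nonneg_combs_def by blast
  then have "\<gamma> \<oplus> \<delta> = (\<Oplus>\<beta>\<in>simple_roots G. of_nat (k \<beta> + l \<beta>) \<odot> \<beta>)" by (simp add: comb_add)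
  then show ?thesis unfolding nonneg_combs_def by (intro CollectI exI[of _ "\<lambda>\<beta>. k \<beta> + l \<beta>"]) simp
qed

lemma nonneg_combs_pointed:
  assumes "\<gamma> \<in> nonneg_combs" "\<delta> \<in> nonneg_combs" "\<gamma> \<oplus> \<delta> = \<zero>" shows "\<gamma> = \<zero>"
proof -
  obtain k l :: "'g \<Rightarrow> nat" where kl: "\<gamma> = (\<Oplus>\<beta>\<in>simple_roots G. of_nat (k \<beta>) \<odot> \<beta>)"
    "\<delta> = (\<Oplus>\<beta>\<in>simple_roots G. of_nat (l \<beta>) \<odot> \<beta>)"
    using assms unfolding nonneg_combs_def by blast
  then have 0: "(\<Oplus>\<beta>\<in>simple_roots G. of_nat (k \<beta> + l \<beta>) \<odot> \<beta>) = \<zero>"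
    using assms(3) by (simp add: comb_add)
  have "of_nat (k \<beta> + l \<beta>) = (0::complex)" if "\<beta> \<in> simple_roots G" for \<beta>
    by (rule base_independent[where k = "\<lambda>\<beta>. of_nat (k \<beta> + l \<beta>)", OF 0 that])
  then have "k \<beta> = 0" if "\<beta> \<in> simple_roots G" for \<beta> using that by (metis add_is_0 of_nat_eq_0_iff)
  then have "\<gamma> = (\<Oplus>\<beta>\<in>simple_roots G. 0 \<odot> \<beta>)"
    unfolding kl using simple_roots_cartan by (intro M.finsum_cong') (auto simp: cartan_carrier subset_iff)
  then show ?thesis by (simp add: comb_zero)
qed

lemma pos_rootD:
  assumes "\<alpha> \<in> pos_roots G"
  shows "\<alpha> \<in> cartan G" "\<alpha> \<noteq> \<zero>" "\<alpha> \<in> nonneg_combs" "\<alpha> \<in> carrier G" "\<ominus> \<alpha> \<in> cartan G" "\<ominus> \<alpha> \<noteq> \<zero>"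
proof -
  show 1: "\<alpha> \<in> cartan G" "\<alpha> \<noteq> \<zero>" "\<alpha> \<in> nonneg_combs"
    using assms by (auto simp: pos_roots_def roots_def nonneg_combs_def)
  then show c: "\<alpha> \<in> carrier G" by (simp add: cartan_carrier)
  show "\<ominus> \<alpha> \<in> cartan G" using submoduleE(3)[OF cartan_subspace] 1 by blast
  show "\<ominus> \<alpha> \<noteq> \<zero>" using 1 uminus_eq_zero[OF c] by blast
qed

definition neg_root_vectors :: "'g set" where
  "neg_root_vectors = (\<Union>\<alpha>\<in>pos_roots G. root_space G (\<ominus> \<alpha>))"

lemma neg_root_vectors_carrier: "neg_root_vectors \<subseteq> carrier G"
  by (auto simp: neg_root_vectors_def root_space_carrier)

lemma n_minus_eq: "n_minus G = lspan G neg_root_vectors"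
  by (simp add: n_minus_def neg_root_vectors_def)

lemma n_minus_submodule: "submodule (n_minus G) complex_alg G"
  unfolding n_minus_eq by (rule lspan_submodule[OF neg_root_vectors_carrier])

lemma n_minus_zero: "\<zero> \<in> n_minus G"
  by (rule submodule_zero[OF n_minus_submodule])

lemma n_minus_carrier: "x \<in> n_minus G \<Longrightarrow> x \<in> carrier G"
  using submoduleE(1)[OF n_minus_submodule] by blast

lemma neg_root_vectors_n_minus: "neg_root_vectors \<subseteq> n_minus G"
  unfolding n_minus_eq by (rule lspan_superset)

lemma n_minus_induct [consumes 1, case_names zero add smult base]:
  assumes "x \<in> n_minus G" "P \<zero>"
    and "\<And>x y. \<lbrakk>x \<in> carrier G; y \<in> carrier G; P x; P y\<rbrakk> \<Longrightarrow> P (x \<oplus> y)"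
    and "\<And>c x. \<lbrakk>x \<in> carrier G; P x\<rbrakk> \<Longrightarrow> P (c \<odot> x)"
    and "\<And>x \<alpha>. \<lbrakk>\<alpha> \<in> pos_roots G; x \<in> root_space G (\<ominus> \<alpha>)\<rbrakk> \<Longrightarrow> P x"
  shows "P x"
  using assms(1)[unfolded n_minus_eq] neg_root_vectors_carrier
  by (induction rule: lspan_induct) (use assms(2-) in \<open>auto simp: neg_root_vectors_def\<close>)

lemma form_n_minus:
  assumes h: "h \<in> cartan G" and y: "y \<in> n_minus G" shows "form G h y = 0"
  using y
proof (induction rule: n_minus_induct)
  case (base x \<alpha>)
  then show ?case using form_cartan_root_space[OF h pos_rootD(5,6)] by blast
qed (use h linear_map_add[OF form_linear_right] linear_map_smult[OF form_linear_right] in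
    \<open>auto simp: cartan_carrier\<close>)

text \<open>If the bracket is nonzero, then \<open>-(\<alpha> + \<beta>)\<close> is a root. It is not positive, because the monoid of
  nonnegative combinations contains no two nonzero elements with sum zero; so \<open>\<alpha> + \<beta>\<close> is a positive root.\<close>

lemma neg_root_vectors_bracket:
  assumes x: "x \<in> root_space G (\<ominus> \<alpha>)" "\<alpha> \<in> pos_roots G" and y: "y \<in> root_space G (\<ominus> \<beta>)" "\<beta> \<in> pos_roots G"
  shows "bracket G x y \<in> n_minus G"
proof (cases "bracket G x y = \<zero>")
  case True
  then show ?thesis by (simp add: n_minus_zero)
next
  case False
  note a = pos_rootD[OF x(2)] and b = pos_rootD[OF y(2)]
  let ?\<gamma> = "\<ominus> \<alpha> \<oplus> \<ominus> \<beta>"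
  have br: "bracket G x y \<in> root_space G ?\<gamma>" using root_space_bracket[OF x(1) y(1)] a b by simp
  have eq: "?\<gamma> = \<ominus> (\<alpha> \<oplus> \<beta>)" using a b by (simp add: M.minus_add)
  have ab: "\<alpha> \<oplus> \<beta> \<noteq> \<zero>" using nonneg_combs_pointed[OF a(3) b(3)] a(2) by blast
  have abc: "\<alpha> \<oplus> \<beta> \<in> carrier G" using a b by simp
  have nz: "?\<gamma> \<noteq> \<zero>" unfolding eq using ab uminus_eq_zero[OF abc] by blast
  have "?\<gamma> \<in> roots G"
    using nz br False submoduleE(5)[OF cartan_subspace a(5) b(5)] by (auto simp: roots_def)
  moreover have "?\<gamma> \<notin> pos_roots G"
  proof
    assume "?\<gamma> \<in> pos_roots G"
    then have "\<alpha> \<oplus> \<beta> = \<zero>"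
      using nonneg_combs_pointed[OF nonneg_combs_add[OF a(3) b(3)] pos_rootD(3)] abc eq
      by (metis M.r_neg)
    then show False using ab by blast
  qed
  ultimately have "\<ominus> ?\<gamma> \<in> pos_roots G" using base_generates by blast
  then have p: "\<alpha> \<oplus> \<beta> \<in> pos_roots G" using eq abc by simp
  have "bracket G x y \<in> neg_root_vectors"
    unfolding neg_root_vectors_def using br p eq by auto
  then show ?thesis using neg_root_vectors_n_minus by blast
qed

lemma n_minus_stable:
  assumes "x \<in> carrier G" "\<And>y. y \<in> neg_root_vectors \<Longrightarrow> bracket G x y \<in> n_minus G"
    and y: "y \<in> n_minus G"
  shows "bracket G x y \<in> n_minus G"
proof -
  have "n_minus G \<subseteq> {y \<in> carrier G. bracket G x y \<in> n_minus G}"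
    by (subst n_minus_eq, rule lspan_least[OF linear_map_subspace_vimage[OF cvec_axioms cvec_axioms
            bracket_linear_right[OF assms(1)] n_minus_submodule]])
      (use assms(2) neg_root_vectors_carrier in blast)
  then show ?thesis using y by blast
qed

lemma n_minus_bracket_swap:
  "\<lbrakk>x \<in> carrier G; y \<in> carrier G; bracket G x y \<in> n_minus G\<rbrakk> \<Longrightarrow> bracket G y x \<in> n_minus G"
  using bracket_anti[of y x] submoduleE(3)[OF n_minus_submodule] by simp

lemma n_minus_bracket:
  assumes x: "x \<in> n_minus G" and y: "y \<in> n_minus G" shows "bracket G x y \<in> n_minus G"
proof (rule n_minus_bracket_swap[OF n_minus_carrier[OF y] n_minus_carrier[OF x]])
  have 1: "bracket G u y \<in> n_minus G" if u: "u \<in> neg_root_vectors" for u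
    by (rule n_minus_stable[OF subsetD[OF neg_root_vectors_carrier u] _ y])
      (use u neg_root_vectors_bracket in \<open>auto simp: neg_root_vectors_def\<close>)
  show "bracket G y x \<in> n_minus G"
    by (rule n_minus_stable[OF n_minus_carrier[OF y] _ x])
      (rule n_minus_bracket_swap[OF subsetD[OF neg_root_vectors_carrier] n_minus_carrier[OF y] 1])
qed

lemma cartan_n_minus_bracket:
  assumes h: "h \<in> cartan G" and y: "y \<in> n_minus G"
  shows "bracket G h y \<in> n_minus G" "bracket G y h \<in> n_minus G"
proof -
  have 1: "bracket G h u \<in> n_minus G" if u: "u \<in> neg_root_vectors" for u
  proof -
    have "u \<in> n_minus G" using u neg_root_vectors_n_minus by blast
    then show ?thesis
      using u h submoduleE(4)[OF n_minus_submodule] by (auto simp: neg_root_vectors_def root_spaceD)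
  qed
  show 2: "bracket G h y \<in> n_minus G" by (rule n_minus_stable[OF cartan_carrier[OF h] 1 y])
  show "bracket G y h \<in> n_minus G"
    by (rule n_minus_bracket_swap[OF cartan_carrier[OF h] n_minus_carrier[OF y] 2])
qed

lemma n_plus_carrier: "n_plus G \<subseteq> carrier G"
  unfolding n_plus_def by (rule lspan_subset) (auto simp: root_space_carrier)

lemma cartan_n_minus_n_plus_span:
  "carrier G \<subseteq> lspan G ((cartan G \<union> neg_root_vectors) \<union> n_plus G)"
proof -
  let ?S = "(cartan G \<union> neg_root_vectors) \<union> n_plus G"
  have np: "(\<Union>\<alpha>\<in>pos_roots G. root_space G \<alpha>) \<subseteq> n_plus G"
    unfolding n_plus_def by (rule lspan_superset)
  have S: "?S \<subseteq> carrier G"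
    using neg_root_vectors_carrier n_plus_carrier cartan_carrier by blast
  have "root_space G \<alpha> \<subseteq> lspan G ?S" if "\<alpha> \<in> cartan G" for \<alpha>
  proof -
    have "root_space G \<alpha> \<subseteq> ?S"
    proof (cases "\<alpha> = \<zero> \<or> root_space G \<alpha> = {\<zero>}")
      case True
      then have "root_space G \<alpha> \<subseteq> cartan G"
        using cartan_self_centralizing cartan_zero by (elim disjE) simp_all
      then show ?thesis by blast
    next
      case False
      then have "\<alpha> \<in> roots G" using that by (simp add: roots_def)
      then consider "\<alpha> \<in> pos_roots G" | "\<ominus> \<alpha> \<in> pos_roots G" using base_generates by blast
      then show ?thesis
      proof cases
        case 1
        then show ?thesis using np by blast
      next
        case 2
        then have "root_space G (\<ominus> (\<ominus> \<alpha>)) \<subseteq> neg_root_vectors" unfolding neg_root_vectors_def by blast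
        then have "root_space G \<alpha> \<subseteq> neg_root_vectors"
          using M.minus_minus[OF cartan_carrier[OF that]] by simp
        then show ?thesis by blast
      qed
    qed
    then show ?thesis using lspan_superset[of ?S] by (rule order_trans)
  qed
  then have "lspan G (\<Union>\<alpha>\<in>cartan G. root_space G \<alpha>) \<subseteq> lspan G ?S"
    by (intro lspan_least[OF lspan_submodule[OF S]]) blast
  then show ?thesis by (simp add: cartan_diagonalizable)
qed

lemma b_minus_simps [simp]:
  "add (b_minus G) = add G" "smult (b_minus G) = smult G" "bracket (b_minus G) = bracket G"
  by (simp_all add: b_minus_def)

lemma b_minus_carrier: "x \<in> carrier (b_minus G) \<longleftrightarrow> (\<exists>h\<in>cartan G. \<exists>y\<in>n_minus G. x = h \<oplus> y)"
  by (auto simp: b_minus_def set_add_def')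

lemma b_minus_sub: "x \<in> carrier (b_minus G) \<Longrightarrow> x \<in> carrier G"
  by (auto simp: b_minus_carrier cartan_carrier n_minus_carrier)

lemma b_minus_bracket:
  assumes "x \<in> carrier (b_minus G)" "y \<in> carrier (b_minus G)"
  shows "bracket G x y \<in> n_minus G"
proof -
  obtain h e where x: "h \<in> cartan G" "e \<in> n_minus G" "x = h \<oplus> e" using assms by (auto simp: b_minus_carrier)
  obtain h' e' where y: "h' \<in> cartan G" "e' \<in> n_minus G" "y = h' \<oplus> e'" using assms by (auto simp: b_minus_carrier)
  note c = cartan_carrier[OF x(1)] cartan_carrier[OF y(1)] n_minus_carrier[OF x(2)] n_minus_carrier[OF y(2)]
  have "bracket G x y = (bracket G h h' \<oplus> bracket G e h') \<oplus> (bracket G h e' \<oplus> bracket G e e')"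
    unfolding x(3) y(3) using c by (simp add: bracket_add_left bracket_add_right bracket_closed)
  also have "\<dots> \<in> n_minus G"
    using cartan_n_minus_bracket(2)[OF y(1) x(2)] cartan_n_minus_bracket(1)[OF x(1) y(2)]
      n_minus_bracket[OF x(2) y(2)] n_minus_zero
    by (simp add: cartan_abelian x(1) y(1) submoduleE(5)[OF n_minus_submodule] n_minus_carrier)
  finally show ?thesis .
qed

sublocale b: lie_ops "b_minus G"
proof
  fix x y assume xy: "x \<in> carrier (b_minus G)" "y \<in> carrier (b_minus G)"
  obtain h e where x: "h \<in> cartan G" "e \<in> n_minus G" "x = h \<oplus> e" using xy by (auto simp: b_minus_carrier)
  obtain h' e' where y: "h' \<in> cartan G" "e' \<in> n_minus G" "y = h' \<oplus> e'" using xy by (auto simp: b_minus_carrier)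
  note c = cartan_carrier[OF x(1)] cartan_carrier[OF y(1)] n_minus_carrier[OF x(2)] n_minus_carrier[OF y(2)]
  have "x \<oplus> y = (h \<oplus> h') \<oplus> (e \<oplus> e')" using c x y by (simp add: M.a_ac)
  moreover have "h \<oplus> h' \<in> cartan G" "e \<oplus> e' \<in> n_minus G"
    using x y submoduleE(5)[OF cartan_subspace] submoduleE(5)[OF n_minus_submodule] by auto
  ultimately show "x \<oplus>\<^bsub>b_minus G\<^esub> y \<in> carrier (b_minus G)" unfolding b_minus_carrier b_minus_simps by blast
  have "bracket G x y = \<zero> \<oplus> bracket G x y" using xy by (simp add: b_minus_sub bracket_closed)
  moreover note cartan_zero
  ultimately show "bracket (b_minus G) x y \<in> carrier (b_minus G)"
    unfolding b_minus_carrier b_minus_simps using b_minus_bracket[OF xy] by blast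
next
  fix x c assume x: "x \<in> carrier (b_minus G)"
  obtain h e where x: "h \<in> cartan G" "e \<in> n_minus G" "x = h \<oplus> e" using x by (auto simp: b_minus_carrier)
  have "c \<odot> x = c \<odot> h \<oplus> c \<odot> e" using x by (simp add: smult_add_right cartan_carrier n_minus_carrier)
  moreover have "c \<odot> h \<in> cartan G" "c \<odot> e \<in> n_minus G"
    using x submoduleE(4)[OF cartan_subspace] submoduleE(4)[OF n_minus_submodule] by auto
  ultimately show "c \<odot>\<^bsub>b_minus G\<^esub> x \<in> carrier (b_minus G)" unfolding b_minus_carrier b_minus_simps by blast
qed

end

section \<open>Verma modules\<close>

context simple_tri_lie begin

lemma cartan_neg_carrier: "cartan G \<union> neg_root_vectors \<subseteq> carrier G"
  using cartan_carrier neg_root_vectors_carrier by blast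

lemma verma_generators_carrier:
  "env_inc G ` n_plus G \<union> {env_inc G h \<ominus>\<^bsub>env G\<^esub> (form G \<tau> h \<odot>\<^bsub>env G\<^esub> \<one>\<^bsub>env G\<^esub>) | h. h \<in> cartan G}
    \<subseteq> carrier (env G)"
proof (rule Un_least)
  show "env_inc G ` n_plus G \<subseteq> carrier (env G)"
    using n_plus_carrier U.env_inc_closed by blast
qed (auto simp: U.env_inc_closed cartan_carrier)

lemma verma_left_ideal: "left_ideal (verma_ideal G \<tau>) (env G)"
  unfolding verma_ideal_def by (rule U.env.gen_left_ideal_left_ideal[OF verma_generators_carrier])

lemma verma_ideal_n_plus: "x \<in> n_plus G \<Longrightarrow> env_inc G x \<in> verma_ideal G \<tau>"
  unfolding verma_ideal_def by (rule subsetD[OF U.env.gen_left_ideal_superset]) blast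

lemma verma_ideal_cartan:
  "h \<in> cartan G \<Longrightarrow> env_inc G h \<ominus>\<^bsub>env G\<^esub> (form G \<tau> h \<odot>\<^bsub>env G\<^esub> \<one>\<^bsub>env G\<^esub>) \<in> verma_ideal G \<tau>"
  unfolding verma_ideal_def by (rule subsetD[OF U.env.gen_left_ideal_superset]) blast

lemma irrep_left_ideal:
  "left_ideal (gen_left_ideal (env G)
     (\<Union>{J. left_ideal J (env G) \<and> verma_ideal G \<nu> \<subseteq> J \<and> J \<noteq> carrier (env G)})) (env G)"
proof (rule U.env.gen_left_ideal_left_ideal)
  have "J \<subseteq> carrier (env G)" if "left_ideal J (env G)" for J
    using that by (auto simp: left_ideal_def dest: additive_subgroup.a_subset)
  then show "\<Union>{J. left_ideal J (env G) \<and> verma_ideal G \<nu> \<subseteq> J \<and> J \<noteq> carrier (env G)} \<subseteq> carrier (env G)"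
    by blast
qed

lemma verma_cvec: "cvec (verma G \<tau>)"
  unfolding verma_def by (rule U.env.cyclic_cvec[OF verma_left_ideal])

lemma irrep_cvec: "cvec (irrep G \<nu>)"
  unfolding irrep_def by (rule U.env.cyclic_cvec[OF irrep_left_ideal])

lemma verma_act_linear_left:
  "m \<in> carrier (verma G \<tau>) \<Longrightarrow> linear_map (env G) (verma G \<tau>) (\<lambda>u. act (verma G \<tau>) u m)"
  unfolding verma_def by (rule U.env.cyclic_act_linear_left[OF verma_left_ideal])

lemma verma_act_linear_right:
  "u \<in> carrier (env G) \<Longrightarrow> linear_map (verma G \<tau>) (verma G \<tau>) (act (verma G \<tau>) u)"
  unfolding verma_def by (rule U.env.cyclic_act_linear_right[OF verma_left_ideal])

lemma verma_act_mult:
  "\<lbrakk>u \<in> carrier (env G); v \<in> carrier (env G); m \<in> carrier (verma G \<tau>)\<rbrakk> \<Longrightarrow>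
    act (verma G \<tau>) (u \<otimes>\<^bsub>env G\<^esub> v) m = act (verma G \<tau>) u (act (verma G \<tau>) v m)"
  unfolding verma_def by (rule U.env.cyclic_act_mult[OF verma_left_ideal])

lemma verma_csubspace: "csubspace (env G) (verma_ideal G \<tau>)"
  by (rule U.env.left_ideal_csubspace[OF verma_left_ideal])

lemma verma_vec_closed: "verma_vec G \<tau> \<in> carrier (verma G \<tau>)"
  unfolding verma_vec_def verma_def cyclic_module_simps
  by (rule csubspace.coset_closed[OF verma_csubspace]) simp

lemma verma_act_vec:
  "u \<in> carrier (env G) \<Longrightarrow> act (verma G \<tau>) u (verma_vec G \<tau>) = verma_ideal G \<tau> +>\<^bsub>env G\<^esub> u"
  unfolding verma_vec_def verma_def
  by (subst U.env.cyclic_act[OF verma_left_ideal]) simp_all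

lemma verma_act_ideal:
  assumes "u \<in> verma_ideal G \<tau>" shows "act (verma G \<tau>) u (verma_vec G \<tau>) = \<zero>\<^bsub>verma G \<tau>\<^esub>"
proof -
  interpret S: csubspace "env G" "verma_ideal G \<tau>" by (rule verma_csubspace)
  show ?thesis
    unfolding verma_act_vec[OF S.sub_carrier[OF assms]] S.coset_eq_zero[OF assms] by (simp add: verma_def)
qed

lemma verma_act_one:
  assumes "m \<in> carrier (verma G \<tau>)" shows "act (verma G \<tau>) \<one>\<^bsub>env G\<^esub> m = m"
proof -
  interpret S: csubspace "env G" "verma_ideal G \<tau>" by (rule verma_csubspace)
  obtain u where u: "u \<in> carrier (env G)" "m = verma_ideal G \<tau> +>\<^bsub>env G\<^esub> u"
    using assms by (auto simp: verma_def elim: S.quot_carrierE)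
  show ?thesis
    unfolding verma_def u(2) using u(1) by (subst U.env.cyclic_act[OF verma_left_ideal]) simp_all
qed

lemma verma_vec_n_plus: "x \<in> n_plus G \<Longrightarrow> act (verma G \<tau>) (env_inc G x) (verma_vec G \<tau>) = \<zero>\<^bsub>verma G \<tau>\<^esub>"
  by (rule verma_act_ideal[OF verma_ideal_n_plus])

lemma verma_vec_cartan:
  assumes "h \<in> cartan G"
  shows "act (verma G \<tau>) (env_inc G h) (verma_vec G \<tau>) = form G \<tau> h \<odot>\<^bsub>verma G \<tau>\<^esub> verma_vec G \<tau>"
proof -
  interpret M: cvec "verma G \<tau>" by (rule verma_cvec)
  note lin = verma_act_linear_left[OF verma_vec_closed[of \<tau>]]
  have c: "env_inc G h \<in> carrier (env G)" by (simp add: U.env_inc_closed cartan_carrier assms)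
  have "act (verma G \<tau>) (env_inc G h \<ominus>\<^bsub>env G\<^esub> (form G \<tau> h \<odot>\<^bsub>env G\<^esub> \<one>\<^bsub>env G\<^esub>)) (verma_vec G \<tau>) = \<zero>\<^bsub>verma G \<tau>\<^esub>"
    by (rule verma_act_ideal[OF verma_ideal_cartan[OF assms]])
  then have "act (verma G \<tau>) (env_inc G h) (verma_vec G \<tau>)
      \<ominus>\<^bsub>verma G \<tau>\<^esub> form G \<tau> h \<odot>\<^bsub>verma G \<tau>\<^esub> verma_vec G \<tau> = \<zero>\<^bsub>verma G \<tau>\<^esub>"
    using c by (simp add: linear_map_diff[OF U.env.cvec_axioms verma_cvec lin] linear_map_smult[OF lin]
        verma_act_one verma_vec_closed)
  then show ?thesis
    using M.diff_zero_imp_eq linear_map_closed[OF lin c] M.smult_carrier[OF verma_vec_closed] by blast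
qed

text \<open>Applied to words in letters from the Cartan subalgebra and from the negative root spaces.
  Cartan letters may stay where they are: every suffix of the word gives a weight vector, on which they
  act by scalars.\<close>

definition word_vec :: "'g \<Rightarrow> 'g list \<Rightarrow> 'g env set" where
  "word_vec \<tau> hs = act (verma G \<tau>) (U.word hs) (verma_vec G \<tau>)"

lemma word_vec_Nil: "word_vec \<tau> [] = verma_vec G \<tau>"
  unfolding word_vec_def U.word_Nil by (rule verma_act_one[OF verma_vec_closed])

lemma word_vec_Cons:
  "\<lbrakk>x \<in> carrier G; hs \<in> lists (carrier G)\<rbrakk> \<Longrightarrow>
    word_vec \<tau> (x # hs) = act (verma G \<tau>) (env_inc G x) (word_vec \<tau> hs)"
  unfolding word_vec_def
  by (simp add: U.word_Cons verma_act_mult U.env_inc_closed U.word_closed verma_vec_closed)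

lemma env_triangular_induct [consumes 1, case_names zero add smult word]:
  assumes "u \<in> carrier (env G)" and "P \<zero>\<^bsub>env G\<^esub>"
    and "\<And>u v. \<lbrakk>u \<in> carrier (env G); v \<in> carrier (env G); P u; P v\<rbrakk> \<Longrightarrow> P (u \<oplus>\<^bsub>env G\<^esub> v)"
    and "\<And>c u. \<lbrakk>u \<in> carrier (env G); P u\<rbrakk> \<Longrightarrow> P (c \<odot>\<^bsub>env G\<^esub> u)"
    and "\<And>hs cs. \<lbrakk>hs \<in> lists (cartan G \<union> neg_root_vectors); cs \<in> lists (n_plus G)\<rbrakk> \<Longrightarrow> P (U.word (hs @ cs))"
  shows "P u"
proof -
  let ?S = "{U.word (hs @ cs) | hs cs. hs \<in> lists (cartan G \<union> neg_root_vectors) \<and> cs \<in> lists (n_plus G)}"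
  have "u \<in> lspan (env G) ?S"
    using U.env_ordered_span[OF cvec_axioms cartan_neg_carrier n_plus_carrier cartan_n_minus_n_plus_span] assms(1)
    by blast
  moreover have "?S \<subseteq> carrier (env G)"
  proof
    fix u assume "u \<in> ?S"
    then obtain hs cs where u: "u = U.word (hs @ cs)"
      "hs \<in> lists (cartan G \<union> neg_root_vectors)" "cs \<in> lists (n_plus G)" by blast
    then have "hs @ cs \<in> lists (carrier G)"
      using subsetD[OF lists_mono[OF cartan_neg_carrier], of hs] subsetD[OF lists_mono[OF n_plus_carrier], of cs] by simp
    then show "u \<in> carrier (env G)" using U.word_closed u(1) by simp
  qed
  ultimately show ?thesis
  proof (induction rule: U.env.lspan_induct)
    case (base u)
    then obtain hs cs where "u = U.word (hs @ cs)"
      "hs \<in> lists (cartan G \<union> neg_root_vectors)" "cs \<in> lists (n_plus G)" by blast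
    then show ?case using assms(5) by simp
  qed (rule assms(2-4); assumption)+
qed

text \<open>A letter from \<open>\<nn>\<^sub>+\<close> at the right end of an ordered word kills the highest weight vector, so only words
  without such letters survive.\<close>

lemma verma_induct [consumes 1, case_names zero add smult word]:
  assumes "m \<in> carrier (verma G \<tau>)" and "P \<zero>\<^bsub>verma G \<tau>\<^esub>"
    and "\<And>u v. \<lbrakk>u \<in> carrier (verma G \<tau>); v \<in> carrier (verma G \<tau>); P u; P v\<rbrakk> \<Longrightarrow> P (u \<oplus>\<^bsub>verma G \<tau>\<^esub> v)"
    and "\<And>c u. \<lbrakk>u \<in> carrier (verma G \<tau>); P u\<rbrakk> \<Longrightarrow> P (c \<odot>\<^bsub>verma G \<tau>\<^esub> u)"
    and "\<And>hs. hs \<in> lists (cartan G \<union> neg_root_vectors) \<Longrightarrow> P (word_vec \<tau> hs)"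
  shows "P m"
proof -
  interpret S: csubspace "env G" "verma_ideal G \<tau>" by (rule verma_csubspace)
  note lin = verma_act_linear_left[OF verma_vec_closed[of \<tau>]]
  obtain u where u: "u \<in> carrier (env G)" "m = verma_ideal G \<tau> +>\<^bsub>env G\<^esub> u"
    using assms(1) by (auto simp: verma_def elim: S.quot_carrierE)
  have "P (act (verma G \<tau>) u (verma_vec G \<tau>))" using u(1)
  proof (induction rule: env_triangular_induct)
    case zero
    then show ?case using assms(2) linear_map_zero[OF U.env.cvec_axioms verma_cvec lin] by simp
  next
    case (add u v)
    then show ?case using assms(3) by (simp add: linear_map_add[OF lin] linear_map_closed[OF lin])
  next
    case (smult c u)
    then show ?case using assms(4) by (simp add: linear_map_smult[OF lin] linear_map_closed[OF lin])
  next
    case (word hs cs)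
    have hs: "hs \<in> lists (carrier G)" using word(1) lists_mono[OF cartan_neg_carrier] by blast
    show ?case
    proof (cases cs rule: rev_cases)
      case Nil
      then show ?thesis using assms(5)[OF word(1)] by (simp add: word_vec_def)
    next
      case (snoc cs' x)
      have x: "x \<in> n_plus G" "x \<in> carrier G" and cs': "cs' \<in> lists (carrier G)"
        using word(2) n_plus_carrier unfolding snoc by auto
      have w: "U.word (hs @ cs') \<in> carrier (env G)" using hs cs' by (intro U.word_closed) simp
      have "U.word (hs @ cs) = U.word (hs @ cs') \<otimes>\<^bsub>env G\<^esub> env_inc G x"
        using U.word_append[of "hs @ cs'" "[x]"] hs cs' x by (simp add: snoc U.env_inc_eq)
      then have "act (verma G \<tau>) (U.word (hs @ cs)) (verma_vec G \<tau>) = \<zero>\<^bsub>verma G \<tau>\<^esub>"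
        using w x linear_map_zero[OF verma_cvec verma_cvec verma_act_linear_right[OF w]]
        by (simp add: verma_act_mult U.env_inc_closed verma_vec_closed verma_vec_n_plus)
      then show ?thesis using assms(2) by simp
    qed
  qed
  then show ?thesis using u by (simp add: verma_act_vec)
qed

abbreviation verma_weight_space :: "'g \<Rightarrow> 'g \<Rightarrow> 'g env set set" where
  "verma_weight_space \<tau> \<nu> \<equiv> weight_space G (verma G \<tau>) (\<lambda>x. act (verma G \<tau>) (env_inc G x)) \<nu>"

lemma weight_vector_smult:
  assumes "m \<in> verma_weight_space \<tau> \<nu>" shows "c \<odot>\<^bsub>verma G \<tau>\<^esub> m \<in> verma_weight_space \<tau> \<nu>"
proof -
  interpret M: cvec "verma G \<tau>" by (rule verma_cvec)
  show ?thesis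
    using assms unfolding weight_space_def
    by (auto simp: linear_map_smult[OF verma_act_linear_right] U.env_inc_closed cartan_carrier M.smult_smult mult.commute)
qed

lemma weight_vector_root:
  assumes m: "m \<in> verma_weight_space \<tau> \<nu>" and y: "y \<in> root_space G \<beta>" and \<nu>: "\<nu> \<in> cartan G" and \<beta>: "\<beta> \<in> cartan G"
  shows "act (verma G \<tau>) (env_inc G y) m \<in> verma_weight_space \<tau> (\<nu> \<oplus> \<beta>)"
  unfolding weight_space_def
proof (intro CollectI conjI ballI)
  interpret M: cvec "verma G \<tau>" by (rule verma_cvec)
  have mc: "m \<in> carrier (verma G \<tau>)" using m by (simp add: weight_space_def)
  have yc: "env_inc G y \<in> carrier (env G)" by (rule U.env_inc_closed[OF root_space_carrier[OF y]])
  note lin = verma_act_linear_left[OF mc]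
  show closed: "act (verma G \<tau>) (env_inc G y) m \<in> carrier (verma G \<tau>)"
    by (rule linear_map_closed[OF lin yc])
  fix h assume h: "h \<in> cartan G"
  have hc: "env_inc G h \<in> carrier (env G)" by (simp add: U.env_inc_closed cartan_carrier h)
  have hm: "act (verma G \<tau>) (env_inc G h) m = form G \<nu> h \<odot>\<^bsub>verma G \<tau>\<^esub> m"
    using m h by (simp add: weight_space_def)
  have "env_inc G h \<otimes>\<^bsub>env G\<^esub> env_inc G y =
      env_inc G (bracket G h y) \<oplus>\<^bsub>env G\<^esub> env_inc G y \<otimes>\<^bsub>env G\<^esub> env_inc G h"
    using hc yc h y
    by (simp add: U.env_inc_bracket cartan_carrier root_space_carrier a_minus_def U.env.a_assoc U.env.l_neg)
  also have "env_inc G (bracket G h y) = form G \<beta> h \<odot>\<^bsub>env G\<^esub> env_inc G y"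
    using y h by (simp add: root_spaceD U.env_inc_smult root_space_carrier)
  finally have "act (verma G \<tau>) (env_inc G h \<otimes>\<^bsub>env G\<^esub> env_inc G y) m =
      form G \<beta> h \<odot>\<^bsub>verma G \<tau>\<^esub> act (verma G \<tau>) (env_inc G y) m \<oplus>\<^bsub>verma G \<tau>\<^esub>
      act (verma G \<tau>) (env_inc G y) (form G \<nu> h \<odot>\<^bsub>verma G \<tau>\<^esub> m)"
    using hc yc mc by (simp add: linear_map_add[OF lin] linear_map_smult[OF lin] verma_act_mult hm)
  also have "\<dots> = form G (\<nu> \<oplus> \<beta>) h \<odot>\<^bsub>verma G \<tau>\<^esub> act (verma G \<tau>) (env_inc G y) m"
    using hc yc mc closed h \<nu> \<beta>
    by (simp add: linear_map_smult[OF verma_act_linear_right] form_add cartan_carrier M.smult_add_left M.M.a_comm)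
  finally show "act (verma G \<tau>) (env_inc G h) (act (verma G \<tau>) (env_inc G y) m) =
      form G (\<nu> \<oplus> \<beta>) h \<odot>\<^bsub>verma G \<tau>\<^esub> act (verma G \<tau>) (env_inc G y) m"
    using hc yc mc by (simp add: verma_act_mult)
qed

lemma nonneg_combs_cartan: "\<gamma> \<in> nonneg_combs \<Longrightarrow> \<gamma> \<in> cartan G"
proof -
  have fs: "finite S \<Longrightarrow> f \<in> S \<rightarrow> cartan G \<Longrightarrow> (\<Oplus>\<beta>\<in>S. f \<beta>) \<in> cartan G" for f and S :: "'g set"
  proof (induction S rule: finite_induct)
    case empty
    then show ?case by (simp add: cartan_zero)
  next
    case (insert x S)
    then have "f \<in> S \<rightarrow> carrier G" "f x \<in> carrier G" using cartan_carrier by blast+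
    then show ?case using insert submoduleE(5)[OF cartan_subspace] by simp
  qed
  have "(\<lambda>\<beta>. c \<beta> \<odot> \<beta>) \<in> simple_roots G \<rightarrow> cartan G" for c
    using simple_roots_cartan submoduleE(4)[OF cartan_subspace] by auto
  then have "(\<Oplus>\<beta>\<in>simple_roots G. c \<beta> \<odot> \<beta>) \<in> cartan G" for c
    by (intro fs base_finite)
  then show "\<gamma> \<in> nonneg_combs \<Longrightarrow> \<gamma> \<in> cartan G"
    unfolding nonneg_combs_def by auto
qed

lemma word_vec_weight:
  assumes \<tau>: "\<tau> \<in> cartan G" and "hs \<in> lists (cartan G \<union> neg_root_vectors)"
  shows "\<exists>\<gamma>\<in>nonneg_combs. word_vec \<tau> hs \<in> verma_weight_space \<tau> (\<tau> \<ominus> \<gamma>)"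
  using assms(2)
proof (induction hs)
  case Nil
  have "word_vec \<tau> [] \<in> verma_weight_space \<tau> (\<tau> \<ominus> \<zero>)"
    using \<tau> by (simp add: weight_space_def word_vec_Nil verma_vec_closed verma_vec_cartan a_minus_def cartan_carrier)
  then show ?case using nonneg_combs_zero by blast
next
  case (Cons x hs)
  obtain \<gamma> where \<gamma>: "\<gamma> \<in> nonneg_combs" "word_vec \<tau> hs \<in> verma_weight_space \<tau> (\<tau> \<ominus> \<gamma>)"
    using Cons.IH by blast
  have hs: "hs \<in> lists (carrier G)" using Cons.hyps lists_mono[OF cartan_neg_carrier] by blast
  have x: "x \<in> carrier G" using Cons.hyps cartan_neg_carrier by blast
  note vec = word_vec_Cons[OF x hs]
  show ?case
  proof (cases "x \<in> cartan G")
    case True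
    then have "word_vec \<tau> (x # hs) \<in> verma_weight_space \<tau> (\<tau> \<ominus> \<gamma>)"
      using weight_vector_smult[OF \<gamma>(2), of "form G (\<tau> \<ominus> \<gamma>) x"] \<gamma>(2) by (simp add: vec weight_space_def)
    then show ?thesis using \<gamma>(1) by blast
  next
    case False
    then obtain \<beta> where \<beta>: "\<beta> \<in> pos_roots G" "x \<in> root_space G (\<ominus> \<beta>)"
      using Cons.hyps by (auto simp: neg_root_vectors_def)
    note b = pos_rootD[OF \<beta>(1)] and g = nonneg_combs_cartan[OF \<gamma>(1)]
    have tg: "\<tau> \<ominus> \<gamma> \<in> cartan G"
      unfolding a_minus_def using \<tau> g submoduleE(3,5)[OF cartan_subspace] by blast
    have "word_vec \<tau> (x # hs) \<in> verma_weight_space \<tau> (\<tau> \<ominus> \<gamma> \<oplus> \<ominus> \<beta>)"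
      unfolding vec by (rule weight_vector_root[OF \<gamma>(2) \<beta>(2) tg b(5)])
    also have "\<tau> \<ominus> \<gamma> \<oplus> \<ominus> \<beta> = \<tau> \<ominus> (\<gamma> \<oplus> \<beta>)"
      using \<tau> g b by (simp add: a_minus_def cartan_carrier M.minus_add M.a_assoc)
    finally show ?thesis using nonneg_combs_add[OF \<gamma>(1) b(3)] by blast
  qed
qed

lemma minus_nonneg_ne:
  assumes "\<tau> \<in> cartan G" "\<gamma> \<in> nonneg_combs" "\<tau> \<ominus> \<gamma> = \<tau>" shows "\<gamma> = \<zero>"
proof -
  have c: "\<tau> \<in> carrier G" "\<gamma> \<in> carrier G" using assms nonneg_combs_cartan cartan_carrier by auto
  have "\<gamma> = (\<tau> \<ominus> (\<tau> \<ominus> \<gamma>))"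
    using c by (simp add: a_minus_def M.minus_add M.r_neg2)
  also have "\<dots> = \<tau> \<ominus> \<tau>" using assms(3) by simp
  also have "\<dots> = \<zero>" using c by (simp add: a_minus_def M.r_neg)
  finally show ?thesis .
qed

context
  fixes \<theta> and \<alpha>
  assumes \<theta>: "\<theta> \<in> cartan G" and \<alpha>: "verma_functional G \<theta> \<alpha>"
begin

lemma functional_linear: "linear_map (verma G \<theta>) complex_alg \<alpha>"
  using \<alpha> by (simp add: verma_functional_def)

lemma functional_weight: "\<lbrakk>\<nu> \<in> cartan G; \<nu> \<noteq> \<theta>; m \<in> verma_weight_space \<theta> \<nu>\<rbrakk> \<Longrightarrow> \<alpha> m = 0"
  using \<alpha> by (simp add: verma_functional_def)

text \<open>Here \<open>\<alpha>\<close> meets a single weight vector, of weight \<open>\<theta> - \<gamma>\<close>. A Cartan letter acts by the scalar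
  \<open>(\<theta> - \<gamma>)(x)\<close>, and either \<open>\<gamma> = 0\<close> or both sides vanish. A letter of weight \<open>-\<beta>\<close> leads to the weight
  \<open>\<theta> - (\<gamma> + \<beta>) \<noteq> \<theta>\<close>, where \<open>\<alpha>\<close> vanishes, and \<open>(\<theta>, x) = 0\<close>.\<close>

lemma functional_word_vec:
  assumes x: "x \<in> cartan G \<union> neg_root_vectors" and hs: "hs \<in> lists (cartan G \<union> neg_root_vectors)"
  shows "\<alpha> (act (verma G \<theta>) (env_inc G x) (word_vec \<theta> hs)) = form G \<theta> x * \<alpha> (word_vec \<theta> hs)"
proof -
  obtain \<gamma> where \<gamma>: "\<gamma> \<in> nonneg_combs" "word_vec \<theta> hs \<in> verma_weight_space \<theta> (\<theta> \<ominus> \<gamma>)"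
    using word_vec_weight[OF \<theta> hs] by blast
  note g = nonneg_combs_cartan[OF \<gamma>(1)]
  have tg: "\<theta> \<ominus> \<gamma> \<in> cartan G"
    unfolding a_minus_def using \<theta> g submoduleE(3,5)[OF cartan_subspace] by blast
  have mc: "word_vec \<theta> hs \<in> carrier (verma G \<theta>)" using \<gamma>(2) by (simp add: weight_space_def)
  show ?thesis
  proof (cases "x \<in> cartan G")
    case True
    then have "\<alpha> (act (verma G \<theta>) (env_inc G x) (word_vec \<theta> hs)) = form G (\<theta> \<ominus> \<gamma>) x * \<alpha> (word_vec \<theta> hs)"
      using \<gamma>(2) mc linear_map_smult[OF functional_linear] by (simp add: weight_space_def)
    also have "\<dots> = form G \<theta> x * \<alpha> (word_vec \<theta> hs)"
      using functional_weight[OF tg _ \<gamma>(2)] by (cases "\<theta> \<ominus> \<gamma> = \<theta>") auto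
    finally show ?thesis .
  next
    case False
    then obtain \<beta> where \<beta>: "\<beta> \<in> pos_roots G" "x \<in> root_space G (\<ominus> \<beta>)"
      using x by (auto simp: neg_root_vectors_def)
    note b = pos_rootD[OF \<beta>(1)]
    have eq: "\<theta> \<ominus> \<gamma> \<oplus> \<ominus> \<beta> = \<theta> \<ominus> (\<gamma> \<oplus> \<beta>)"
      using \<theta> g b by (simp add: a_minus_def cartan_carrier M.minus_add M.a_assoc)
    have w: "act (verma G \<theta>) (env_inc G x) (word_vec \<theta> hs) \<in> verma_weight_space \<theta> (\<theta> \<ominus> \<gamma> \<oplus> \<ominus> \<beta>)"
      by (rule weight_vector_root[OF \<gamma>(2) \<beta>(2) tg b(5)])
    have "\<gamma> \<oplus> \<beta> \<noteq> \<zero>"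
      using nonneg_combs_pointed[OF b(3) \<gamma>(1)] b g by (auto simp: M.a_comm cartan_carrier)
    then have "\<theta> \<ominus> \<gamma> \<oplus> \<ominus> \<beta> \<noteq> \<theta>"
      using minus_nonneg_ne[OF \<theta> nonneg_combs_add[OF \<gamma>(1) b(3)]] unfolding eq by blast
    then have "\<alpha> (act (verma G \<theta>) (env_inc G x) (word_vec \<theta> hs)) = 0"
      using functional_weight[OF submoduleE(5)[OF cartan_subspace tg b(5)] _ w] by blast
    moreover have "form G \<theta> x = 0" by (rule form_cartan_root_space[OF \<theta> b(5,6) \<beta>(2)])
    ultimately show ?thesis by simp
  qed
qed

lemma functional_b_minus:
  assumes x: "x \<in> carrier (b_minus G)" and m: "m \<in> carrier (verma G \<theta>)"
  shows "\<alpha> (act (verma G \<theta>) (env_inc G x) m) = form G \<theta> x * \<alpha> m"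
proof -
  have 1: "\<alpha> (act (verma G \<theta>) (env_inc G x) m) = form G \<theta> x * \<alpha> m"
    if x: "x \<in> cartan G \<union> neg_root_vectors" for x
  proof -
    have "x \<in> carrier G" using x cartan_neg_carrier by blast
    then have xc: "env_inc G x \<in> carrier (env G)" by (rule U.env_inc_closed)
    note lin = verma_act_linear_right[OF xc, of \<theta>]
    show ?thesis using m
    proof (induction rule: verma_induct)
      case zero
      then show ?case
        using linear_map_zero[OF verma_cvec verma_cvec lin] linear_map_zero[OF verma_cvec cvec_complex functional_linear]
        by simp
    next
      case (add u v)
      then show ?case
        by (simp add: linear_map_add[OF lin] linear_map_add[OF functional_linear] linear_map_closed[OF lin] algebra_simps)
    next
      case (smult c u)
      then show ?case
        by (simp add: linear_map_smult[OF lin] linear_map_smult[OF functional_linear] linear_map_closed[OF lin])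
    qed (rule functional_word_vec[OF x])
  qed
  have "lspan G (cartan G \<union> neg_root_vectors) \<subseteq> {x \<in> carrier G. \<alpha> (act (verma G \<theta>) (env_inc G x) m) = form G \<theta> x * \<alpha> m}"
  proof
    fix x assume "x \<in> lspan G (cartan G \<union> neg_root_vectors)"
    then have "x \<in> carrier G \<and> \<alpha> (act (verma G \<theta>) (env_inc G x) m) = form G \<theta> x * \<alpha> m"
      using cartan_neg_carrier
    proof (induction rule: lspan_induct)
      case zero
      have "env_inc G \<zero> = \<zero>\<^bsub>env G\<^esub>" by (rule linear_map_zero[OF cvec_axioms U.env.cvec_axioms U.env_inc_linear])
      then show ?case
        using \<theta> linear_map_zero[OF U.env.cvec_axioms verma_cvec verma_act_linear_left[OF m]]
          linear_map_zero[OF verma_cvec cvec_complex functional_linear]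
        by (simp add: cartan_carrier)
    next
      case (add x y)
      then show ?case
        using \<theta> by (simp add: U.env_inc_add U.env_inc_closed linear_map_add[OF verma_act_linear_left[OF m]]
            linear_map_add[OF functional_linear] linear_map_closed[OF verma_act_linear_left[OF m]]
            linear_map_add[OF form_linear_right] cartan_carrier algebra_simps)
    next
      case (smult c x)
      then show ?case
        using \<theta> by (simp add: U.env_inc_smult U.env_inc_closed linear_map_smult[OF verma_act_linear_left[OF m]]
            linear_map_smult[OF functional_linear] linear_map_closed[OF verma_act_linear_left[OF m]]
            linear_map_smult[OF form_linear_right] cartan_carrier)
    next
      case (base x)
      then show ?case using 1 cartan_neg_carrier by blast
    qed
    then show "x \<in> {x \<in> carrier G. \<alpha> (act (verma G \<theta>) (env_inc G x) m) = form G \<theta> x * \<alpha> m}" by simp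
  qed
  moreover have "x \<in> lspan G (cartan G \<union> neg_root_vectors)"
  proof -
    obtain h e where he: "h \<in> cartan G" "e \<in> n_minus G" "x = h \<oplus> e" using x by (auto simp: b_minus_carrier)
    have "e \<in> lspan G (cartan G \<union> neg_root_vectors)"
      using he(2) lspan_mono[of neg_root_vectors "cartan G \<union> neg_root_vectors"] by (auto simp: n_minus_eq)
    moreover have "h \<in> lspan G (cartan G \<union> neg_root_vectors)" using he(1) lspan_superset by blast
    ultimately show ?thesis unfolding he(3) by (intro submoduleE(5)[OF lspan_submodule[OF cartan_neg_carrier]])
  qed
  ultimately show ?thesis by blast
qed

end

subsection \<open>The character of the Borel subalgebra\<close>

text \<open>The form pairs the Cartan subalgebra trivially with \<open>\<nn>\<^sub>-\<close>, so the character \<open>\<theta>\<close> of \<open>\<bb>\<^sub>-\<close> is just \<open>(\<theta>, x)\<close>.\<close>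

lemma form_b_minus:
  assumes "\<theta> \<in> cartan G" "x \<in> carrier (b_minus G)"
  shows "(THE r. \<exists>h\<in>cartan G. \<exists>y\<in>n_minus G. x = h \<oplus> y \<and> r = form G \<theta> h) = form G \<theta> x"
proof -
  have eq: "form G \<theta> (h \<oplus> y) = form G \<theta> h" if "h \<in> cartan G" "y \<in> n_minus G" for h y
    using that assms(1) linear_map_add[OF form_linear_right]
    by (simp add: cartan_carrier n_minus_carrier form_n_minus)
  obtain h y where x: "h \<in> cartan G" "y \<in> n_minus G" "x = h \<oplus> y" using assms(2) by (auto simp: b_minus_carrier)
  show ?thesis
  proof (rule the_equality)
    show "\<exists>h\<in>cartan G. \<exists>y\<in>n_minus G. x = h \<oplus> y \<and> form G \<theta> x = form G \<theta> h"
      using x eq by metis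
  qed (use eq in metis)
qed

lemma b_incl_hom: "env_hom (b_minus G) (env G) (env_inc G)"
  by (intro env_hom.intro env_hom_axioms.intro b.lie_ops_axioms U.env.calg_axioms linear_mapI)
    (simp_all add: b_minus_sub U.env_inc_closed U.env_inc_add U.env_inc_smult U.env_inc_bracket)

lemma b_char_hom:
  assumes "\<theta> \<in> cartan G"
  shows "env_hom (b_minus G) complex_alg (\<lambda>x. THE r. \<exists>h\<in>cartan G. \<exists>y\<in>n_minus G. x = h \<oplus> y \<and> r = form G \<theta> h)"
    (is "env_hom _ _ ?\<chi>")
proof -
  have \<theta>: "\<theta> \<in> carrier G" using assms by (rule cartan_carrier)
  note \<chi> = form_b_minus[OF assms]
  have z: "x \<ominus>\<^bsub>complex_alg\<^esub> x = 0" for x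
    using ring.ring_simprules(16)[OF cring.axioms(1)[OF complex_alg_cring]] by (simp add: a_minus_def)
  show ?thesis
  proof (intro env_hom.intro env_hom_axioms.intro b.lie_ops_axioms calg_complex linear_mapI)
    fix x y assume xy: "x \<in> carrier (b_minus G)" "y \<in> carrier (b_minus G)"
    show "?\<chi> (x \<oplus>\<^bsub>b_minus G\<^esub> y) = ?\<chi> x \<oplus>\<^bsub>complex_alg\<^esub> ?\<chi> y"
      using \<chi>[OF b.add_closed[OF xy]] \<chi>[OF xy(1)] \<chi>[OF xy(2)] xy linear_map_add[OF form_linear_right[OF \<theta>]]
      by (simp add: b_minus_sub)
    have "form G \<theta> (bracket G x y) = 0" by (rule form_n_minus[OF assms b_minus_bracket[OF xy]])
    then show "?\<chi> (bracket (b_minus G) x y) = ?\<chi> x \<otimes>\<^bsub>complex_alg\<^esub> ?\<chi> y \<ominus>\<^bsub>complex_alg\<^esub> ?\<chi> y \<otimes>\<^bsub>complex_alg\<^esub> ?\<chi> x"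
      using \<chi>[OF b.bracket_closed[OF xy]] by (simp add: mult.commute z)
  next
    fix c x assume x: "x \<in> carrier (b_minus G)"
    show "?\<chi> (c \<odot>\<^bsub>b_minus G\<^esub> x) = c \<odot>\<^bsub>complex_alg\<^esub> ?\<chi> x"
      using \<chi>[OF b.scale_closed[OF x, of c]] \<chi>[OF x] x linear_map_smult[OF form_linear_right[OF \<theta>]]
      by (simp add: b_minus_sub)
  qed simp
qed

abbreviation b_env_map :: "'g env \<Rightarrow> 'g env" where
  "b_env_map \<equiv> env_lift (b_minus G) (env G) (env_inc G)"

lemma b_env_map_linear: "linear_map (env (b_minus G)) (env G) b_env_map"
  by (rule env_hom.env_lift_linear[OF b_incl_hom])

lemma b_char_linear: "\<theta> \<in> cartan G \<Longrightarrow> linear_map (env (b_minus G)) complex_alg (b_char G \<theta>)"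
  unfolding b_char_def by (rule env_hom.env_lift_linear[OF b_char_hom])

lemma b_env_map_word:
  assumes w: "w \<in> lists (carrier (b_minus G))" shows "b_env_map (b.word w) = U.word w"
proof -
  interpret h: env_hom "b_minus G" "env G" "env_inc G" by (rule b_incl_hom)
  have "h.eval_word w = U.word w" using w
  proof (induction w)
    case Nil
    then show ?case by (simp add: h.eval_word_def U.word_Nil)
  next
    case (Cons x w)
    have "w \<in> lists (carrier G)" using Cons.hyps b_minus_sub by auto
    then show ?case using Cons b_minus_sub by (simp add: h.eval_word_def U.word_Cons)
  qed
  then show ?thesis using h.env_lift_word[OF w] by simp
qed

text \<open>\<open>\<alpha>\<close> transforms under \<open>U \<bb>\<^sub>-\<close> by the character \<open>\<theta>\<close>. This is where the definition of \<open>\<alpha>\<close> through weight spaces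
  enters the proof.\<close>

lemma functional_b_env:
  assumes \<theta>: "\<theta> \<in> cartan G" and \<alpha>: "verma_functional G \<theta> \<alpha>"
    and b: "b \<in> carrier (env (b_minus G))" and m: "m \<in> carrier (verma G \<theta>)"
  shows "\<alpha> (act (verma G \<theta>) (b_env_map b) m) = b_char G \<theta> b * \<alpha> m"
proof -
  let ?\<chi> = "\<lambda>x. THE r. \<exists>h\<in>cartan G. \<exists>y\<in>n_minus G. x = h \<oplus> y \<and> r = form G \<theta> h"
  interpret h: env_hom "b_minus G" complex_alg ?\<chi> by (rule b_char_hom[OF \<theta>])
  note lin = functional_linear[OF \<theta> \<alpha>] and lin_m = verma_act_linear_left[OF m]
  note lin_b = linear_map_comp[OF linear_map_comp[OF b_env_map_linear lin_m] lin]
  show ?thesis using b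
  proof (induction rule: b.env_induct)
    case zero
    show ?case
      using linear_map_zero[OF b.env.cvec_axioms cvec_complex lin_b]
        linear_map_zero[OF b.env.cvec_axioms cvec_complex b_char_linear[OF \<theta>]] by simp
  next
    case (add u v)
    then show ?case
      by (simp add: linear_map_add[OF lin_b] linear_map_add[OF b_char_linear[OF \<theta>]] algebra_simps)
  next
    case (smult c u)
    then show ?case
      by (simp add: linear_map_smult[OF lin_b] linear_map_smult[OF b_char_linear[OF \<theta>]])
  next
    case (word w)
    have bw: "b_char G \<theta> (b.word w) = h.eval_word w"
      unfolding b_char_def by (rule h.env_lift_word[OF word])
    have "\<alpha> (act (verma G \<theta>) (U.word w) m) = h.eval_word w * \<alpha> m" using word
    proof (induction w)
      case Nil
      have "h.eval_word [] = 1" unfolding h.eval_word_def by simp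
      then show ?case by (simp only: U.word_Nil verma_act_one[OF m]) simp
    next
      case (Cons x w)
      have w: "w \<in> lists (carrier G)" and x: "x \<in> carrier G" using Cons.hyps b_minus_sub by auto
      have "act (verma G \<theta>) (U.word w) m \<in> carrier (verma G \<theta>)"
        by (rule linear_map_closed[OF lin_m U.word_closed[OF w]])
      then have "\<alpha> (act (verma G \<theta>) (U.word (x # w)) m) = form G \<theta> x * (h.eval_word w * \<alpha> m)"
        using x w m Cons.IH functional_b_minus[OF \<theta> \<alpha> Cons.hyps(1)]
        by (simp add: U.word_Cons verma_act_mult U.env_inc_closed U.word_closed)
      moreover have "h.eval_word (x # w) = form G \<theta> x * h.eval_word w"
        unfolding form_b_minus[OF \<theta> Cons.hyps(1), symmetric] unfolding h.eval_word_def by simp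
      ultimately show ?case by (simp only: mult.assoc)
    qed
    then show ?case by (simp add: b_env_map_word[OF word] bw)
  qed
qed

end

section \<open>Tensor powers of the enveloping algebra\<close>

text \<open>Common to \<open>\<theta> \<otimes> id\<close> and \<open>\<alpha> \<otimes> id\<close>.\<close>

lemma scalar_first_multilinear:
  fixes n :: nat
  assumes W: "tensor_family {0..n} W" and W': "tensor_family {1..n} W'" and eq: "\<And>i. i \<in> {1..n} \<Longrightarrow> W' i = W i"
    and \<chi>: "linear_map (W 0) complex_alg \<chi>"
  shows "multilinear {0..n} W (tensor {1..n} W')
    (\<lambda>t. \<chi> (t 0) \<odot>\<^bsub>tensor {1..n} W'\<^esub> pure {1..n} W' (restrict t {1..n}))"
proof (rule multilinearI)
  interpret W: tensor_family "{0..n}" W by fact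
  interpret W': tensor_family "{1..n}" W' by fact
  interpret T: cvec "tensor {1..n} W'" by (rule W'.cvec_tensor)
  fix t assume t: "t \<in> W.tuples"
  have r: "restrict t {1..n} \<in> W'.tuples" using t eq by (auto simp: PiE_iff)
  show "\<chi> (t 0) \<odot>\<^bsub>tensor {1..n} W'\<^esub> pure {1..n} W' (restrict t {1..n}) \<in> carrier (tensor {1..n} W')"
    by (intro T.smult_carrier W'.pure_closed r)
  fix i assume i: "i \<in> {0..n}"
  show "linear_map (W i) (tensor {1..n} W') (\<lambda>x. \<chi> ((t(i := x)) 0) \<odot>\<^bsub>tensor {1..n} W'\<^esub>
      pure {1..n} W' (restrict (t(i := x)) {1..n}))"
  proof (cases "i = 0")
    case True
    have "restrict (t(0 := x)) {1..n} = restrict t {1..n}" for x by auto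
    then show ?thesis
      unfolding True fun_upd_same
      using linear_map_smult_scalar[OF T.cvec_axioms \<chi> W'.pure_closed[OF r]] by simp
  next
    case False
    then have i1: "i \<in> {1..n}" using i by auto
    have "restrict (t(i := x)) {1..n} = (restrict t {1..n})(i := x)" for x using i1 by auto
    then show ?thesis
      using linear_map_smult_fun[OF T.cvec_axioms multilinear_linear[OF W'.pure_multilinear r i1], of "\<chi> (t 0)"]
        False by (simp add: eq[OF i1])
  qed
qed

context simple_tri_lie begin

lemma env_pow_family: "tensor_algebra_family I (\<lambda>_. env G)"
  by (rule tensor_algebra_family.intro) (rule U.env.calg_axioms)

end

locale env_power = simple_tri_lie G for G :: "'g tri_lie" (structure) + fixes I :: "nat set"
begin

abbreviation "UI \<equiv> env_pow G I"

sublocale A: tensor_algebra_family I "\<lambda>_. env G" by (rule env_pow_family)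
sublocale TA: calg "UI" by (rule A.calg_tensor)

definition ones :: "nat \<Rightarrow> 'g env" where "ones = (\<lambda>i\<in>I. \<one>\<^bsub>env G\<^esub>)"

lemma ones_tuple: "ones \<in> A.tuples"
  by (auto simp: ones_def)

lemma factor_eq: "i \<in> I \<Longrightarrow> factor G I i x = pure I (\<lambda>_. env G) (ones(i := env_inc G x))"
  unfolding factor_def ones_def
  by (rule arg_cong[where f = "pure I (\<lambda>_. env G)"], rule ext) auto

lemma tmult_ones_upd:
  assumes "s \<in> A.tuples" "i \<in> I"
  shows "A.tmult s (ones(i := u)) = s(i := s i \<otimes>\<^bsub>env G\<^esub> u)"
  using assms by (intro ext) (auto simp: A.tmult_def ones_def PiE_iff extensional_def)

lemma factor_linear:
  assumes "i \<in> I" shows "linear_map G UI (factor G I i)"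
proof -
  have "linear_map G UI (\<lambda>x. pure I (\<lambda>_. env G) (ones(i := env_inc G x)))"
    by (rule linear_map_comp[OF U.env_inc_linear multilinear_linear[OF A.pure_multilinear ones_tuple assms]])
  then show ?thesis by (simp add: factor_eq[OF assms, abs_def])
qed

lemma factor_closed: "\<lbrakk>i \<in> I; x \<in> carrier G\<rbrakk> \<Longrightarrow> factor G I i x \<in> carrier UI"
  by (rule linear_map_closed[OF factor_linear])

lemma pure_mult_factor:
  assumes "s \<in> A.tuples" "i \<in> I" "x \<in> carrier G"
  shows "pure I (\<lambda>_. env G) s \<otimes>\<^bsub>UI\<^esub> factor G I i x =
    pure I (\<lambda>_. env G) (s(i := s i \<otimes>\<^bsub>env G\<^esub> env_inc G x))"
  using assms
  by (simp add: factor_eq A.pure_mult A.tuple_upd ones_tuple U.env_inc_closed tmult_ones_upd)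

lemma factor_mult_factor:
  assumes "i \<in> I" "j \<in> I" "x \<in> carrier G" "y \<in> carrier G"
  shows "factor G I i x \<otimes>\<^bsub>UI\<^esub> factor G I j y =
    pure I (\<lambda>_. env G) ((ones(i := env_inc G x))(j := (ones(i := env_inc G x)) j \<otimes>\<^bsub>env G\<^esub> env_inc G y))"
  unfolding factor_eq[OF assms(1)]
  by (rule pure_mult_factor) (use assms in \<open>simp_all only: A.tuple_upd ones_tuple U.env_inc_closed\<close>)

lemma factor_commute:
  assumes "i \<in> I" "j \<in> I" "i \<noteq> j" "x \<in> carrier G" "y \<in> carrier G"
  shows "factor G I i x \<otimes>\<^bsub>UI\<^esub> factor G I j y = factor G I j y \<otimes>\<^bsub>UI\<^esub> factor G I i x"
  using assms
  by (simp add: factor_mult_factor ones_def U.env_inc_closed fun_upd_twist)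

lemma factor_bracket:
  assumes i: "i \<in> I" and xy: "x \<in> carrier G" "y \<in> carrier G"
  shows "factor G I i (bracket G x y) = factor G I i x \<otimes>\<^bsub>UI\<^esub> factor G I i y
    \<ominus>\<^bsub>UI\<^esub> factor G I i y \<otimes>\<^bsub>UI\<^esub> factor G I i x"
proof -
  note lin = multilinear_linear[OF A.pure_multilinear ones_tuple i]
  show ?thesis
    using xy linear_map_diff[OF U.env.cvec_axioms TA.cvec_axioms lin]
    by (simp add: factor_mult_factor i) (simp add: factor_eq i U.env_inc_bracket U.env_inc_closed)
qed

text \<open>For \<open>d\<^sub>i = (w\<^sub>i - c)\<^sup>-\<^sup>m\<close> this is the image of \<open>x[-m]\<close> in the Gaudin algebra.\<close>

definition weighted_diag :: "(nat \<Rightarrow> complex) \<Rightarrow> 'g \<Rightarrow> ((nat \<Rightarrow> 'g env) \<Rightarrow> complex) set" where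
  "weighted_diag d x = (\<Oplus>\<^bsub>UI\<^esub>i\<in>I. d i \<odot>\<^bsub>UI\<^esub> factor G I i x)"

lemma scaled_factor_linear:
  "i \<in> I \<Longrightarrow> linear_map G UI (\<lambda>x. c \<odot>\<^bsub>UI\<^esub> factor G I i x)"
  by (rule linear_map_smult_fun[OF TA.cvec_axioms factor_linear])

lemma sum_factors_linear:
  assumes "finite S" "S \<subseteq> I"
  shows "linear_map G UI (\<lambda>x. \<Oplus>\<^bsub>UI\<^esub>i\<in>S. d i \<odot>\<^bsub>UI\<^esub> factor G I i x)"
  using assms
proof (induction S)
  case empty
  show ?case using linear_map_zero_fun[OF TA.cvec_axioms] by simp
next
  case (insert i S)
  then have i: "i \<in> I" and S: "S \<subseteq> I" by auto
  have c: "(\<lambda>i. d i \<odot>\<^bsub>UI\<^esub> factor G I i x) \<in> S \<rightarrow> carrier UI" if "x \<in> carrier G" for x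
    using S that factor_closed by auto
  show ?case
    by (rule linear_map_cong[OF linear_map_add_fun[OF TA.cvec_axioms scaled_factor_linear[OF i, of "d i"]
            insert.IH[OF S]] cvec_axioms])
      (use insert.hyps i c factor_closed in simp)
qed

text \<open>Different tensor factors commute, so the mixed terms of the commutator cancel.\<close>

lemma sum_factors_commutator:
  assumes "finite S" "S \<subseteq> I" and xy: "x \<in> carrier G" "y \<in> carrier G"
  defines "D \<equiv> \<lambda>S d x. \<Oplus>\<^bsub>UI\<^esub>i\<in>S. d i \<odot>\<^bsub>UI\<^esub> factor G I i x"
  shows "D S (\<lambda>i. d i * e i) (bracket G x y) =
    D S d x \<otimes>\<^bsub>UI\<^esub> D S e y \<ominus>\<^bsub>UI\<^esub> D S e y \<otimes>\<^bsub>UI\<^esub> D S d x"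
  using assms(1,2)
proof (induction S)
  case empty
  show ?case by (simp add: D_def a_minus_def)
next
  case (insert i S)
  then have i: "i \<in> I" and S: "S \<subseteq> I" by auto
  have cl: "D S d x \<in> carrier UI" if "x \<in> carrier G" for d x
    unfolding D_def by (rule linear_map_closed[OF sum_factors_linear[OF insert.hyps(1) S] that])
  have ins: "D (insert i S) d x = d i \<odot>\<^bsub>UI\<^esub> factor G I i x \<oplus>\<^bsub>UI\<^esub> D S d x"
    if "x \<in> carrier G" for d x
    unfolding D_def using insert.hyps i S that factor_closed by (subst TA.M.finsum_insert) auto
  have comm: "factor G I i x \<otimes>\<^bsub>UI\<^esub> D S e y = D S e y \<otimes>\<^bsub>UI\<^esub> factor G I i x"
    if xy: "x \<in> carrier G" "y \<in> carrier G" for x y e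
  proof -
    have f: "(\<lambda>j. e j \<odot>\<^bsub>UI\<^esub> factor G I j y) \<in> S \<rightarrow> carrier UI"
      using S xy factor_closed by auto
    note fc = factor_closed[OF i xy(1)]
    have "factor G I i x \<otimes>\<^bsub>UI\<^esub> D S e y =
        (\<Oplus>\<^bsub>UI\<^esub>j\<in>S. factor G I i x \<otimes>\<^bsub>UI\<^esub> (e j \<odot>\<^bsub>UI\<^esub> factor G I j y))"
      unfolding D_def
      by (rule linear_map_finsum[OF TA.cvec_axioms TA.cvec_axioms TA.mult_left_linear[OF fc] insert.hyps(1) f])
    also have "\<dots> = (\<Oplus>\<^bsub>UI\<^esub>j\<in>S. (e j \<odot>\<^bsub>UI\<^esub> factor G I j y) \<otimes>\<^bsub>UI\<^esub> factor G I i x)"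
    proof (rule TA.M.finsum_cong'[OF refl])
      show "(\<lambda>j. (e j \<odot>\<^bsub>UI\<^esub> factor G I j y) \<otimes>\<^bsub>UI\<^esub> factor G I i x) \<in> S \<rightarrow> carrier UI"
        using f fc by (auto simp: Pi_iff)
      fix j assume "j \<in> S"
      then have "j \<in> I" "i \<noteq> j" using S insert.hyps by auto
      then show "factor G I i x \<otimes>\<^bsub>UI\<^esub> (e j \<odot>\<^bsub>UI\<^esub> factor G I j y) =
          (e j \<odot>\<^bsub>UI\<^esub> factor G I j y) \<otimes>\<^bsub>UI\<^esub> factor G I i x"
        using i xy fc by (simp add: TA.smult_mult_left TA.smult_mult_right factor_closed factor_commute)
    qed
    also have "\<dots> = D S e y \<otimes>\<^bsub>UI\<^esub> factor G I i x"
      unfolding D_def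
      by (rule linear_map_finsum[OF TA.cvec_axioms TA.cvec_axioms TA.mult_right_linear[OF fc] insert.hyps(1) f, symmetric])
    finally show ?thesis .
  qed
  \<comment> \<open>\<open>?P\<close> and \<open>?Q\<close> live in factor \<open>i\<close>, \<open>?R\<close> and \<open>?T\<close> in the others, so only the pairs
    \<open>(?P, ?Q)\<close> and \<open>(?R, ?T)\<close> have a commutator.\<close>
  let ?P = "d i \<odot>\<^bsub>UI\<^esub> factor G I i x" and ?Q = "e i \<odot>\<^bsub>UI\<^esub> factor G I i y"
  let ?R = "D S d x" and ?T = "D S e y"
  note c = TA.smult_carrier[OF factor_closed[OF i xy(1)], of "d i"]
    TA.smult_carrier[OF factor_closed[OF i xy(2)], of "e i"] cl[OF xy(1), of d] cl[OF xy(2), of e]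
  have PT: "?P \<otimes>\<^bsub>UI\<^esub> ?T = ?T \<otimes>\<^bsub>UI\<^esub> ?P"
    using comm[OF xy, of e] c(3,4) factor_closed[OF i xy(1)] by (simp add: TA.smult_mult_left TA.smult_mult_right)
  have QR: "?Q \<otimes>\<^bsub>UI\<^esub> ?R = ?R \<otimes>\<^bsub>UI\<^esub> ?Q"
    using comm[OF xy(2,1), of d] c(3,4) factor_closed[OF i xy(2)] by (simp add: TA.smult_mult_left TA.smult_mult_right)
  have PQ: "(d i * e i) \<odot>\<^bsub>UI\<^esub> factor G I i (bracket G x y) =
      ?P \<otimes>\<^bsub>UI\<^esub> ?Q \<ominus>\<^bsub>UI\<^esub> ?Q \<otimes>\<^bsub>UI\<^esub> ?P"
    using factor_closed[OF i xy(1)] factor_closed[OF i xy(2)]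
    by (simp add: factor_bracket[OF i xy] TA.smult_mult_left TA.smult_mult_right TA.smult_smult a_minus_def
        TA.smult_add_right TA.uminus_eq_smult mult.commute)
  have ring_eq: "(p \<oplus>\<^bsub>UI\<^esub> r) \<otimes>\<^bsub>UI\<^esub> (q \<oplus>\<^bsub>UI\<^esub> t) \<ominus>\<^bsub>UI\<^esub>
      (q \<oplus>\<^bsub>UI\<^esub> t) \<otimes>\<^bsub>UI\<^esub> (p \<oplus>\<^bsub>UI\<^esub> r) =
      (p \<otimes>\<^bsub>UI\<^esub> q \<ominus>\<^bsub>UI\<^esub> q \<otimes>\<^bsub>UI\<^esub> p) \<oplus>\<^bsub>UI\<^esub>
      (r \<otimes>\<^bsub>UI\<^esub> t \<ominus>\<^bsub>UI\<^esub> t \<otimes>\<^bsub>UI\<^esub> r)"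
    if "p \<in> carrier UI" "q \<in> carrier UI" "r \<in> carrier UI" "t \<in> carrier UI"
      "p \<otimes>\<^bsub>UI\<^esub> t = t \<otimes>\<^bsub>UI\<^esub> p" "q \<otimes>\<^bsub>UI\<^esub> r = r \<otimes>\<^bsub>UI\<^esub> q" for p q r t
  proof -
    have 1: "(p \<oplus>\<^bsub>UI\<^esub> r) \<otimes>\<^bsub>UI\<^esub> (q \<oplus>\<^bsub>UI\<^esub> t) =
        (p \<otimes>\<^bsub>UI\<^esub> q \<oplus>\<^bsub>UI\<^esub> r \<otimes>\<^bsub>UI\<^esub> t) \<oplus>\<^bsub>UI\<^esub>
        (t \<otimes>\<^bsub>UI\<^esub> p \<oplus>\<^bsub>UI\<^esub> q \<otimes>\<^bsub>UI\<^esub> r)"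
      using that by (simp add: TA.l_distr TA.r_distr TA.M.a_ac)
    have 2: "(q \<oplus>\<^bsub>UI\<^esub> t) \<otimes>\<^bsub>UI\<^esub> (p \<oplus>\<^bsub>UI\<^esub> r) =
        (q \<otimes>\<^bsub>UI\<^esub> p \<oplus>\<^bsub>UI\<^esub> t \<otimes>\<^bsub>UI\<^esub> r) \<oplus>\<^bsub>UI\<^esub>
        (t \<otimes>\<^bsub>UI\<^esub> p \<oplus>\<^bsub>UI\<^esub> q \<otimes>\<^bsub>UI\<^esub> r)"
      using that(1-4) by (simp add: TA.l_distr TA.r_distr TA.M.a_ac)
    have 3: "(a \<oplus>\<^bsub>UI\<^esub> b \<oplus>\<^bsub>UI\<^esub> m) \<ominus>\<^bsub>UI\<^esub> (a' \<oplus>\<^bsub>UI\<^esub> b' \<oplus>\<^bsub>UI\<^esub> m) =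
        (a \<ominus>\<^bsub>UI\<^esub> a') \<oplus>\<^bsub>UI\<^esub> (b \<ominus>\<^bsub>UI\<^esub> b')"
      if "a \<in> carrier UI" "b \<in> carrier UI" "a' \<in> carrier UI"
        "b' \<in> carrier UI" "m \<in> carrier UI" for a b a' b' m
      using that by (simp add: a_minus_def TA.M.minus_add TA.M.a_ac TA.M.r_neg1 TA.M.r_neg2 TA.M.r_neg)
    show ?thesis unfolding 1 2 using that(1-4) by (simp add: 3)
  qed
  show ?case
    unfolding ins[OF xy(1)] ins[OF xy(2)] ins[OF bracket_closed[OF xy]] ring_eq[OF c(1,2,3,4) PT QR]
      PQ insert.IH[OF S] ..
qed

end

section \<open>Evaluation of the loop algebra\<close>

context simple_tri_lie begin

lemma loop_simps [simp]:
  "\<zero>\<^bsub>loop_minus G\<^esub> = (\<lambda>_. \<zero>)" "f \<oplus>\<^bsub>loop_minus G\<^esub> g = (\<lambda>k. f k \<oplus> g k)"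
  "c \<odot>\<^bsub>loop_minus G\<^esub> f = (\<lambda>k. c \<odot> f k)"
  "bracket (loop_minus G) f g = (\<lambda>k. \<Oplus>i\<in>{..k}. bracket G (f i) (g (k - i)))"
  by (simp_all add: loop_minus_def)

lemma loop_carrier:
  "f \<in> carrier (loop_minus G) \<longleftrightarrow> (\<forall>k. f k \<in> carrier G) \<and> f 0 = \<zero> \<and> finite {k. f k \<noteq> \<zero>}"
  by (auto simp: loop_minus_def)

lemma bracket_zero_left [simp]: "x \<in> carrier G \<Longrightarrow> bracket G \<zero> x = \<zero>"
  by (rule linear_map_zero[OF cvec_axioms cvec_axioms bracket_linear_left])

lemma bracket_zero_right [simp]: "x \<in> carrier G \<Longrightarrow> bracket G x \<zero> = \<zero>"
  by (rule linear_map_zero[OF cvec_axioms cvec_axioms bracket_linear_right])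

lemma loop_bracket_Pi:
  "\<lbrakk>\<forall>k. f k \<in> carrier G; \<forall>k. g k \<in> carrier G\<rbrakk> \<Longrightarrow> (\<lambda>i. bracket G (f i) (g (k - i))) \<in> S \<rightarrow> carrier G"
  by (simp add: bracket_closed)

sublocale loop: lie_ops "loop_minus G"
proof
  fix f g assume fg: "f \<in> carrier (loop_minus G)" "g \<in> carrier (loop_minus G)"
  then have c: "\<forall>k. f k \<in> carrier G" "\<forall>k. g k \<in> carrier G" "f 0 = \<zero>" "g 0 = \<zero>"
    and fin: "finite {k. f k \<noteq> \<zero>}" "finite {k. g k \<noteq> \<zero>}" by (auto simp: loop_carrier)
  have "finite {k. f k \<oplus> g k \<noteq> \<zero>}"
    by (rule finite_subset[OF _ finite_UnI[OF fin]]) auto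
  then show "f \<oplus>\<^bsub>loop_minus G\<^esub> g \<in> carrier (loop_minus G)"
    using c by (simp add: loop_carrier)
  obtain N M where N: "\<And>k. f k \<noteq> \<zero> \<Longrightarrow> k \<le> N" and M: "\<And>k. g k \<noteq> \<zero> \<Longrightarrow> k \<le> M"
    using fin unfolding finite_nat_set_iff_bounded_le by blast
  have z: "(\<Oplus>i\<in>{..k}. bracket G (f i) (g (k - i))) = \<zero>" if k: "N + M < k" for k
  proof -
    have "bracket G (f i) (g (k - i)) = \<zero>" for i
    proof (cases "i \<le> N")
      case True
      then have "\<not> k - i \<le> M" using k by linarith
      then have "g (k - i) = \<zero>" using M by blast
      then show ?thesis using c by simp
    next
      case False
      then have "f i = \<zero>" using N by blast
      then show ?thesis using c by simp
    qed
    then show ?thesis by simp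
  qed
  have "finite {k. (\<Oplus>i\<in>{..k}. bracket G (f i) (g (k - i))) \<noteq> \<zero>}"
  proof (rule finite_subset)
    show "{k. (\<Oplus>i\<in>{..k}. bracket G (f i) (g (k - i))) \<noteq> \<zero>} \<subseteq> {..N + M}"
      using z by (intro subsetI) (simp, metis not_le)
  qed simp
  then show "bracket (loop_minus G) f g \<in> carrier (loop_minus G)"
    using c loop_bracket_Pi[OF c(1,2)] by (simp add: loop_carrier)
next
  fix f c assume f: "f \<in> carrier (loop_minus G)"
  then have "finite {k. c \<odot> f k \<noteq> \<zero>}"
    by (intro finite_subset[of "{k. c \<odot> f k \<noteq> \<zero>}" "{k. f k \<noteq> \<zero>}"]) (auto simp: loop_carrier)
  then show "c \<odot>\<^bsub>loop_minus G\<^esub> f \<in> carrier (loop_minus G)"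
    using f by (simp add: loop_carrier)
qed

lemma loop_elem_carrier: "\<lbrakk>x \<in> carrier G; k \<noteq> 0\<rbrakk> \<Longrightarrow> loop_elem G x k \<in> carrier (loop_minus G)"
proof -
  assume "x \<in> carrier G" "k \<noteq> 0"
  moreover have "finite {m. loop_elem G x k m \<noteq> \<zero>}"
    by (rule finite_subset[of _ "{k}"]) (auto simp: loop_elem_def)
  ultimately show ?thesis by (auto simp: loop_carrier loop_elem_def)
qed

text \<open>The elements \<open>x[-k]\<close> span \<open>t\<^sup>-\<^sup>1 \<gg>[t\<^sup>-\<^sup>1]\<close>, which reduces the compatibility of the evaluation map with brackets
  to \<open>[x[-k], y[-l]] = [x, y][-k-l]\<close>.\<close>

lemma loop_induct [consumes 1, case_names zero add elem]:
  assumes "f \<in> carrier (loop_minus G)" and zero: "P \<zero>\<^bsub>loop_minus G\<^esub>"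
    and add: "\<And>f g. \<lbrakk>f \<in> carrier (loop_minus G); g \<in> carrier (loop_minus G); P f; P g\<rbrakk> \<Longrightarrow> P (f \<oplus>\<^bsub>loop_minus G\<^esub> g)"
    and elem: "\<And>x k. \<lbrakk>x \<in> carrier G; k \<noteq> 0\<rbrakk> \<Longrightarrow> P (loop_elem G x k)"
  shows "P f"
proof -
  have "\<forall>f. f \<in> carrier (loop_minus G) \<longrightarrow> {k. f k \<noteq> \<zero>} = S \<longrightarrow> P f" if "finite S" for S
    using that
  proof induction
    case empty
    show ?case
    proof (intro allI impI)
      fix f :: "nat \<Rightarrow> 'g" assume "{k. f k \<noteq> \<zero>} = {}"
      then have "f = \<zero>\<^bsub>loop_minus G\<^esub>" by auto
      then show "P f" using zero by simp
    qed
  next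
    case (insert a S)
    show ?case
    proof (intro allI impI)
      fix f assume f: "f \<in> carrier (loop_minus G)" "{k. f k \<noteq> \<zero>} = insert a S"
      define g where "g = (\<lambda>k. if k = a then \<zero> else f k)"
      have supp: "{k. g k \<noteq> \<zero>} = S" using f(2) insert.hyps by (auto simp: g_def)
      have fc: "f k \<in> carrier G" for k using f(1) by (simp add: loop_carrier)
      have g: "g \<in> carrier (loop_minus G)"
        using f(1) supp insert.hyps fc by (auto simp: loop_carrier g_def)
      have "f a \<noteq> \<zero>" using f(2) by blast
      then have a: "a \<noteq> 0" using f(1) by (auto simp: loop_carrier intro: ccontr)
      have "f = loop_elem G (f a) a \<oplus>\<^bsub>loop_minus G\<^esub> g"
        using fc by (auto simp: loop_elem_def g_def)
      moreover have "P (loop_elem G (f a) a \<oplus>\<^bsub>loop_minus G\<^esub> g)"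
        by (intro add elem loop_elem_carrier fc a g) (use insert.IH g supp in blast)
      ultimately show "P f" by metis
    qed
  qed
  then show ?thesis using assms(1) by (auto simp: loop_carrier)
qed

lemma loop_bracket_add_left:
  assumes "f \<in> carrier (loop_minus G)" "f' \<in> carrier (loop_minus G)" "g \<in> carrier (loop_minus G)"
  shows "bracket (loop_minus G) (f \<oplus>\<^bsub>loop_minus G\<^esub> f') g =
    bracket (loop_minus G) f g \<oplus>\<^bsub>loop_minus G\<^esub> bracket (loop_minus G) f' g"
proof -
  have c: "\<forall>k. f k \<in> carrier G" "\<forall>k. f' k \<in> carrier G" "\<forall>k. g k \<in> carrier G"
    using assms by (auto simp: loop_carrier)
  have "(\<Oplus>i\<in>{..k}. bracket G (f i \<oplus> f' i) (g (k - i))) =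
      (\<Oplus>i\<in>{..k}. bracket G (f i) (g (k - i)) \<oplus> bracket G (f' i) (g (k - i)))" for k
    using c by (intro M.finsum_cong') (auto simp: bracket_add_left bracket_closed)
  also have "\<dots> k = (\<Oplus>i\<in>{..k}. bracket G (f i) (g (k - i))) \<oplus> (\<Oplus>i\<in>{..k}. bracket G (f' i) (g (k - i)))" for k
    by (rule M.finsum_addf[OF loop_bracket_Pi[OF c(1,3)] loop_bracket_Pi[OF c(2,3)]])
  finally show ?thesis by simp
qed

lemma loop_bracket_add_right:
  assumes "f \<in> carrier (loop_minus G)" "g \<in> carrier (loop_minus G)" "g' \<in> carrier (loop_minus G)"
  shows "bracket (loop_minus G) f (g \<oplus>\<^bsub>loop_minus G\<^esub> g') =
    bracket (loop_minus G) f g \<oplus>\<^bsub>loop_minus G\<^esub> bracket (loop_minus G) f g'"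
proof -
  have c: "\<forall>k. f k \<in> carrier G" "\<forall>k. g k \<in> carrier G" "\<forall>k. g' k \<in> carrier G"
    using assms by (auto simp: loop_carrier)
  have "(\<Oplus>i\<in>{..k}. bracket G (f i) (g (k - i) \<oplus> g' (k - i))) =
      (\<Oplus>i\<in>{..k}. bracket G (f i) (g (k - i)) \<oplus> bracket G (f i) (g' (k - i)))" for k
    using c by (intro M.finsum_cong') (auto simp: bracket_add_right bracket_closed)
  also have "\<dots> k = (\<Oplus>i\<in>{..k}. bracket G (f i) (g (k - i))) \<oplus> (\<Oplus>i\<in>{..k}. bracket G (f i) (g' (k - i)))" for k
    by (rule M.finsum_addf[OF loop_bracket_Pi[OF c(1,2)] loop_bracket_Pi[OF c(1,3)]])
  finally show ?thesis by simp
qed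

lemma loop_bracket_elem:
  assumes "x \<in> carrier G" "y \<in> carrier G"
  shows "bracket (loop_minus G) (loop_elem G x k) (loop_elem G y l) = loop_elem G (bracket G x y) (k + l)"
proof
  fix m
  have t: "bracket G (loop_elem G x k i) (loop_elem G y l (m - i)) =
      (if i = k \<and> m - i = l then bracket G x y else \<zero>)" for i
    using assms by (simp add: loop_elem_def)
  have eq: "bracket (loop_minus G) (loop_elem G x k) (loop_elem G y l) m =
      (\<Oplus>i\<in>{..m}. if i = k \<and> m - i = l then bracket G x y else \<zero>)"
    by (simp only: loop_simps(4) t)
  show "bracket (loop_minus G) (loop_elem G x k) (loop_elem G y l) m = loop_elem G (bracket G x y) (k + l) m"
  proof (cases "m = k + l")
    case True
    have "(\<Oplus>i\<in>{..m}. if i = k \<and> m - i = l then bracket G x y else \<zero>) =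
        (\<Oplus>i\<in>{..m}. if k = i then bracket G x y else \<zero>)"
      using True assms by (intro M.finsum_cong') (auto simp: bracket_closed)
    also have "\<dots> = bracket G x y"
      using True assms by (intro M.finsum_singleton) (auto simp: bracket_closed)
    finally show ?thesis unfolding eq using True by (simp add: loop_elem_def)
  next
    case False
    have "(\<Oplus>i\<in>{..m}. if i = k \<and> m - i = l then bracket G x y else \<zero>) = (\<Oplus>i\<in>{..m}. \<zero>)"
      using False by (intro M.finsum_cong') auto
    then show ?thesis unfolding eq using False by (simp add: loop_elem_def)
  qed
qed

end

context env_power begin

context
  fixes w :: "nat \<Rightarrow> complex" and c :: complex
  assumes fin: "finite I"
begin

definition loop_map :: "(nat \<Rightarrow> 'g) \<Rightarrow> ((nat \<Rightarrow> 'g env) \<Rightarrow> complex) set" where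
  "loop_map f = (\<Oplus>\<^bsub>UI\<^esub>m\<in>{m. f m \<noteq> \<zero>}. weighted_diag (\<lambda>i. 1 / (w i - c) ^ m) (f m))"

lemma weighted_diag_linear: "linear_map G UI (weighted_diag d)"
  unfolding weighted_diag_def[abs_def] by (rule sum_factors_linear[OF fin order_refl])

lemma weighted_diag_Pi:
  "f \<in> carrier (loop_minus G) \<Longrightarrow> (\<lambda>m. weighted_diag (d m) (f m)) \<in> S \<rightarrow> carrier UI"
  by (auto simp: loop_carrier intro: linear_map_closed[OF weighted_diag_linear])

lemma loop_map_superset:
  assumes "f \<in> carrier (loop_minus G)" "finite S" "{m. f m \<noteq> \<zero>} \<subseteq> S"
  shows "loop_map f = (\<Oplus>\<^bsub>UI\<^esub>m\<in>S. weighted_diag (\<lambda>i. 1 / (w i - c) ^ m) (f m))"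
  unfolding loop_map_def
  using assms linear_map_zero[OF cvec_axioms TA.cvec_axioms weighted_diag_linear] weighted_diag_Pi[OF assms(1)]
  by (intro TA.M.add.finprod_mono_neutral_cong_left) auto

lemma loop_map_elem:
  assumes "x \<in> carrier G" "k \<noteq> 0"
  shows "loop_map (loop_elem G x k) = weighted_diag (\<lambda>i. 1 / (w i - c) ^ k) x"
proof -
  have "loop_map (loop_elem G x k) =
      (\<Oplus>\<^bsub>UI\<^esub>m\<in>{k}. weighted_diag (\<lambda>i. 1 / (w i - c) ^ m) (loop_elem G x k m))"
    by (rule loop_map_superset[OF loop_elem_carrier[OF assms]]) (auto simp: loop_elem_def)
  then show ?thesis
    using assms linear_map_closed[OF weighted_diag_linear] by (simp add: loop_elem_def)
qed

lemma loop_map_linear: "linear_map (loop_minus G) UI loop_map"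
proof (rule linear_mapI)
  fix f assume f: "f \<in> carrier (loop_minus G)"
  then have fs: "finite {m. f m \<noteq> \<zero>}" and fc: "f m \<in> carrier G" for m by (auto simp: loop_carrier)
  show "loop_map f \<in> carrier UI"
    unfolding loop_map_def by (rule TA.M.finsum_closed[OF weighted_diag_Pi[OF f]])
  fix a
  have "loop_map (a \<odot>\<^bsub>loop_minus G\<^esub> f) = (\<Oplus>\<^bsub>UI\<^esub>m\<in>{m. f m \<noteq> \<zero>}.
      weighted_diag (\<lambda>i. 1 / (w i - c) ^ m) ((a \<odot>\<^bsub>loop_minus G\<^esub> f) m))"
    by (rule loop_map_superset[OF loop.scale_closed[OF f] fs]) auto
  also have "\<dots> = (\<Oplus>\<^bsub>UI\<^esub>m\<in>{m. f m \<noteq> \<zero>}.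
      a \<odot>\<^bsub>UI\<^esub> weighted_diag (\<lambda>i. 1 / (w i - c) ^ m) (f m))"
    using weighted_diag_Pi[OF f] fc
    by (intro TA.M.finsum_cong') (auto simp: linear_map_smult[OF weighted_diag_linear] linear_map_closed[OF weighted_diag_linear])
  also have "\<dots> = a \<odot>\<^bsub>UI\<^esub> loop_map f"
    unfolding loop_map_def by (rule TA.smult_finsum[OF fs weighted_diag_Pi[OF f], symmetric])
  finally show "loop_map (a \<odot>\<^bsub>loop_minus G\<^esub> f) = a \<odot>\<^bsub>UI\<^esub> loop_map f" .
  fix g assume g: "g \<in> carrier (loop_minus G)"
  then have gs: "finite {m. g m \<noteq> \<zero>}" and gc: "g m \<in> carrier G" for m by (auto simp: loop_carrier)
  let ?S = "{m. f m \<noteq> \<zero>} \<union> {m. g m \<noteq> \<zero>}"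
  have "loop_map (f \<oplus>\<^bsub>loop_minus G\<^esub> g) = (\<Oplus>\<^bsub>UI\<^esub>m\<in>?S.
      weighted_diag (\<lambda>i. 1 / (w i - c) ^ m) ((f \<oplus>\<^bsub>loop_minus G\<^esub> g) m))"
    by (rule loop_map_superset[OF loop.add_closed[OF f g]]) (use fs gs in auto)
  also have "\<dots> = (\<Oplus>\<^bsub>UI\<^esub>m\<in>?S. weighted_diag (\<lambda>i. 1 / (w i - c) ^ m) (f m)
      \<oplus>\<^bsub>UI\<^esub> weighted_diag (\<lambda>i. 1 / (w i - c) ^ m) (g m))"
    using fc gc
    by (intro TA.M.finsum_cong') (auto simp: linear_map_add[OF weighted_diag_linear] linear_map_closed[OF weighted_diag_linear])
  also have "\<dots> = (\<Oplus>\<^bsub>UI\<^esub>m\<in>?S. weighted_diag (\<lambda>i. 1 / (w i - c) ^ m) (f m))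
      \<oplus>\<^bsub>UI\<^esub> (\<Oplus>\<^bsub>UI\<^esub>m\<in>?S. weighted_diag (\<lambda>i. 1 / (w i - c) ^ m) (g m))"
    by (rule TA.M.finsum_addf[OF weighted_diag_Pi[OF f] weighted_diag_Pi[OF g]])
  also have "\<dots> = loop_map f \<oplus>\<^bsub>UI\<^esub> loop_map g"
    using loop_map_superset[OF f, of ?S] loop_map_superset[OF g, of ?S] fs gs by simp
  finally show "loop_map (f \<oplus>\<^bsub>loop_minus G\<^esub> g) = loop_map f \<oplus>\<^bsub>UI\<^esub> loop_map g" .
qed

definition commutator where
  "commutator u v = u \<otimes>\<^bsub>UI\<^esub> v \<ominus>\<^bsub>UI\<^esub> v \<otimes>\<^bsub>UI\<^esub> u"

lemma commutator_add_left:
  assumes "u \<in> carrier UI" "v \<in> carrier UI" "x \<in> carrier UI"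
  shows "commutator (u \<oplus>\<^bsub>UI\<^esub> v) x = commutator u x \<oplus>\<^bsub>UI\<^esub> commutator v x"
  using assms by (simp add: commutator_def TA.l_distr TA.r_distr a_minus_def TA.M.minus_add TA.M.a_ac)

lemma commutator_add_right:
  assumes "u \<in> carrier UI" "v \<in> carrier UI" "x \<in> carrier UI"
  shows "commutator x (u \<oplus>\<^bsub>UI\<^esub> v) = commutator x u \<oplus>\<^bsub>UI\<^esub> commutator x v"
  using assms by (simp add: commutator_def TA.l_distr TA.r_distr a_minus_def TA.M.minus_add TA.M.a_ac)

text \<open>By biadditivity it suffices to take \<open>x[-k]\<close> and \<open>y[-l]\<close>, where the weights \<open>(w\<^sub>i - c)\<^sup>-\<^sup>k\<close> and
  \<open>(w\<^sub>i - c)\<^sup>-\<^sup>l\<close> multiply to \<open>(w\<^sub>i - c)\<^sup>-\<^sup>k\<^sup>-\<^sup>l\<close>.\<close>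

lemma loop_map_bracket:
  assumes f: "f \<in> carrier (loop_minus G)" and g: "g \<in> carrier (loop_minus G)"
  shows "loop_map (bracket (loop_minus G) f g) = commutator (loop_map f) (loop_map g)"
proof -
  note lin = loop_map_linear and closed = linear_map_closed[OF loop_map_linear]
  have zero: "loop_map \<zero>\<^bsub>loop_minus G\<^esub> = \<zero>\<^bsub>UI\<^esub>"
    by (simp add: loop_map_def)
  have comm0: "commutator \<zero>\<^bsub>UI\<^esub> x = \<zero>\<^bsub>UI\<^esub>" "commutator x \<zero>\<^bsub>UI\<^esub> = \<zero>\<^bsub>UI\<^esub>"
    if "x \<in> carrier UI" for x
    using that by (simp_all add: commutator_def a_minus_def)
  have 1: "loop_map (bracket (loop_minus G) (loop_elem G x k) g) = commutator (loop_map (loop_elem G x k)) (loop_map g)"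
    if x: "x \<in> carrier G" "k \<noteq> 0" for x k
    using g
  proof (induction rule: loop_induct)
    case zero
    have xk: "loop_elem G x k i \<in> carrier G" for i using x by (simp add: loop_elem_def)
    then have "bracket (loop_minus G) (loop_elem G x k) \<zero>\<^bsub>loop_minus G\<^esub> = \<zero>\<^bsub>loop_minus G\<^esub>" by simp
    then show ?case using \<open>loop_map \<zero>\<^bsub>loop_minus G\<^esub> = \<zero>\<^bsub>UI\<^esub>\<close> comm0(2)[OF closed[OF loop_elem_carrier[OF x]]]
      by (simp only:)
  next
    case (add f g)
    note e = loop_elem_carrier[OF x]
    show ?case
      unfolding loop_bracket_add_right[OF e add.hyps] linear_map_add[OF lin add.hyps]
        linear_map_add[OF lin loop.bracket_closed[OF e add.hyps(1)] loop.bracket_closed[OF e add.hyps(2)]]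
        commutator_add_right[OF closed[OF add.hyps(1)] closed[OF add.hyps(2)] closed[OF e]] add.IH ..
  next
    case (elem y l)
    have "loop_map (bracket (loop_minus G) (loop_elem G x k) (loop_elem G y l)) =
        weighted_diag (\<lambda>i. 1 / (w i - c) ^ (k + l)) (bracket G x y)"
      unfolding loop_bracket_elem[OF x(1) elem(1)] using x elem by (intro loop_map_elem bracket_closed) auto
    also have "(\<lambda>i. 1 / (w i - c) ^ (k + l)) = (\<lambda>i. (1 / (w i - c) ^ k) * (1 / (w i - c) ^ l))"
      by (simp add: power_add)
    also have "weighted_diag \<dots> (bracket G x y) =
        commutator (weighted_diag (\<lambda>i. 1 / (w i - c) ^ k) x) (weighted_diag (\<lambda>i. 1 / (w i - c) ^ l) y)"
      unfolding weighted_diag_def commutator_def by (rule sum_factors_commutator[OF fin order_refl x(1) elem(1)])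
    finally show ?case unfolding loop_map_elem[OF x] loop_map_elem[OF elem] .
  qed
  show ?thesis using f
  proof (induction rule: loop_induct)
    case zero
    have gk: "g i \<in> carrier G" for i using g by (simp add: loop_carrier)
    then have "bracket (loop_minus G) \<zero>\<^bsub>loop_minus G\<^esub> g = \<zero>\<^bsub>loop_minus G\<^esub>" by simp
    then show ?case using \<open>loop_map \<zero>\<^bsub>loop_minus G\<^esub> = \<zero>\<^bsub>UI\<^esub>\<close> comm0(1)[OF closed[OF g]]
      by (simp only:)
  next
    case (add f f')
    show ?case
      unfolding loop_bracket_add_left[OF add.hyps g] linear_map_add[OF lin add.hyps]
        linear_map_add[OF lin loop.bracket_closed[OF add.hyps(1) g] loop.bracket_closed[OF add.hyps(2) g]]
        commutator_add_left[OF closed[OF add.hyps(1)] closed[OF add.hyps(2)] closed[OF g]] add.IH ..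
  qed (rule 1)
qed

lemma loop_map_hom: "env_hom (loop_minus G) UI loop_map"
  by (intro env_hom.intro env_hom_axioms.intro loop.lie_ops_axioms TA.calg_axioms loop_map_linear)
    (rule loop_map_bracket[unfolded commutator_def])

end

end

lemma (in simple_tri_lie) gaudin_carrier:
  assumes "a \<in> gaudin G d xl xu n w c" shows "a \<in> carrier (env_pow G {0..n})"
proof -
  interpret P: env_power G "{0..n}" ..
  have fin: "finite {0..n}" by simp
  interpret h: env_hom "loop_minus G" "env_pow G {0..n}" "P.loop_map w c"
    by (rule P.loop_map_hom[OF fin])
  obtain u where "u \<in> carrier (env (loop_minus G))" "a = gaudin_eval G n w c u"
    using assms by (auto simp: gaudin_def universal_gaudin_def Let_def)
  moreover have "gaudin_eval G n w c = env_lift (loop_minus G) (env_pow G {0..n}) (P.loop_map w c)"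
    unfolding gaudin_eval_def Let_def P.loop_map_def[OF fin, abs_def] P.weighted_diag_def ..
  ultimately show ?thesis using linear_map_closed[OF h.env_lift_linear] by simp
qed

section \<open>Decomposition along the diagonal nilpotent subalgebra\<close>

locale trig_setup = simple_tri_lie G for G :: "'g tri_lie" (structure) +
  fixes n :: nat and lam :: "nat \<Rightarrow> 'g" and \<theta> :: 'g and \<alpha> :: "'g env set \<Rightarrow> complex"
  assumes \<theta>: "\<theta> \<in> cartan G" and \<alpha>: "verma_functional G \<theta> \<alpha>"
begin

abbreviation "mv_act \<equiv> tensor_act {0..n} (verma_irreps G \<theta> lam)"
abbreviation "v_act \<equiv> tensor_act {1..n} (irreps G lam)"
abbreviation "MV0 \<equiv> tensor {0..n} (verma_irreps G \<theta> lam)"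
abbreviation "V1 \<equiv> tensor {1..n} (irreps G lam)"
abbreviation "B0 \<equiv> tensor {0..n} (b_env_factors G)"
abbreviation "U0 \<equiv> env_pow G {0..n}"
abbreviation "U1 \<equiv> env_pow G {1..n}"
abbreviation "mv_pure \<equiv> pure {0..n} (verma_irreps G \<theta> lam)"
abbreviation "v_pure \<equiv> pure {1..n} (irreps G lam)"
abbreviation "b_pure \<equiv> pure {0..n} (b_env_factors G)"
abbreviation "u0_pure \<equiv> pure {0..n} (\<lambda>_. env G)"
abbreviation "u1_pure \<equiv> pure {1..n} (\<lambda>_. env G)"
abbreviation "eval_first \<equiv> functional_id G n lam \<alpha>"
abbreviation "incl_b \<equiv> b_incl G n"
abbreviation "char_first \<equiv> char_id G n \<theta>"

sublocale P0: env_power G "{0..n}" ..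
sublocale P1: env_power G "{1..n}" ..

lemma b_factor_cvec: "cvec (b_env_factors G i)"
  by (simp add: b_env_factors_def b.env.cvec_axioms U.env.cvec_axioms)

sublocale B: tensor_family "{0..n}" "b_env_factors G"
  by (rule tensor_family.intro) (rule b_factor_cvec)

lemma b_env_factors_simps: "b_env_factors G 0 = env (b_minus G)" "i \<noteq> 0 \<Longrightarrow> b_env_factors G i = env G"
  by (simp_all add: b_env_factors_def)

lemma irrep_module_axioms:
  shows "\<lbrakk>u \<in> carrier (env G); v \<in> carrier (env G); m \<in> carrier (irrep G \<nu>)\<rbrakk> \<Longrightarrow>
      act (irrep G \<nu>) (u \<otimes>\<^bsub>env G\<^esub> v) m = act (irrep G \<nu>) u (act (irrep G \<nu>) v m)"
    and "m \<in> carrier (irrep G \<nu>) \<Longrightarrow> linear_map (env G) (irrep G \<nu>) (\<lambda>u. act (irrep G \<nu>) u m)"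
    and "u \<in> carrier (env G) \<Longrightarrow> linear_map (irrep G \<nu>) (irrep G \<nu>) (act (irrep G \<nu>) u)"
  unfolding irrep_def
  by (rule U.env.cyclic_act_mult[OF irrep_left_ideal] U.env.cyclic_act_linear_left[OF irrep_left_ideal]
      U.env.cyclic_act_linear_right[OF irrep_left_ideal]; assumption)+

sublocale MV: tensor_module "{0..n}" "\<lambda>_. env G" "verma_irreps G \<theta> lam"
  by (intro tensor_module.intro tensor_action.intro tensor_family.intro tensor_action_axioms.intro
      tensor_module_axioms.intro P0.A.tensor_algebra_family_axioms U.env.cvec_axioms)
    (simp_all add: verma_irreps_def verma_cvec irrep_cvec verma_act_linear_left verma_act_linear_right
      verma_act_mult irrep_module_axioms split: if_splits)

sublocale V: tensor_module "{1..n}" "\<lambda>_. env G" "irreps G lam"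
  by (intro tensor_module.intro tensor_action.intro tensor_family.intro tensor_action_axioms.intro
      tensor_module_axioms.intro P1.A.tensor_algebra_family_axioms U.env.cvec_axioms)
    (simp_all add: irreps_def irrep_cvec irrep_module_axioms)

subsection \<open>Partial evaluation maps\<close>

lemma b_incl_multilinear:
  "multilinear {0..n} (b_env_factors G) U0
    (\<lambda>t. u0_pure (t(0 := b_env_map (t 0))))"
proof (rule multilinearI)
  fix t assume t: "t \<in> B.tuples"
  have t0: "b_env_map (t 0) \<in> carrier (env G)"
    using linear_map_closed[OF b_env_map_linear] PiE_mem[OF t, of 0] by (simp add: b_env_factors_simps)
  have tup: "t(0 := b_env_map (t 0)) \<in> P0.A.tuples"
    using t t0 by (auto simp: PiE_iff extensional_def b_env_factors_def)
  then show "u0_pure (t(0 := b_env_map (t 0))) \<in> carrier U0"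
    by (rule P0.A.pure_closed)
  fix i assume i: "i \<in> {0..n}"
  show "linear_map (b_env_factors G i) U0
      (\<lambda>x. u0_pure ((t(i := x))(0 := b_env_map ((t(i := x)) 0))))"
  proof (cases "i = 0")
    case True
    show ?thesis
      using linear_map_comp[OF b_env_map_linear multilinear_linear[OF P0.A.pure_multilinear tup, of 0]]
      by (simp add: True b_env_factors_simps)
  next
    case False
    show ?thesis
      using multilinear_linear[OF P0.A.pure_multilinear tup i] False
      by (simp add: b_env_factors_simps fun_upd_twist)
  qed
qed

sublocale b_incl: tensor_lift "{0..n}" "b_env_factors G" "U0"
    "\<lambda>t. u0_pure (t(0 := b_env_map (t 0)))"
  by (intro tensor_lift.intro tensor_lift_axioms.intro B.tensor_family_axioms P0.A.cvec_tensor b_incl_multilinear)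

lemma b_incl_linear: "linear_map (B0) U0 (incl_b)"
  unfolding b_incl_def by (rule b_incl.lift_linear)

lemma b_incl_pure:
  "t \<in> B.tuples \<Longrightarrow> incl_b (b_pure t) =
    u0_pure (t(0 := b_env_map (t 0)))"
  unfolding b_incl_def by (rule b_incl.lift_pure)

sublocale char_id: tensor_lift "{0..n}" "b_env_factors G" "U1"
    "\<lambda>t. b_char G \<theta> (t 0) \<odot>\<^bsub>U1\<^esub> u1_pure (restrict t {1..n})"
proof (intro tensor_lift.intro tensor_lift_axioms.intro B.tensor_family_axioms P1.A.cvec_tensor
    scalar_first_multilinear P1.A.tensor_family_axioms)
  show "linear_map (b_env_factors G 0) complex_alg (b_char G \<theta>)"
    by (simp add: b_env_factors_simps b_char_linear[OF \<theta>])
qed (simp add: b_env_factors_simps)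

lemma char_id_linear: "linear_map (B0) (U1) (char_first)"
  unfolding char_id_def Let_def by (rule char_id.lift_linear)

lemma char_id_pure:
  "t \<in> B.tuples \<Longrightarrow> char_first (b_pure t) =
    b_char G \<theta> (t 0) \<odot>\<^bsub>U1\<^esub> u1_pure (restrict t {1..n})"
  unfolding char_id_def Let_def by (rule char_id.lift_pure)

sublocale functional_id: tensor_lift "{0..n}" "verma_irreps G \<theta> lam" "V1"
    "\<lambda>t. \<alpha> (t 0) \<odot>\<^bsub>V1\<^esub> v_pure (restrict t {1..n})"
proof (intro tensor_lift.intro tensor_lift_axioms.intro MV.W.tensor_family_axioms V.W.cvec_tensor
    scalar_first_multilinear V.W.tensor_family_axioms)
  show "linear_map (verma_irreps G \<theta> lam 0) complex_alg \<alpha>"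
    by (simp add: verma_irreps_def functional_linear[OF \<theta> \<alpha>])
qed (simp add: irreps_def verma_irreps_def)

lemma functional_id_linear:
  "linear_map MV0 (V1) (eval_first)"
  unfolding functional_id_def Let_def by (rule functional_id.lift_linear)

lemma functional_id_pure:
  "t \<in> MV.W.tuples \<Longrightarrow> eval_first (mv_pure t) =
    \<alpha> (t 0) \<odot>\<^bsub>V1\<^esub> v_pure (restrict t {1..n})"
  unfolding functional_id_def Let_def by (rule functional_id.lift_pure)

text \<open>On pure tensors the two sides differ only in the factor \<open>0\<close>, where the left one has \<open>\<alpha> (b m)\<close> and the
  right one \<open>\<theta>(b) \<alpha> m\<close>.\<close>

lemma functional_id_b_incl:
  assumes p: "p \<in> carrier (B0)"
    and X: "X \<in> carrier MV0"
  shows "eval_first (mv_act (incl_b p) X) =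
    v_act (char_first p) (eval_first X)"
proof -
  note incl = linear_map_closed[OF b_incl_linear] and char = linear_map_closed[OF char_id_linear]
    and func = linear_map_closed[OF functional_id_linear]
  have pure_pure: "eval_first (mv_act
        (incl_b (b_pure t)) (mv_pure m)) =
      v_act (char_first (b_pure t))
        (eval_first (mv_pure m))"
    if t: "t \<in> B.tuples" and m: "m \<in> MV.W.tuples" for t m
  proof -
    let ?s = "t(0 := b_env_map (t 0))"
    have t0: "t 0 \<in> carrier (env (b_minus G))" using PiE_mem[OF t, of 0] by (simp add: b_env_factors_simps)
    have m0: "m 0 \<in> carrier (verma G \<theta>)" using PiE_mem[OF m, of 0] by (simp add: verma_irreps_def)
    have s: "?s \<in> P0.A.tuples"
      using t linear_map_closed[OF b_env_map_linear t0] by (auto simp: PiE_iff extensional_def b_env_factors_def)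
    have "t i \<in> carrier (env G)" if "i \<in> {1..n}" for i
      using PiE_mem[OF t, of i] that by (simp add: b_env_factors_simps)
    then have rt: "restrict t {1..n} \<in> P1.A.tuples" by simp
    have "m i \<in> carrier (irreps G lam i)" if "i \<in> {1..n}" for i
      using PiE_mem[OF m, of i] that by (simp add: verma_irreps_def irreps_def)
    then have rm: "restrict m {1..n} \<in> V.W.tuples" by simp
    have act0: "MV.tact ?s m 0 = act (verma G \<theta>) (b_env_map (t 0)) (m 0)"
      by (subst MV.tact_def) (simp add: verma_irreps_def)
    have act1: "restrict (MV.tact ?s m) {1..n} = V.tact (restrict t {1..n}) (restrict m {1..n})"
      unfolding MV.tact_def V.tact_def by (rule ext) (auto simp: verma_irreps_def irreps_def)
    note plin = V.tensor_act_linear_left[OF V.W.pure_closed[OF rm]]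
    have "eval_first (mv_act
        (incl_b (b_pure t)) (mv_pure m)) =
      (b_char G \<theta> (t 0) * \<alpha> (m 0)) \<odot>\<^bsub>V1\<^esub>
        v_pure (V.tact (restrict t {1..n}) (restrict m {1..n}))"
      by (simp only: b_incl_pure[OF t] MV.tensor_act_pure[OF s m] functional_id_pure[OF MV.tact_closed[OF s m]]
          act0 act1 functional_b_env[OF \<theta> \<alpha> t0 m0])
    also have "\<dots> = b_char G \<theta> (t 0) \<odot>\<^bsub>V1\<^esub> (\<alpha> (m 0) \<odot>\<^bsub>V1\<^esub>
        v_act (u1_pure (restrict t {1..n}))
          (v_pure (restrict m {1..n})))"
      by (simp only: V.tensor_act_pure[OF rt rm] functional_id.target.smult_smult[OF V.W.pure_closed[OF V.tact_closed[OF rt rm]]])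
    also have "\<alpha> (m 0) \<odot>\<^bsub>V1\<^esub>
        v_act (u1_pure (restrict t {1..n}))
          (v_pure (restrict m {1..n})) =
        v_act (u1_pure (restrict t {1..n}))
          (\<alpha> (m 0) \<odot>\<^bsub>V1\<^esub> v_pure (restrict m {1..n}))"
      by (rule linear_map_smult[OF V.tensor_act_linear_right[OF P1.A.pure_closed[OF rt]] V.W.pure_closed[OF rm], symmetric])
    also have "b_char G \<theta> (t 0) \<odot>\<^bsub>V1\<^esub> \<dots> =
        v_act (b_char G \<theta> (t 0) \<odot>\<^bsub>U1\<^esub> u1_pure (restrict t {1..n}))
          (\<alpha> (m 0) \<odot>\<^bsub>V1\<^esub> v_pure (restrict m {1..n}))"
      by (rule linear_map_smult[OF V.tensor_act_linear_left[OF functional_id.target.smult_carrier[OF V.W.pure_closed[OF rm]]]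
            P1.A.pure_closed[OF rt], symmetric])
    finally show ?thesis by (simp only: char_id_pure[OF t] functional_id_pure[OF m])
  qed
  have pure_X: "eval_first (mv_act
        (incl_b (b_pure t)) X) =
      v_act (char_first (b_pure t)) (eval_first X)"
    if t: "t \<in> B.tuples" for t
    by (rule MV.W.tensor_linear_eq[OF
          linear_map_comp[OF MV.tensor_act_linear_right[OF incl[OF B.pure_closed[OF t]]] functional_id_linear]
          linear_map_comp[OF functional_id_linear V.tensor_act_linear_right[OF char[OF B.pure_closed[OF t]]]]
          V.W.cvec_tensor pure_pure[OF t] X])
  show ?thesis
    by (rule B.tensor_linear_eq[OF
          linear_map_comp[OF linear_map_comp[OF b_incl_linear MV.tensor_act_linear_left[OF X]] functional_id_linear]
          linear_map_comp[OF char_id_linear V.tensor_act_linear_left[OF func[OF X]]]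
          V.W.cvec_tensor pure_X p])
qed

subsection \<open>Existence of the decomposition\<close>

abbreviation "J \<equiv> gen_left_ideal U0 (diag G {0..n} ` n_plus G)"

lemma diag_closed: "x \<in> carrier G \<Longrightarrow> diag G {0..n} x \<in> carrier U0"
  unfolding diag_def by (rule P0.TA.M.finsum_closed) (auto intro: P0.factor_closed)

lemma diag_n_plus_carrier: "diag G {0..n} ` n_plus G \<subseteq> carrier U0"
  using diag_closed n_plus_carrier by blast

lemma J_left_ideal: "left_ideal J U0"
  by (rule P0.TA.gen_left_ideal_left_ideal[OF diag_n_plus_carrier])

lemma J_submodule: "submodule J complex_alg U0"
  by (rule P0.TA.left_ideal_submodule[OF J_left_ideal])

definition decomposable :: "((nat \<Rightarrow> 'g env) \<Rightarrow> complex) set set" where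
  "decomposable = {incl_b p \<oplus>\<^bsub>U0\<^esub> q | p q. p \<in> carrier (B0) \<and> q \<in> J}"

lemma decomposable_submodule: "submodule decomposable complex_alg U0"
proof (rule P0.TA.subspaceI)
  interpret TB: cvec B0 by (rule B.cvec_tensor)
  note incl = linear_map_closed[OF b_incl_linear]
  have Jc: "q \<in> carrier U0" if "q \<in> J" for q
    using that P0.TA.submoduleE(1)[OF J_submodule] by blast
  have J0: "\<zero>\<^bsub>U0\<^esub> \<in> J" by (rule P0.TA.submodule_zero[OF J_submodule])
  show "decomposable \<subseteq> carrier U0"
    unfolding decomposable_def using incl Jc by auto
  have "\<zero>\<^bsub>U0\<^esub> = incl_b \<zero>\<^bsub>B0\<^esub> \<oplus>\<^bsub>U0\<^esub> \<zero>\<^bsub>U0\<^esub>"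
    by (simp add: linear_map_zero[OF B.cvec_tensor P0.A.cvec_tensor b_incl_linear])
  then show "\<zero>\<^bsub>U0\<^esub> \<in> decomposable"
    unfolding decomposable_def using J0 TB.M.zero_closed by blast
next
  interpret TB: cvec B0 by (rule B.cvec_tensor)
  note incl = linear_map_closed[OF b_incl_linear]
  have Jc: "q \<in> carrier U0" if "q \<in> J" for q
    using that P0.TA.submoduleE(1)[OF J_submodule] by blast
  fix u assume "u \<in> decomposable"
  then obtain p q where u: "u = incl_b p \<oplus>\<^bsub>U0\<^esub> q"
    "p \<in> carrier (B0)" "q \<in> J" unfolding decomposable_def by blast
  fix c
  have "c \<odot>\<^bsub>U0\<^esub> u = incl_b (c \<odot>\<^bsub>B0\<^esub> p) \<oplus>\<^bsub>U0\<^esub>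
      (c \<odot>\<^bsub>U0\<^esub> q)"
    using u(2,3) incl Jc by (simp add: u(1) P0.TA.smult_add_right linear_map_smult[OF b_incl_linear])
  moreover have "c \<odot>\<^bsub>U0\<^esub> q \<in> J" using P0.TA.submoduleE(4)[OF J_submodule, of c q] u(3) by simp
  ultimately show "c \<odot>\<^bsub>U0\<^esub> u \<in> decomposable"
    unfolding decomposable_def using TB.smult_carrier[OF u(2)] by blast
  fix v assume "v \<in> decomposable"
  then obtain p' q' where v: "v = incl_b p' \<oplus>\<^bsub>U0\<^esub> q'"
    "p' \<in> carrier (B0)" "q' \<in> J" unfolding decomposable_def by blast
  have "u \<oplus>\<^bsub>U0\<^esub> v = incl_b (p \<oplus>\<^bsub>B0\<^esub> p') \<oplus>\<^bsub>U0\<^esub>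
      (q \<oplus>\<^bsub>U0\<^esub> q')"
    using u(2,3) v(2,3) incl Jc by (simp add: u(1) v(1) linear_map_add[OF b_incl_linear] P0.TA.M.a_ac)
  moreover have "q \<oplus>\<^bsub>U0\<^esub> q' \<in> J" by (rule P0.TA.submoduleE(5)[OF J_submodule u(3) v(3)])
  ultimately show "u \<oplus>\<^bsub>U0\<^esub> v \<in> decomposable"
    unfolding decomposable_def using TB.M.a_closed[OF u(2) v(2)] by blast
qed

lemma J_decomposable: "J \<subseteq> decomposable"
proof
  interpret TB: cvec B0 by (rule B.cvec_tensor)
  fix q assume q: "q \<in> J"
  then have "q \<in> carrier U0" using P0.TA.submoduleE(1)[OF J_submodule] by blast
  then have "q = incl_b \<zero>\<^bsub>B0\<^esub> \<oplus>\<^bsub>U0\<^esub> q"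
    by (simp add: linear_map_zero[OF B.cvec_tensor P0.A.cvec_tensor b_incl_linear])
  then show "q \<in> decomposable" unfolding decomposable_def using q TB.M.zero_closed by blast
qed

lemma b_incl_decomposable:
  assumes "p \<in> carrier (B0)" shows "incl_b p \<in> decomposable"
proof -
  have J0: "\<zero>\<^bsub>U0\<^esub> \<in> J" by (rule P0.TA.submodule_zero[OF J_submodule])
  have "incl_b p = incl_b p \<oplus>\<^bsub>U0\<^esub> \<zero>\<^bsub>U0\<^esub>"
    using linear_map_closed[OF b_incl_linear assms] by simp
  then show ?thesis unfolding decomposable_def using assms J0 by blast
qed

text \<open>Induction on the number of letters from \<open>\<nn>\<^sub>+\<close> in factor \<open>0\<close>. A last letter \<open>x\<close> is removed with
  \<open>x\<^sup>(\<^sup>0\<^sup>) = \<Delta>(x) - (x\<^sup>(\<^sup>1\<^sup>) + \<dots> + x\<^sup>(\<^sup>n\<^sup>))\<close>, multiplied from the right: \<open>\<Delta>(x)\<close> contributes an element of the left ideal,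
  and the other terms multiply \<open>x\<close> into other factors. These change, so \<open>s\<close> is arbitrary
  in the induction.\<close>

lemma word_decomposable:
  assumes "cs \<in> lists (n_plus G)" and hs: "hs \<in> lists (cartan G \<union> neg_root_vectors)" and "s \<in> P0.A.tuples"
  shows "u0_pure (s(0 := U.word (hs @ cs))) \<in> decomposable"
  using assms(1,3)
proof (induction cs arbitrary: s rule: rev_induct)
  case Nil
  have "h \<in> carrier (b_minus G)" if "h \<in> cartan G \<union> neg_root_vectors" for h
    using that
  proof
    assume h: "h \<in> cartan G"
    then have "h = h \<oplus> \<zero>" by (simp add: cartan_carrier)
    then show ?thesis unfolding b_minus_carrier using h n_minus_zero by blast
  next
    assume "h \<in> neg_root_vectors"
    then have h: "h \<in> n_minus G" using neg_root_vectors_n_minus by blast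
    then have "h = \<zero> \<oplus> h" by (simp add: n_minus_carrier)
    then show ?thesis unfolding b_minus_carrier using h cartan_zero by blast
  qed
  then have hb: "hs \<in> lists (carrier (b_minus G))" using hs by auto
  have t: "s(0 := b.word hs) \<in> B.tuples"
    using Nil.prems(2) b.word_closed[OF hb] by (auto simp: PiE_iff extensional_def b_env_factors_def)
  have "incl_b (b_pure (s(0 := b.word hs))) = u0_pure (s(0 := U.word (hs @ [])))"
    unfolding b_incl_pure[OF t] by (simp add: b_env_map_word[OF hb])
  then show ?case using b_incl_decomposable[OF B.pure_closed[OF t]] by (simp only:)
next
  case (snoc x cs)
  have x: "x \<in> n_plus G" "x \<in> carrier G" and cs: "cs \<in> lists (n_plus G)"
    using snoc.prems(1) n_plus_carrier by auto
  have "hs \<in> lists (carrier G)" "cs \<in> lists (carrier G)"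
    using subsetD[OF lists_mono[OF cartan_neg_carrier] hs] subsetD[OF lists_mono[OF n_plus_carrier] cs] by simp_all
  then have hc: "hs @ cs \<in> lists (carrier G)" by simp
  let ?w = "U.word (hs @ cs)" and ?A = "U0"
  let ?P = "u0_pure (s(0 := ?w))"
  have w: "?w \<in> carrier (env G)" by (rule U.word_closed[OF hc])
  have sw: "s(0 := ?w) \<in> P0.A.tuples" by (rule P0.A.tuple_upd[OF snoc.prems(2) _ w]) simp
  have P: "?P \<in> carrier ?A" by (rule P0.A.pure_closed[OF sw])
  have fc: "(\<lambda>i. factor G {0..n} i x) \<in> {0..n} \<rightarrow> carrier ?A" using P0.factor_closed x by blast
  have mc: "?P \<otimes>\<^bsub>?A\<^esub> factor G {0..n} i x \<in> carrier ?A" if "i \<in> {0..n}" for i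
    using P0.factor_closed[OF that x(2)] P by simp
  have "U.word (hs @ cs @ [x]) = ?w \<otimes>\<^bsub>env G\<^esub> env_inc G x"
    using U.word_append[OF hc, of "[x]"] x by (simp add: U.env_inc_eq)
  then have goal: "u0_pure (s(0 := U.word (hs @ cs @ [x]))) = ?P \<otimes>\<^bsub>?A\<^esub> factor G {0..n} 0 x"
    using P0.pure_mult_factor[OF sw _ x(2), of 0] by simp
  have range: "{0..n} = insert 0 {1..n}" by auto
  have "?P \<otimes>\<^bsub>?A\<^esub> diag G {0..n} x = (\<Oplus>\<^bsub>?A\<^esub>i\<in>{0..n}. ?P \<otimes>\<^bsub>?A\<^esub> factor G {0..n} i x)"
    unfolding diag_def
    by (rule linear_map_finsum[OF P0.A.cvec_tensor P0.A.cvec_tensor P0.TA.mult_left_linear[OF P] _ fc]) simp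
  also have "\<dots> = (\<Oplus>\<^bsub>?A\<^esub>i\<in>insert 0 {1..n}. ?P \<otimes>\<^bsub>?A\<^esub> factor G {0..n} i x)"
    by (rule arg_cong[OF range])
  also have "\<dots> = ?P \<otimes>\<^bsub>?A\<^esub> factor G {0..n} 0 x \<oplus>\<^bsub>?A\<^esub> (\<Oplus>\<^bsub>?A\<^esub>i\<in>{1..n}. ?P \<otimes>\<^bsub>?A\<^esub> factor G {0..n} i x)"
    using mc by (intro P0.TA.M.finsum_insert) auto
  finally have D: "?P \<otimes>\<^bsub>?A\<^esub> diag G {0..n} x =
    ?P \<otimes>\<^bsub>?A\<^esub> factor G {0..n} 0 x \<oplus>\<^bsub>?A\<^esub> (\<Oplus>\<^bsub>?A\<^esub>i\<in>{1..n}. ?P \<otimes>\<^bsub>?A\<^esub> factor G {0..n} i x)" .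
  let ?R = "\<Oplus>\<^bsub>?A\<^esub>i\<in>{1..n}. ?P \<otimes>\<^bsub>?A\<^esub> factor G {0..n} i x"
  have "diag G {0..n} x \<in> J" using x(1) by (intro subsetD[OF P0.TA.gen_left_ideal_superset] imageI)
  then have "?P \<otimes>\<^bsub>?A\<^esub> diag G {0..n} x \<in> J" using J_left_ideal P by (simp add: left_ideal_def)
  then have 1: "?P \<otimes>\<^bsub>?A\<^esub> diag G {0..n} x \<in> decomposable" using J_decomposable by blast
  have each: "?P \<otimes>\<^bsub>?A\<^esub> factor G {0..n} i x \<in> decomposable" if i: "i \<in> {1..n}" for i
  proof -
    have i0: "i \<in> {0..n}" "i \<noteq> 0" using i by auto
    have si: "s i \<otimes>\<^bsub>env G\<^esub> env_inc G x \<in> carrier (env G)"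
      using snoc.prems(2) i0 U.env_inc_closed[OF x(2)] by (auto simp: PiE_iff)
    have "?P \<otimes>\<^bsub>?A\<^esub> factor G {0..n} i x =
        u0_pure ((s(i := s i \<otimes>\<^bsub>env G\<^esub> env_inc G x))(0 := ?w))"
      using P0.pure_mult_factor[OF sw i0(1) x(2)] i0(2) by (simp add: fun_upd_twist)
    then show ?thesis using snoc.IH[OF cs P0.A.tuple_upd[OF snoc.prems(2) i0(1) si]] by (simp only:)
  qed
  have sum_in: "(\<Oplus>\<^bsub>?A\<^esub>i\<in>S. ?P \<otimes>\<^bsub>?A\<^esub> factor G {0..n} i x) \<in> decomposable" if "finite S" "S \<subseteq> {1..n}" for S
    using that
  proof induction
    case empty
    show ?case by (simp add: P0.TA.submodule_zero[OF decomposable_submodule])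
  next
    case (insert i S)
    then have "(\<Oplus>\<^bsub>?A\<^esub>j\<in>insert i S. ?P \<otimes>\<^bsub>?A\<^esub> factor G {0..n} j x) =
        ?P \<otimes>\<^bsub>?A\<^esub> factor G {0..n} i x \<oplus>\<^bsub>?A\<^esub> (\<Oplus>\<^bsub>?A\<^esub>j\<in>S. ?P \<otimes>\<^bsub>?A\<^esub> factor G {0..n} j x)"
      by (intro P0.TA.M.finsum_insert) (auto intro!: mc)
    also have "\<dots> \<in> decomposable"
      using insert.prems by (intro P0.TA.submoduleE(5)[OF decomposable_submodule] each insert.IH) auto
    finally show ?case .
  qed
  have R: "?R \<in> decomposable" by (rule sum_in) simp_all
  then have Rc: "?R \<in> carrier ?A" using P0.TA.submoduleE(1)[OF decomposable_submodule] by blast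
  have "?P \<otimes>\<^bsub>?A\<^esub> factor G {0..n} 0 x = ?P \<otimes>\<^bsub>?A\<^esub> diag G {0..n} x \<oplus>\<^bsub>?A\<^esub> \<ominus>\<^bsub>?A\<^esub> ?R"
    unfolding D using Rc mc[of 0] by (simp add: P0.TA.M.a_assoc P0.TA.M.r_neg)
  also have "\<dots> \<in> decomposable"
    by (intro P0.TA.submoduleE(5)[OF decomposable_submodule 1] P0.TA.submoduleE(3)[OF decomposable_submodule R])
  finally show ?case unfolding goal .
qed

lemma decomposable_all:
  assumes "u \<in> carrier U0" shows "u \<in> decomposable"
  using assms
proof (induction rule: P0.A.tensor_induct)
  case zero
  show ?case by (rule P0.TA.submodule_zero[OF decomposable_submodule])
next
  case (add u v)
  then show ?case by (intro P0.TA.submoduleE(5)[OF decomposable_submodule])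
next
  case (smult c u)
  then show ?case using P0.TA.submoduleE(4)[OF decomposable_submodule, of c u] by simp
next
  case (pure t)
  have z: "0 \<in> {0..n}" by simp
  note lin = multilinear_linear[OF P0.A.pure_multilinear pure z]
  have "u0_pure (t(0 := u)) \<in> decomposable" if "u \<in> carrier (env G)" for u
    using that
  proof (induction rule: env_triangular_induct)
    case zero
    show ?case
      unfolding linear_map_zero[OF U.env.cvec_axioms P0.A.cvec_tensor lin]
      by (rule P0.TA.submodule_zero[OF decomposable_submodule])
  next
    case (add u v)
    show ?case
      unfolding linear_map_add[OF lin add.hyps] by (rule P0.TA.submoduleE(5)[OF decomposable_submodule add.IH])
  next
    case (smult c u)
    show ?case
      unfolding linear_map_smult[OF lin smult.hyps]
      by (rule P0.TA.submoduleE(4)[OF decomposable_submodule _ smult.IH]) simp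
  next
    case (word hs cs)
    then show ?case using word_decomposable pure by blast
  qed
  from this[of "t 0"] show ?case using pure z by (auto simp: PiE_iff)
qed

lemma b_component_exists:
  assumes "u \<in> carrier U0"
  shows "b_component G n u \<in> carrier (B0)"
    and "\<exists>q\<in>J. u = incl_b (b_component G n u) \<oplus>\<^bsub>U0\<^esub> q"
proof -
  have "\<exists>p. p \<in> carrier (B0) \<and> (\<exists>q\<in>J. u = incl_b p \<oplus>\<^bsub>U0\<^esub> q)"
    using decomposable_all[OF assms] unfolding decomposable_def by blast
  from someI_ex[OF this] show "b_component G n u \<in> carrier (B0)"
    "\<exists>q\<in>J. u = incl_b (b_component G n u) \<oplus>\<^bsub>U0\<^esub> q"
    unfolding b_component_def by blast+
qed

section \<open>The transported action\<close>

text \<open>The heart of the proof: on a vector annihilated by \<open>\<Delta>(\<nn>\<^sub>+)\<close>, the element \<open>a\<close> may be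
  replaced by its component in \<open>U \<bb>\<^sub>- \<otimes> U \<gg>\<^sup>\<otimes>\<^sup>n\<close>, which passes through \<open>\<alpha> \<otimes> id\<close> by the eigenfunctional property.\<close>

lemma functional_id_singular:
  assumes a: "a \<in> carrier U0" and X: "X \<in> carrier MV0"
    and sing: "\<And>x. x \<in> n_plus G \<Longrightarrow> mv_act (diag G {0..n} x) X =
      \<zero>\<^bsub>MV0\<^esub>"
  shows "eval_first (mv_act a X) =
    v_act (psi G n \<theta> a) (eval_first X)"
proof -
  interpret T: cvec MV0 by (rule MV.W.cvec_tensor)
  note p = b_component_exists(1)[OF a]
  obtain q where q: "q \<in> J" "a = incl_b (b_component G n a) \<oplus>\<^bsub>U0\<^esub> q"
    using b_component_exists(2)[OF a] by blast
  have qc: "q \<in> carrier U0" using q(1) P0.TA.submoduleE(1)[OF J_submodule] by blast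
  have "mv_act q X = \<zero>\<^bsub>MV0\<^esub>"
    by (rule MV.gen_left_ideal_annihilates[OF X diag_n_plus_carrier _ q(1)]) (use sing in blast)
  moreover note pc = linear_map_closed[OF b_incl_linear p]
  ultimately have "mv_act a X =
      mv_act (incl_b (b_component G n a)) X"
    by (subst q(2), subst linear_map_add[OF MV.tensor_act_linear_left[OF X] pc qc])
      (simp add: MV.tensor_act_closed[OF pc X])
  then show ?thesis unfolding psi_def by (simp only: functional_id_b_incl[OF p X])
qed

text \<open>The image of the highest weight vector under a homomorphism is annihilated by \<open>\<Delta>(\<nn>\<^sub>+)\<close>.\<close>

lemma transported_act_eq:
  assumes a: "a \<in> carrier U0"
    and bij: "bij_betw (pi_map G n lam \<mu> \<theta> \<alpha>) (verma_homs G n lam \<mu> \<theta>) (V_weight G n lam \<mu>)"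
    and v: "v \<in> V_weight G n lam \<mu>"
  shows "transported_act G n lam \<mu> \<theta> \<alpha> a v = v_act (psi G n \<theta> a) v"
proof -
  define \<phi> where "\<phi> = inv_into (verma_homs G n lam \<mu> \<theta>) (pi_map G n lam \<mu> \<theta> \<alpha>) v"
  have im: "v \<in> pi_map G n lam \<mu> \<theta> \<alpha> ` verma_homs G n lam \<mu> \<theta>"
    using bij v by (simp add: bij_betw_def)
  have \<phi>: "\<phi> \<in> verma_homs G n lam \<mu> \<theta>" "pi_map G n lam \<mu> \<theta> \<alpha> \<phi> = v"
    unfolding \<phi>_def using inv_into_into[OF im] f_inv_into_f[OF im] by auto
  let ?M = "verma G (\<theta> \<oplus> \<mu>)" and ?T = MV0
  let ?m = "verma_vec G (\<theta> \<oplus> \<mu>)"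
  have lin: "linear_map ?M ?T \<phi>"
    and hom: "\<And>x m. \<lbrakk>x \<in> carrier G; m \<in> carrier ?M\<rbrakk> \<Longrightarrow>
      \<phi> (act ?M (env_inc G x) m) = mv_act (diag G {0..n} x) (\<phi> m)"
    using \<phi>(1) by (auto simp: verma_homs_def lie_hom_def)
  have X: "\<phi> ?m \<in> carrier ?T" by (rule linear_map_closed[OF lin verma_vec_closed])
  have sing: "mv_act (diag G {0..n} x) (\<phi> ?m) = \<zero>\<^bsub>?T\<^esub>" if "x \<in> n_plus G" for x
    using hom[of x ?m] that n_plus_carrier verma_vec_closed[of "\<theta> \<oplus> \<mu>"] verma_vec_n_plus[OF that, of "\<theta> \<oplus> \<mu>"]
      linear_map_zero[OF verma_cvec MV.W.cvec_tensor lin] by auto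
  have "transported_act G n lam \<mu> \<theta> \<alpha> a v =
      eval_first (mv_act a (\<phi> ?m))"
    unfolding transported_act_def \<phi>_def[symmetric] pi_map_def post_comp_def
    by (simp add: verma_vec_closed)
  also have "\<dots> = v_act (psi G n \<theta> a) (eval_first (\<phi> ?m))"
    by (rule functional_id_singular[OF a X sing])
  also have "eval_first (\<phi> ?m) = v"
    using \<phi>(2) by (simp add: pi_map_def)
  finally show ?thesis .
qed

end

theorem theorem5p13:
  fixes G :: "'g tri_lie" and d n :: nat and xl xu lam :: "nat \<Rightarrow> 'g" and z :: "nat \<Rightarrow> complex"
    and c :: complex and mu theta :: 'g and alpha :: "'g env set \<Rightarrow> complex"
  assumes "simple_tri_lie G"
    and "dual_bases G d xl xu"
    and "inj_on z {1..n}" and "\<forall>i\<in>{1..n}. z i \<noteq> 0"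
    and "c \<notin> insert 0 (z ` {1..n})"
    and "\<forall>i\<in>{1..n}. dominant_integral_weight G (lam i)"
    and "integral_weight G mu"
    and "theta \<in> cartan G"
    and "verma_functional G theta alpha"
    and generic: "bij_betw (pi_map G n lam mu theta alpha) (verma_homs G n lam mu theta) (V_weight G n lam mu)"
  shows "\<forall>a\<in>gaudin G d xl xu n (z(0 := 0)) c.
           psi G n theta a \<in> trig_gaudin G d xl xu n theta z c \<and>
           (\<forall>v\<in>V_weight G n lam mu.
              transported_act G n lam mu theta alpha a v
                = tensor_act {1..n} (irreps G lam) (psi G n theta a) v)"
proof (intro ballI conjI)
  interpret simple_tri_lie G by fact
  interpret trig_setup G n lam theta alpha
    by unfold_locales (use assms in auto)
  fix a assume a: "a \<in> gaudin G d xl xu n (z(0 := 0)) c"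
  then show "psi G n theta a \<in> trig_gaudin G d xl xu n theta z c"
    by (simp add: trig_gaudin_def)
  fix v assume "v \<in> V_weight G n lam mu"
  then show "transported_act G n lam mu theta alpha a v = tensor_act {1..n} (irreps G lam) (psi G n theta a) v"
    by (rule transported_act_eq[OF gaudin_carrier[OF a] generic])
qed

end
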